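(* Let $D\subset\mathbb{R}^3$ be compact with $O\notin D$, such that either $D$ is contained in a plane or $D$ is countable, and let $M=\max_{P\in D}OP$. Let $\Omega\subseteq S^2$ with $|\partial\Omega|=0$, let $f\in L^1(\bar\Omega)$ with $f>0$ a.e., and let $\eta$ be a Radon measure on $D$. Let $\delta>0$, $c_\delta=-\delta+\sqrt{1+\delta^2}$, $k\ge\frac{1+c_\delta}{1-c_\delta}$, and assume $$\int_{\bar\Omega}f(x)\,dx\ \ge\ \frac{1}{C(\delta,k\delta,M)}\,\eta(D),\qquad C(\delta,k\delta,M)=\frac{(1-c_\delta)^3}{(1+c_\delta)(k\delta M)^2}.$$ Then for every $P_0$ in the support of $\eta$ there exists a reflector $\sigma=\{\rho(x)x\}_{x\in\bar\Omega}$ from $\bar\Omega$ to $D$ in the class $\mathcal A(\delta)$ such that $$\eta(E)\le\int_{\tau_\sigma(E)}f(x)\,\frac{x\cdot\nu_\rho(x)}{\rho(x)^2}\,dx\quad\text{for each Borel set }E\subseteq D,$$ $$\eta(E)=\int_{\tau_\sigma(E)}f(x)\,\frac{x\cdot\nu_\rho(x)}{\rho(x)^2}\,dx\quad\text{for each Borel set }E\subseteq D\text{ with }P_0\notin E,$$ and $\frac{\delta M}{1+c_\delta}\le\rho(x)\le\frac{k\delta M}{1-c_\delta}$ for all $x\in\bar\Omega$.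
   Context: $S^2$ is the unit sphere of $\mathbb{R}^3$ centered at the origin $O$; $dx$ and $|\cdot|$ denote surface (Lebesgue) measure on $S^2$; $\bar\Omega$, $\partial\Omega$ are closure and boundary in $S^2$. For $P\ne O$ write $OP=|P|$ and $m_P=P/|P|$. For $d>0$, $E_d(P)$ is the ellipsoid of revolution with foci $O$ and $P$ with polar radius $\rho_d(x)=\frac{d}{1-\varepsilon\,x\cdot m_P}$, $x\in S^2$, where $\varepsilon=\sqrt{1+\frac{d^2}{OP^2}}-\frac{d}{OP}\in(0,1)$ is its eccentricity ($\rho_d$ also depends on $P$). A surface $\sigma=\{\rho(x)x\}_{x\in\bar\Omega}$, $\rho>0$, is a reflector from $\bar\Omega$ to $D$ if for each $x_0\in\bar\Omega$ there is an ellipsoid $E_d(P)$ with $P\in D$ that supports $\sigma$ at $\rho(x_0)x_0$, i.e. $\rho(x)\le\rho_d(x)$ for all $x\in\bar\Omega$ with equality at $x=x_0$. For $P\in D$, $\tau_\sigma(P)$ is the set of $x_0\in\bar\Omega$ such that some $E_d(P)$ supports $\sigma$ at $\rho(x_0)x_0$; for $E\subseteq D$, $\tau_\sigma(E)=\bigcup_{P\in E}\tau_\sigma(P)$ (Lebesgue measurable for $E$ Borel). $\mathcal A(\delta)$ is the set of reflectors $\sigma$ from $\bar\Omega$ to $D$ such that for each $x_0\in\bar\Omega$ there is a supporting ellipsoid $E_d(P)$ to $\sigma$ at $\rho(x_0)x_0$ with $P\in D$ and $d\ge\delta M$. $\nu_\rho(x)$ is the outer unit normal to $\sigma$ at $\rho(x)x$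 (defined for a.e. $x\in\bar\Omega$; a.e. it equals $\frac{x-\varepsilon m_P}{|x-\varepsilon m_P|}$ where $E_d(P)$ is the supporting ellipsoid at that point and $\varepsilon$ its eccentricity). *)

theory Defs
  imports "HOL-Analysis.Analysis"
begin

type_synonym point = "real^3"

abbreviation S2 :: "point set" where
  "S2 \<equiv> sphere 0 1"

text \<open>Lebesgue surface measure on the unit sphere: polar coordinates give
  \<open>|A| = 3 * vol {r x. x \<in> A, 0 < r \<le> 1}\<close>, so it is three times the image of the volume on the
  punctured unit ball under radial projection; completed, so that its measurable sets are the
  Lebesgue measurable subsets of the sphere.\<close>

definition surface_borel :: "point measure" where
  "surface_borel = scale_measure 3
     (distr (restrict_space lborel (cball 0 1 - {0})) (restrict_space borel S2) (\<lambda>y. y /\<^sub>R norm y))"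

definition surface :: "point measure" where
  "surface = completion surface_borel"

lemma space_surface: "space surface = S2"
  by (simp add: surface_def surface_borel_def space_scale_measure space_restrict_space)

lemma emeasure_surface_borel:
  assumes "A \<in> sets borel" "A \<subseteq> S2"
  shows "emeasure surface A = 3 * emeasure lborel {y \<in> cball 0 1 - {0}. y /\<^sub>R norm y \<in> A}"
proof -
  have A: "A \<in> sets (restrict_space borel S2)"
    using assms by (auto simp: sets_restrict_space)
  have "continuous_on (cball 0 1 - {0}) (\<lambda>y::point. y /\<^sub>R norm y)"
    by (intro continuous_intros) auto
  then have m: "(\<lambda>y. y /\<^sub>R norm y) \<in> restrict_space lborel (cball 0 1 - {0}) \<rightarrow>\<^sub>M restrict_space borel S2"
    by (intro measurable_restrict_space2)
       (auto simp: space_restrict_space intro: borel_measurable_continuous_on_restrict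
             cong: measurable_cong_sets restrict_space_sets_cong)
  have "emeasure surface A = emeasure surface_borel A"
    using A by (simp add: surface_def surface_borel_def)
  also have "\<dots> = 3 * emeasure (restrict_space lborel (cball 0 1 - {0}))
                        ((\<lambda>y. y /\<^sub>R norm y) -` A \<inter> (cball 0 1 - {0}))"
    using A m by (simp add: surface_borel_def emeasure_distr space_restrict_space)
  also have "(\<lambda>y. y /\<^sub>R norm y) -` A \<inter> (cball 0 1 - {0}) = {y \<in> cball 0 1 - {0}. y /\<^sub>R norm y \<in> A}"
    by auto
  also have "emeasure (restrict_space lborel (cball 0 1 - {0})) \<dots> = emeasure lborel \<dots>"
    by (rule emeasure_restrict_space) auto
  finally show ?thesis .
qed

lemma emeasure_surface_S2: "emeasure surface S2 = 4 * pi"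
proof -
  have "{y \<in> cball 0 1 - {0}. y /\<^sub>R norm y \<in> S2} = cball (0::point) 1 - {0}"
    by auto
  then have "emeasure surface S2 = 3 * emeasure lborel (cball (0::point) 1 - {0})"
    by (simp add: emeasure_surface_borel)
  also have "emeasure lborel (cball (0::point) 1 - {0}) = emeasure lborel (cball (0::point) 1)"
    by (simp add: emeasure_Diff emeasure_cball)
  also have "\<dots> = ennreal (4 / 3 * pi)"
    by (simp add: emeasure_cball unit_ball_vol_3)
  also have "3 * \<dots> = ennreal (3 * (4 / 3 * pi))"
    by (subst ennreal_mult') simp_all
  finally show ?thesis by simp
qed

definition radon_measure_on :: "point set \<Rightarrow> point measure \<Rightarrow> bool" where
  "radon_measure_on D \<eta> \<longleftrightarrow>
     sets \<eta> = sets (restrict_space borel D) \<and>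
     (\<forall>K. compact K \<and> K \<subseteq> D \<longrightarrow> emeasure \<eta> K < \<infinity>) \<and>
     (\<forall>E\<in>sets \<eta>. emeasure \<eta> E = (SUP K\<in>{K. compact K \<and> K \<subseteq> E}. emeasure \<eta> K))"

definition measure_support :: "point set \<Rightarrow> point measure \<Rightarrow> point set" where
  "measure_support D \<eta> = {P \<in> D. \<forall>U. open U \<and> P \<in> U \<longrightarrow> emeasure \<eta> (U \<inter> D) > 0}"

definition eccentricity :: "point \<Rightarrow> real \<Rightarrow> real" where
  "eccentricity P d = sqrt (1 + d\<^sup>2 / (norm P)\<^sup>2) - d / norm P"

definition polar_radius :: "point \<Rightarrow> real \<Rightarrow> point \<Rightarrow> real" where
  "polar_radius P d x = d / (1 - eccentricity P d * (x \<bullet> (P /\<^sub>R norm P)))"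

text \<open>In what follows \<open>X\<close> is the closure of \<open>\<Omega>\<close> and the surface
  \<open>{\<rho> x x | x \<in> X}\<close> is represented by its radial function \<open>\<rho>\<close>, of which only the values on \<open>X\<close>
  matter.\<close>

definition surface_of :: "point set \<Rightarrow> (point \<Rightarrow> real) \<Rightarrow> point set" where
  "surface_of X \<rho> = (\<lambda>x. \<rho> x *\<^sub>R x) ` X"

definition supports_at :: "point set \<Rightarrow> (point \<Rightarrow> real) \<Rightarrow> point \<Rightarrow> real \<Rightarrow> point \<Rightarrow> bool" where
  "supports_at X \<rho> P d x\<^sub>0 \<longleftrightarrow>
     d > 0 \<and> (\<forall>x\<in>X. \<rho> x \<le> polar_radius P d x) \<and> \<rho> x\<^sub>0 = polar_radius P d x\<^sub>0"

definition reflector :: "point set \<Rightarrow> point set \<Rightarrow> (point \<Rightarrow> real) \<Rightarrow> bool" where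
  "reflector X D \<rho> \<longleftrightarrow>
     (\<forall>x\<in>X. \<rho> x > 0) \<and> (\<forall>x\<^sub>0\<in>X. \<exists>P\<in>D. \<exists>d. supports_at X \<rho> P d x\<^sub>0)"

definition reflector_class :: "point set \<Rightarrow> point set \<Rightarrow> real \<Rightarrow> real \<Rightarrow> (point \<Rightarrow> real) set" where
  "reflector_class X D M \<delta> =
     {\<rho>. reflector X D \<rho> \<and> (\<forall>x\<^sub>0\<in>X. \<exists>P\<in>D. \<exists>d. supports_at X \<rho> P d x\<^sub>0 \<and> d \<ge> \<delta> * M)}"

definition tau :: "point set \<Rightarrow> (point \<Rightarrow> real) \<Rightarrow> point set \<Rightarrow> point set" where
  "tau X \<rho> E = (\<Union>P\<in>E. {x\<^sub>0 \<in> X. \<exists>d. supports_at X \<rho> P d x\<^sub>0})"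

text \<open>\<open>\<nu>\<close> is an outer unit normal at \<open>p\<close> if the plane through \<open>p\<close> orthogonal to \<open>\<nu>\<close> is tangent to
  the surface at \<open>p\<close> to first order and \<open>\<nu>\<close> points away from the origin. For a reflector this
  determines \<open>\<nu>\<close> at almost every point; elsewhere \<open>outer_normal\<close> is unspecified.\<close>

definition is_outer_normal :: "point set \<Rightarrow> point \<Rightarrow> point \<Rightarrow> bool" where
  "is_outer_normal \<sigma> p \<nu> \<longleftrightarrow>
     norm \<nu> = 1 \<and> p \<bullet> \<nu> > 0 \<and> ((\<lambda>y. ((y - p) \<bullet> \<nu>) / norm (y - p)) \<longlongrightarrow> 0) (at p within \<sigma>)"

definition outer_normal :: "point set \<Rightarrow> (point \<Rightarrow> real) \<Rightarrow> point \<Rightarrow> point" where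
  "outer_normal X \<rho> x = (THE \<nu>. is_outer_normal (surface_of X \<rho>) (\<rho> x *\<^sub>R x) \<nu>)"

definition illum_density :: "point set \<Rightarrow> (point \<Rightarrow> real) \<Rightarrow> (point \<Rightarrow> real) \<Rightarrow> point \<Rightarrow> real" where
  "illum_density X f \<rho> x = f x * ((x \<bullet> outer_normal X \<rho> x) / (\<rho> x)\<^sup>2)"

definition c_ecc :: "real \<Rightarrow> real" where
  "c_ecc \<delta> = - \<delta> + sqrt (1 + \<delta>\<^sup>2)"

text \<open>The constant \<open>C(\<delta>, k \<delta>, M)\<close>, with \<open>\<kappa> = k \<delta>\<close> as second argument.\<close>

definition C_const :: "real \<Rightarrow> real \<Rightarrow> real \<Rightarrow> real" where
  "C_const \<delta> \<kappa> M = (1 - c_ecc \<delta>)^3 / ((1 + c_ecc \<delta>) * (\<kappa> * M)\<^sup>2)"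

end

(* The reciprocal of the polar radius of an ellipsoid with focus O extends to a convex function on
   R^3 that is homogeneous of degree one; its gradient, the conormal, satisfies the subgradient
   inequality against every point of a reflector which the ellipsoid supports. Hence the conormals
   form a monotone relation, and monotonicity along the rays from a fixed centre shows that the
   points with two conormals are negligible. Two foci with the same conormal lie on the same
   reflected ray, which is exceptional both for countable and for planar D. So almost every point
   has exactly one supporting ellipsoid, the reflector is differentiable there, and it transports
   the source to a well-defined measure on D.

   For finitely many targets, Perron's method (the least admissible vector of parameters) gives all
   prescribed masses except at P0, where the lower bound on the source yields a surplus. For general
   eta, approximate by finitely supported measures: the reciprocals of the radial functions are
   uniformly Lipschitz, so Arzela-Ascoli applies, the unique supporting ellipsoids converge almost
   everywhere, and dominated convergence shows that the limit transports the source to eta plus a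
   nonnegative point mass at P0. *)

theory Submission
  imports Defs "HOL-Complex_Analysis.Great_Picard"
begin

text \<open>The obstacle is that the received energy is not conserved: the factor (x . \<nu>) /
  \<rho>^2 depends on the reflector itself, so no balance of total masses can force equality at
  every target. Hence one target P0 absorbs a surplus. Its ellipsoid is pinned to the parameter k
  \<delta> M, which bounds every competing reflector from above. The constants come from this.
  Parameters d >= \<delta> M have eccentricity at most c = \<open>c_ecc \<delta>\<close>. Then the
  cosine between ray and normal is at least (1 - c) / (1 + c), and inside the pinned ellipsoid the
  radius is at most k \<delta> M / (1 - c); together these give C as a lower bound for the factor.
  The bound on k says that every ellipsoid with parameter \<delta> M fits inside the pinned one. The
  alternative planar or countable is needed because ellipsoids with two foci on one reflected ray
  are tangent to each other at the reflection point: differentiability of the reflector alone cannot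
  tell such foci apart.\<close>

section \<open>Null sets of the surface measure\<close>

text \<open>By monotonicity along a ray from \<open>a\<close>, at most one of its points carries two values whose
  radial components lie on different sides of a given gap \<open>(q, r)\<close>.\<close>

lemma negligible_multivalued_monotone:
  fixes G :: "('a::euclidean_space \<times> 'a) set"
  assumes G: "compact G"
    and mono: "\<And>y g y' g'. (y, g) \<in> G \<Longrightarrow> (y', g') \<in> G \<Longrightarrow> (g - g') \<bullet> (y - y') \<ge> 0"
  shows "negligible {y. \<exists>g1 g2. (y, g1) \<in> G \<and> (y, g2) \<in> G \<and> g1 \<noteq> g2}"
proof -
  \<comment> \<open>Failures seen from the centre \<open>a\<close> with the rational gap (q, r). The
    bound \<open>s\<close> excludes the centre itself, where both inequalities are trivial, and all
    conditions are non-strict so that \<open>Z\<close> is closed.\<close>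
  define Z where "Z = (\<lambda>(a, q, r, s). {y. \<exists>g1 g2. (y, g1) \<in> G \<and> (y, g2) \<in> G \<and> s \<le> norm (y - a)
      \<and> g1 \<bullet> (y - a) \<le> q * norm (y - a) \<and> r * norm (y - a) \<le> g2 \<bullet> (y - a)})"
  define I where "I = {(a, q, r, s). a \<in> insert 0 (Basis :: 'a set) \<and> q \<in> \<rat> \<and> r \<in> \<rat> \<and> s \<in> \<rat> \<and> (0::real) < s \<and> (q::real) < r}"
  have "I \<subseteq> insert 0 Basis \<times> \<rat> \<times> \<rat> \<times> \<rat>"
    by (auto simp: I_def)
  moreover have "countable (insert 0 (Basis :: 'a set) \<times> (\<rat>::real set) \<times> (\<rat>::real set) \<times> (\<rat>::real set))"
    by (intro countable_SIGMA countable_rat) (auto intro: countable_finite)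
  ultimately have "countable I"
    by (rule countable_subset)
  have neg: "negligible (Z i)" if "i \<in> I" for i
  proof -
    obtain a q r s where i: "i = (a, q, r, s)" by (cases i)
    have qr: "q < r" and s: "0 < s" using that by (auto simp: I_def i)
    let ?C = "{w :: ('a \<times> 'a) \<times> 'a \<times> 'a. fst (fst w) = fst (snd w) \<and> s \<le> norm (fst (fst w) - a) \<and>
       snd (fst w) \<bullet> (fst (fst w) - a) \<le> q * norm (fst (fst w) - a) \<and>
       r * norm (fst (fst w) - a) \<le> snd (snd w) \<bullet> (fst (fst w) - a)}"
    have "closed ?C"
      by (intro closed_Collect_conj closed_Collect_eq closed_Collect_le continuous_intros)
    then have "compact ((G \<times> G) \<inter> ?C)"
      by (intro compact_Int_closed compact_Times G)
    then have "compact ((\<lambda>w. fst (fst w)) ` ((G \<times> G) \<inter> ?C))"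
      by (intro compact_continuous_image continuous_intros)
    moreover have "(\<lambda>w. fst (fst w)) ` ((G \<times> G) \<inter> ?C) = Z i"
      by (force simp: Z_def i image_iff)
    ultimately have "closed (Z i)"
      using compact_imp_closed by simp
    then show ?thesis
    proof (rule starlike_negligible_strong[where a = a])
      fix c :: real and u :: 'a
      assume c: "0 \<le> c" "c < 1" and u: "a + u \<in> Z i"
      show "a + c *\<^sub>R u \<notin> Z i"
      proof
        assume "a + c *\<^sub>R u \<in> Z i"
        then obtain g2 where g2: "(a + c *\<^sub>R u, g2) \<in> G" "s \<le> norm (c *\<^sub>R u)"
          "r * norm (c *\<^sub>R u) \<le> g2 \<bullet> (c *\<^sub>R u)"
          by (auto simp: Z_def i)
        obtain g1 where g1: "(a + u, g1) \<in> G" "g1 \<bullet> u \<le> q * norm u"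
          using u by (auto simp: Z_def i)
        have c0: "c > 0" "u \<noteq> 0" using g2(2) s c by (auto intro: ccontr)
        have "r * norm u \<le> g2 \<bullet> u"
          using g2(3) c0 by (simp add: mult.left_commute[of r])
        have "(g1 - g2) \<bullet> ((a + u) - (a + c *\<^sub>R u)) \<ge> 0"
          by (rule mono[OF g1(1) g2(1)])
        also have "(a + u) - (a + c *\<^sub>R u) = (1 - c) *\<^sub>R u"
          by (simp add: algebra_simps)
        finally have "(g1 - g2) \<bullet> u \<ge> 0"
          using c by (simp add: zero_le_mult_iff)
        then have "r * norm u \<le> q * norm u"
          using g1(2) \<open>r * norm u \<le> g2 \<bullet> u\<close> by (simp add: inner_diff_left)
        then show False using qr c0 by simp
      qed
    qed
  qed
  have "negligible (\<Union>(Z ` I))"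
    by (rule negligible_countable_Union) (use \<open>countable I\<close> neg in auto)
  moreover have "{y. \<exists>g1 g2. (y, g1) \<in> G \<and> (y, g2) \<in> G \<and> g1 \<noteq> g2} \<subseteq> \<Union>(Z ` I)"
  proof clarsimp
    fix y g1 g2 assume g: "(y, g1) \<in> G" "(y, g2) \<in> G" "g1 \<noteq> g2"
    \<comment> \<open>A single centre misses jumps orthogonal to the ray. A jump orthogonal to
      \<open>y\<close> and to every \<open>y - b\<close> with \<open>b\<close> in the basis is
      orthogonal to every \<open>b\<close>, hence zero.\<close>
    have "\<exists>a\<in>insert 0 Basis. (g1 - g2) \<bullet> (y - a) \<noteq> 0"
    proof (rule ccontr)
      assume "\<not> ?thesis"
      then have 0: "(g1 - g2) \<bullet> (y - a) = 0" if "a \<in> insert 0 Basis" for a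
        using that by blast
      have "(g1 - g2) \<bullet> b = 0" if "b \<in> Basis" for b
        using 0[of 0] 0[of b] that by (simp add: inner_diff_right)
      then have "g1 - g2 = 0" using euclidean_all_zero_iff by blast
      with g show False by simp
    qed
    then obtain a where a: "a \<in> insert 0 Basis" "(g1 - g2) \<bullet> (y - a) \<noteq> 0" by blast
    have "\<exists>h1 h2. (y, h1) \<in> G \<and> (y, h2) \<in> G \<and> h1 \<bullet> (y - a) < h2 \<bullet> (y - a)"
    proof (cases "g1 \<bullet> (y - a) < g2 \<bullet> (y - a)")
      case True then show ?thesis using g by blast
    next
      case False then have "g2 \<bullet> (y - a) < g1 \<bullet> (y - a)"
        using a by (simp add: inner_diff_left)
      then show ?thesis using g by blast
    qed
    then obtain h1 h2 where h: "(y, h1) \<in> G" "(y, h2) \<in> G" "h1 \<bullet> (y - a) < h2 \<bullet> (y - a)"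
      by blast
    have n: "norm (y - a) > 0" using a by auto
    obtain s where s: "s \<in> \<rat>" "0 < s" "s < norm (y - a)"
      using Rats_dense_in_real[OF n] by blast
    have "h1 \<bullet> (y - a) / norm (y - a) < h2 \<bullet> (y - a) / norm (y - a)"
      using h(3) n by (simp add: divide_strict_right_mono)
    then obtain q where q: "q \<in> \<rat>" "h1 \<bullet> (y - a) / norm (y - a) < q" "q < h2 \<bullet> (y - a) / norm (y - a)"
      using Rats_dense_in_real by blast
    obtain r where r: "r \<in> \<rat>" "q < r" "r < h2 \<bullet> (y - a) / norm (y - a)"
      using Rats_dense_in_real[OF q(3)] by blast
    have "(a, q, r, s) \<in> I" using a q r s by (auto simp: I_def)
    moreover have "y \<in> Z (a, q, r, s)"
      unfolding Z_def using h q r s n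
      by (simp, intro exI[of _ h1] conjI exI[of _ h2]) (simp_all add: field_simps)
    ultimately show "\<exists>x\<in>I. y \<in> Z x" by blast
  qed
  ultimately show ?thesis by (rule negligible_subset)
qed

lemma sets_surface_borel: "A \<in> sets borel \<Longrightarrow> A \<subseteq> S2 \<Longrightarrow> A \<in> sets surface"
  unfolding surface_def surface_borel_def
  by (intro sets_completionI_sets) (auto simp: sets_restrict_space_iff)

lemma null_sets_surface_subset: "B \<subseteq> A \<Longrightarrow> A \<in> null_sets surface \<Longrightarrow> B \<in> null_sets surface"
  unfolding surface_def by (rule null_sets_completion_subset)

text \<open>The surface measure of \<open>A\<close> is three times the volume of the part in the
  unit ball of the cone over \<open>A\<close>.\<close>

lemma null_sets_surfaceI:
  assumes "A \<in> sets borel" "A \<subseteq> S2" "negligible {y. y \<noteq> 0 \<and> y /\<^sub>R norm y \<in> A}"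
  shows "A \<in> null_sets surface"
proof -
  let ?B = "{y \<in> cball 0 1 - {0}. y /\<^sub>R norm y \<in> A}"
  have "(\<lambda>y::point. y /\<^sub>R norm y) \<in> borel_measurable borel" by measurable
  then have "(\<lambda>y. y /\<^sub>R norm y) -` A \<inter> space borel \<in> sets borel"
    using assms(1) by (rule measurable_sets)
  then have "((\<lambda>y. y /\<^sub>R norm y) -` A \<inter> space borel) \<inter> (cball 0 1 - {0}) \<in> sets borel"
    by (intro sets.Int) auto
  also have "((\<lambda>y. y /\<^sub>R norm y) -` A \<inter> space borel) \<inter> (cball 0 1 - {0}) = ?B" by auto
  finally have B: "?B \<in> sets lborel" by simp
  have "negligible ?B"
    by (rule negligible_subset[OF assms(3)]) auto
  then have "emeasure lebesgue ?B = 0"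
    by (simp add: negligible_iff_null_sets null_setsD1)
  then have "emeasure lborel ?B = 0" using B by simp
  then have "emeasure surface A = 0"
    using emeasure_surface_borel[OF assms(1,2)] by simp
  then show ?thesis using sets_surface_borel[OF assms(1,2)] by auto
qed

lemma null_sets_surface_hyperplane:
  assumes "a \<noteq> 0" shows "{x \<in> S2. a \<bullet> x = 0} \<in> null_sets surface"
proof (rule null_sets_surfaceI)
  have "closed (S2 \<inter> {x. a \<bullet> x = 0})"
    by (intro closed_Int closed_sphere closed_hyperplane)
  also have "S2 \<inter> {x. a \<bullet> x = 0} = {x \<in> S2. a \<bullet> x = 0}" by auto
  finally have "closed {x \<in> S2. a \<bullet> x = 0}" .
  then show "{x \<in> S2. a \<bullet> x = 0} \<in> sets borel" by (rule borel_closed)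
  show "negligible {y. y \<noteq> 0 \<and> y /\<^sub>R norm y \<in> {x \<in> S2. a \<bullet> x = 0}}"
    by (rule negligible_subset[OF negligible_hyperplane[of a 0]]) (use assms in auto)
qed auto

lemma null_sets_surface_countable:
  assumes "countable A" "A \<subseteq> S2" shows "A \<in> null_sets surface"
proof -
  have "{x} \<in> null_sets surface" if "x \<in> A" for x
  proof (rule null_sets_surfaceI)
    have "negligible (span {x})"
      by (intro negligible_lowdim) (use dim_le_card'[of "{x}"] in auto)
    moreover have "y \<in> span {x}" if "y \<noteq> 0" "y /\<^sub>R norm y = x" for y
    proof -
      have "y = norm y *\<^sub>R x" using that by auto
      then show ?thesis by (metis span_base span_mul singletonI)
    qed
    ultimately show "negligible {y. y \<noteq> 0 \<and> y /\<^sub>R norm y \<in> {x}}"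
      by (auto intro: negligible_subset)
  qed (use that assms in auto)
  then have "(\<Union>x\<in>A. {x}) \<in> null_sets surface"
    by (intro null_sets_UN' assms)
  then show ?thesis by simp
qed

text \<open>Extending each value constantly along its ray gives a monotone relation on space: the
  product in question splits into s (g . x - g' . x) + s' (g' . x' - g . x'), and both brackets are
  nonnegative by \<open>mono\<close>. So the failures form a negligible cone.\<close>

lemma null_sets_surface_multivalued:
  assumes R: "compact R" and S: "fst ` R \<subseteq> S2"
    and mono: "\<And>x g x' g'. (x, g) \<in> R \<Longrightarrow> (x', g') \<in> R \<Longrightarrow> g \<bullet> x' \<le> g' \<bullet> x'"
  shows "{x. \<exists>g1 g2. (x, g1) \<in> R \<and> (x, g2) \<in> R \<and> g1 \<noteq> g2} \<in> null_sets surface"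
proof -
  \<comment> \<open>A jump bounded away from zero is a closed condition, so \<open>Z k\<close> is
    compact and therefore Borel.\<close>
  define Z where "Z k = {x. \<exists>g1 g2. (x, g1) \<in> R \<and> (x, g2) \<in> R \<and> inverse (real (Suc k)) \<le> norm (g1 - g2)}" for k
  have "Z k \<in> null_sets surface" for k
  proof (rule null_sets_surfaceI)
    let ?C = "{w :: (point \<times> point) \<times> point \<times> point. fst (fst w) = fst (snd w) \<and>
       inverse (real (Suc k)) \<le> norm (snd (fst w) - snd (snd w))}"
    have "closed ?C"
      by (intro closed_Collect_conj closed_Collect_eq closed_Collect_le continuous_intros)
    then have "compact ((R \<times> R) \<inter> ?C)"
      by (intro compact_Int_closed compact_Times R)
    then have "compact ((\<lambda>w. fst (fst w)) ` ((R \<times> R) \<inter> ?C))"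
      by (intro compact_continuous_image continuous_intros)
    moreover have "(\<lambda>w. fst (fst w)) ` ((R \<times> R) \<inter> ?C) = Z k"
      by (force simp: Z_def image_iff)
    ultimately show "Z k \<in> sets borel"
      using compact_imp_closed by (metis borel_closed)
    show "Z k \<subseteq> S2" using S by (force simp: Z_def)
    \<comment> \<open>Cutting the rays off at both ends keeps the extended relation compact; the
      pieces exhaust the punctured space.\<close>
    define G where "G n = (\<lambda>(s, x, g). (s *\<^sub>R x, g)) ` ({inverse (real (Suc n))..real n} \<times> R)" for n
    have "negligible {y. \<exists>g1 g2. (y, g1) \<in> G n \<and> (y, g2) \<in> G n \<and> g1 \<noteq> g2}" for n
    proof (rule negligible_multivalued_monotone)
      show "compact (G n)" unfolding G_def
        by (intro compact_continuous_image compact_Times R) (auto simp: case_prod_unfold intro!: continuous_intros)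
      fix y g y' g' assume "(y, g) \<in> G n" "(y', g') \<in> G n"
      then obtain s s' x x' where *: "y = s *\<^sub>R x" "y' = s' *\<^sub>R x'" "(x, g) \<in> R" "(x', g') \<in> R"
        and "inverse (real (Suc n)) \<le> s" "inverse (real (Suc n)) \<le> s'"
        by (auto simp: G_def)
      then have s: "0 \<le> s" "0 \<le> s'" by (meson inverse_nonnegative_iff_nonnegative of_nat_0_le_iff order_trans)+
      have "(g - g') \<bullet> (y - y') = s * (g \<bullet> x - g' \<bullet> x) + s' * (g' \<bullet> x' - g \<bullet> x')"
        by (simp add: * algebra_simps inner_diff_left inner_diff_right)
      moreover have "g' \<bullet> x \<le> g \<bullet> x" "g \<bullet> x' \<le> g' \<bullet> x'" using mono * by blast+
      ultimately show "(g - g') \<bullet> (y - y') \<ge> 0"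
        using s by simp
    qed
    then have neg: "negligible (\<Union>n. {y. \<exists>g1 g2. (y, g1) \<in> G n \<and> (y, g2) \<in> G n \<and> g1 \<noteq> g2})"
      by (intro negligible_countable_Union) auto
    show "negligible {y. y \<noteq> 0 \<and> y /\<^sub>R norm y \<in> Z k}"
    proof (rule negligible_subset[OF neg], clarsimp simp: Z_def)
      fix y g1 g2 assume y: "y \<noteq> 0" and g: "(y /\<^sub>R norm y, g1) \<in> R" "(y /\<^sub>R norm y, g2) \<in> R"
        and "inverse (1 + real k) \<le> norm (g1 - g2)"
      then have ne: "g1 \<noteq> g2" by (auto simp: field_simps)
      obtain n1 where n1: "inverse (real (Suc n1)) < norm y"
        using reals_Archimedean[of "norm y"] y by auto
      obtain n2 where n2: "norm y < real n2" using reals_Archimedean2 by blast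
      define n where "n = max n1 n2"
      have "inverse (real (Suc n)) \<le> inverse (real (Suc n1))"
        by (rule le_imp_inverse_le) (auto simp: n_def)
      moreover have "real n2 \<le> real n" by (simp add: n_def)
      ultimately have "norm y \<in> {inverse (real (Suc n))..real n}"
        using n1 n2 unfolding atLeastAtMost_iff by linarith
      then have "(y, g) \<in> G n" if "(y /\<^sub>R norm y, g) \<in> R" for g
        unfolding G_def using that y
        by (intro image_eqI[of _ _ "(norm y, y /\<^sub>R norm y, g)"]) auto
      then show "\<exists>n g1. (y, g1) \<in> G n \<and> (\<exists>g2. (y, g2) \<in> G n \<and> g1 \<noteq> g2)"
        using g ne by blast
    qed
  qed
  then have "(\<Union>k. Z k) \<in> null_sets surface" by (intro null_sets_UN)
  then show ?thesis
  proof (rule null_sets_surface_subset[rotated], clarify)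
    fix x g1 g2 assume g: "(x, g1) \<in> R" "(x, g2) \<in> R" "g1 \<noteq> g2"
    then obtain k where "inverse (real (Suc k)) < norm (g1 - g2)"
      using reals_Archimedean[of "norm (g1 - g2)"] by auto
    then have "x \<in> Z k" using g less_imp_le by (auto simp: Z_def simp del: of_nat_Suc)
    then show "x \<in> (\<Union>k. Z k)" by blast
  qed
qed

section \<open>Ellipsoids of revolution\<close>

lemma c_ecc_sqrt_pos: "\<bar>t\<bar> < sqrt (1 + t\<^sup>2)"
  by (rule real_less_rsqrt) simp

lemma c_ecc_pos: "0 < c_ecc t"
  using c_ecc_sqrt_pos[of t] by (auto simp: c_ecc_def)

lemma c_ecc_mult: "c_ecc t * (t + sqrt (1 + t\<^sup>2)) = 1"
  by (simp add: c_ecc_def algebra_simps power2_eq_square[symmetric])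

lemma c_ecc_less_1: "0 < t \<Longrightarrow> c_ecc t < 1"
proof -
  assume "0 < t"
  then have "sqrt (1 + t\<^sup>2) < sqrt ((1 + t)\<^sup>2)"
    by (intro real_sqrt_less_mono) (simp add: power2_eq_square algebra_simps)
  then show ?thesis using \<open>0 < t\<close> by (simp add: c_ecc_def)
qed

text \<open>For t = d / norm P this says that \<open>d\<close> is the semi-latus rectum of the
  ellipse with focal distance norm P and eccentricity \<open>c_ecc t\<close>.\<close>

lemma c_ecc_quadratic: "1 - (c_ecc t)\<^sup>2 = 2 * t * c_ecc t"
proof -
  have "(sqrt (1 + t\<^sup>2))\<^sup>2 = 1 + t\<^sup>2" by simp
  then show ?thesis unfolding c_ecc_def by algebra
qed

lemma c_ecc_strict_antimono:
  assumes "0 \<le> s" "s < t" shows "c_ecc t < c_ecc s"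
proof -
  have "sqrt (1 + s\<^sup>2) < sqrt (1 + t\<^sup>2)"
    using assms by (intro real_sqrt_less_mono) (simp add: power_strict_mono)
  then have "s + sqrt (1 + s\<^sup>2) < t + sqrt (1 + t\<^sup>2)" using assms by linarith
  then have "c_ecc t * (s + sqrt (1 + s\<^sup>2)) < c_ecc t * (t + sqrt (1 + t\<^sup>2))"
    by (intro mult_strict_left_mono c_ecc_pos)
  then have "c_ecc t * (s + sqrt (1 + s\<^sup>2)) < c_ecc s * (s + sqrt (1 + s\<^sup>2))"
    by (simp add: c_ecc_mult)
  moreover have "0 < s + sqrt (1 + s\<^sup>2)" using c_ecc_sqrt_pos[of s] assms by simp
  ultimately show ?thesis by (simp add: mult_less_cancel_right)
qed

lemma c_ecc_antimono: "0 \<le> s \<Longrightarrow> s \<le> t \<Longrightarrow> c_ecc t \<le> c_ecc s"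
  using c_ecc_strict_antimono[of s t] by (cases "s = t") auto

lemma eccentricity_eq: "eccentricity P d = c_ecc (d / norm P)"
  by (simp add: eccentricity_def c_ecc_def power_divide)

text \<open>The eccentricity vector. It makes the reciprocal of the polar radius the affine function
  \<open>(1 - focal P d \<bullet> x) / d\<close> of \<open>x\<close>, on which the convexity
  arguments rest.\<close>

definition focal :: "point \<Rightarrow> real \<Rightarrow> point" where
  "focal P d = eccentricity P d *\<^sub>R (P /\<^sub>R norm P)"

lemma polar_radius_focal: "polar_radius P d x = d / (1 - focal P d \<bullet> x)"
  by (simp add: polar_radius_def focal_def inner_commute)

lemma norm_focal: "P \<noteq> 0 \<Longrightarrow> norm (focal P d) = c_ecc (d / norm P)"
  using c_ecc_pos[of "d / norm P"] by (simp add: focal_def eccentricity_eq)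

lemma norm_focal_less_1: "P \<noteq> 0 \<Longrightarrow> 0 < d \<Longrightarrow> norm (focal P d) < 1"
  by (simp add: norm_focal c_ecc_less_1)

text \<open>Inverts \<open>focal\<close> by means of \<open>c_ecc_quadratic\<close>: parameter and
  eccentricity vector together determine the focus.\<close>

lemma focus_of_focal:
  assumes "P \<noteq> 0" "0 < d"
  shows "P = (2 * d / (1 - (norm (focal P d))\<^sup>2)) *\<^sub>R focal P d"
proof -
  define t where "t = d / norm P"
  have t: "t > 0" using assms by (simp add: t_def)
  have "focal P d = c_ecc t *\<^sub>R (P /\<^sub>R norm P)"
    by (simp add: focal_def eccentricity_eq t_def)
  moreover have "1 - (norm (focal P d))\<^sup>2 = 2 * t * c_ecc t"
    using assms by (simp add: norm_focal t_def[symmetric] c_ecc_quadratic)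
  moreover have "d = t * norm P" using assms by (simp add: t_def)
  ultimately show ?thesis using t c_ecc_pos[of t] assms by simp
qed

lemma focal_inner_le: "norm x = 1 \<Longrightarrow> \<bar>focal P d \<bullet> x\<bar> \<le> norm (focal P d)"
  using Cauchy_Schwarz_ineq2[of "focal P d" x] by simp

lemma one_minus_focal_pos:
  assumes "P \<noteq> 0" "0 < d" "norm x = 1" shows "0 < 1 - focal P d \<bullet> x"
  using focal_inner_le[OF assms(3), of P d] norm_focal_less_1[OF assms(1,2)] by linarith

lemma polar_radius_pos:
  assumes "P \<noteq> 0" "0 < d" "norm x = 1" shows "0 < polar_radius P d x"
  using one_minus_focal_pos[OF assms] assms by (simp add: polar_radius_focal)

lemma polar_radius_ge:
  assumes "P \<noteq> 0" "0 < d" "norm x = 1" "norm (focal P d) \<le> c"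
  shows "d / (1 + c) \<le> polar_radius P d x"
  unfolding polar_radius_focal
  using focal_inner_le[OF assms(3), of P d] one_minus_focal_pos[OF assms(1-3)] assms
  by (intro divide_left_mono mult_pos_pos) auto

lemma polar_radius_le:
  assumes "P \<noteq> 0" "0 < d" "norm x = 1" "norm (focal P d) \<le> c" "c < 1"
  shows "polar_radius P d x \<le> d / (1 - c)"
  unfolding polar_radius_focal
  using focal_inner_le[OF assms(3), of P d] one_minus_focal_pos[OF assms(1-3)] assms
  by (intro divide_left_mono mult_pos_pos) auto

lemma polar_radius_ge_half:
  assumes "P \<noteq> 0" "0 < d" "norm x = 1" shows "d / 2 \<le> polar_radius P d x"
  using polar_radius_ge[OF assms, of 1] norm_focal_less_1[OF assms(1,2)] by simp

text \<open>Confocal ellipsoids are nested. This is not visible from the formula, since the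
  eccentricity falls as \<open>d\<close> grows. The reciprocal radius is affine in u = cos of the
  angle, so it is a convex combination of its values at u = -1 and u = 1, and both of these decrease
  strictly.\<close>

lemma polar_radius_strict_mono:
  assumes P: "P \<noteq> 0" and d: "0 < d" "d < d'" and x: "norm x = 1"
  shows "polar_radius P d x < polar_radius P d' x"
proof -
  define s t u where "s = d / norm P" and "t = d' / norm P" and "u = x \<bullet> (P /\<^sub>R norm P)"
  have st: "0 < s" "s < t" using assms by (auto simp: s_def t_def divide_strict_right_mono)
  have c: "c_ecc t < c_ecc s" "0 < c_ecc t" "c_ecc s < 1"
    using c_ecc_strict_antimono[of s t] c_ecc_pos[of t] c_ecc_less_1[of s] st by auto
  have u: "\<bar>u\<bar> \<le> 1"
    using Cauchy_Schwarz_ineq2[of x "P /\<^sub>R norm P"] x P by (simp add: u_def)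
  \<comment> \<open>On the left, numerator and denominator both grow with \<open>r\<close>; the
    right-hand side depends on \<open>c_ecc r\<close> alone and increases with it.\<close>
  have eq: "(1 - c_ecc r) / r = 2 * c_ecc r / (1 + c_ecc r)" if "0 < r" for r
  proof -
    have "(1 - c_ecc r) * (1 + c_ecc r) = 2 * c_ecc r * r"
      using c_ecc_quadratic[of r] by (simp add: power2_eq_square algebra_simps)
    then show ?thesis using that c_ecc_pos[of r] by (simp add: frac_eq_eq)
  qed
  have A: "(1 + c_ecc t) / t < (1 + c_ecc s) / s"
    using st c by (intro frac_less2) auto
  have B: "(1 - c_ecc t) / t < (1 - c_ecc s) / s"
    using st c by (simp add: eq field_simps)
  have dec: "(1 - c_ecc r * u) / r = (1 - u) / 2 * ((1 + c_ecc r) / r) + (1 + u) / 2 * ((1 - c_ecc r) / r)"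
    if "r > 0" for r
    using that by (simp add: field_simps)
  have "(1 - u) / 2 * ((1 + c_ecc t) / t) + (1 + u) / 2 * ((1 - c_ecc t) / t)
      < (1 - u) / 2 * ((1 + c_ecc s) / s) + (1 + u) / 2 * ((1 - c_ecc s) / s)"
  proof (cases "u = 1")
    case True then show ?thesis using B by simp
  next
    case False
    then have "(1 - u) / 2 * ((1 + c_ecc t) / t) < (1 - u) / 2 * ((1 + c_ecc s) / s)"
      using u A by (intro mult_strict_left_mono) auto
    moreover have "(1 + u) / 2 * ((1 - c_ecc t) / t) \<le> (1 + u) / 2 * ((1 - c_ecc s) / s)"
      using u B by (intro mult_left_mono) auto
    ultimately show ?thesis by simp
  qed
  then have less: "(1 - c_ecc t * u) / t < (1 - c_ecc s * u) / s"
    using st by (simp add: dec)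
  have eqs: "polar_radius P d x = norm P / ((1 - c_ecc s * u) / s)"
    "polar_radius P d' x = norm P / ((1 - c_ecc t * u) / t)"
    using P d by (simp_all add: polar_radius_def eccentricity_eq s_def t_def u_def)
  have "c_ecc t * u \<le> c_ecc t * 1" using u c by (intro mult_left_mono) auto
  then have "0 < 1 - c_ecc t * u" using c by linarith
  then have "0 < (1 - c_ecc t * u) / t" using st by simp
  then show ?thesis unfolding eqs
    using less P by (intro divide_strict_left_mono mult_pos_pos) auto
qed

lemma polar_radius_le_iff:
  assumes "P \<noteq> 0" "0 < d" "0 < d'" "norm x = 1"
  shows "polar_radius P d x \<le> polar_radius P d' x \<longleftrightarrow> d \<le> d'"
  using polar_radius_strict_mono[OF assms(1,2) _ assms(4), of d']
    polar_radius_strict_mono[OF assms(1,3) _ assms(4), of d]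
  by (cases d d' rule: linorder_cases) auto

lemma tendsto_focal[tendsto_intros]:
  assumes "(f \<longlongrightarrow> P) F" "(g \<longlongrightarrow> d) F" "P \<noteq> 0"
  shows "((\<lambda>x. focal (f x) (g x)) \<longlongrightarrow> focal P d) F"
  unfolding focal_def eccentricity_def using assms by (auto intro!: tendsto_intros)

lemma tendsto_polar_radius[tendsto_intros]:
  assumes "(f \<longlongrightarrow> P) F" "(g \<longlongrightarrow> d) F" "(h \<longlongrightarrow> x) F" "P \<noteq> 0" "0 < d" "norm x = 1"
  shows "((\<lambda>x. polar_radius (f x) (g x) (h x)) \<longlongrightarrow> polar_radius P d x) F"
  unfolding polar_radius_focal using assms one_minus_focal_pos[of P d x]
  by (intro tendsto_intros) auto

lemma continuous_on_focal[continuous_intros]: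
  assumes "continuous_on S f" "continuous_on S g" "\<And>x. x \<in> S \<Longrightarrow> f x \<noteq> 0"
  shows "continuous_on S (\<lambda>x. focal (f x) (g x))"
  using assms unfolding continuous_on_def by (auto intro!: tendsto_focal)

lemma continuous_on_polar_radius[continuous_intros]:
  assumes "continuous_on S f" "continuous_on S g" "continuous_on S h"
    "\<And>x. x \<in> S \<Longrightarrow> f x \<noteq> 0" "\<And>x. x \<in> S \<Longrightarrow> 0 < g x" "\<And>x. x \<in> S \<Longrightarrow> norm (h x) = 1"
  shows "continuous_on S (\<lambda>x. polar_radius (f x) (g x) (h x))"
  using assms unfolding continuous_on_def by (auto intro!: tendsto_polar_radius)

lemma measurable_focal[measurable]:
  assumes [measurable]: "f \<in> borel_measurable N" "g \<in> borel_measurable N"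
  shows "(\<lambda>x. focal (f x) (g x)) \<in> borel_measurable N"
  unfolding focal_def eccentricity_def by measurable

lemma measurable_polar_radius[measurable]:
  assumes [measurable]: "f \<in> borel_measurable N" "g \<in> borel_measurable N" "h \<in> borel_measurable N"
  shows "(\<lambda>x. polar_radius (f x) (g x) (h x)) \<in> borel_measurable N"
  unfolding polar_radius_focal by measurable

text \<open>The gradient of \<open>y \<mapsto> (norm y - focal P d \<bullet> y) / d\<close>, a convex function that is homogeneous of
  degree one and equals one on the ellipsoid.\<close>

definition conormal :: "point \<Rightarrow> real \<Rightarrow> point \<Rightarrow> point" where
  "conormal P d x = (x - focal P d) /\<^sub>R d"

lemma continuous_on_conormal[continuous_intros]:
  assumes "continuous_on S f" "continuous_on S g" "continuous_on S h"
    "\<And>x. x \<in> S \<Longrightarrow> f x \<noteq> 0" "\<And>x. x \<in> S \<Longrightarrow> 0 < g x"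
  shows "continuous_on S (\<lambda>x. conormal (f x) (g x) (h x))"
  unfolding conormal_def using assms by (intro continuous_intros) force+

lemma conormal_inner_self:
  assumes "norm x = 1" shows "conormal P d x \<bullet> x = 1 / polar_radius P d x"
proof -
  have "x \<bullet> x = 1" using assms by (simp add: dot_square_norm)
  then show ?thesis by (simp add: conormal_def polar_radius_focal inner_diff_left divide_inverse)
qed

text \<open>The subgradient inequality; all terms cancel except x . y <= 1.\<close>

lemma conormal_inner_le:
  assumes "norm x = 1" "norm y = 1" "0 < d"
  shows "conormal P d x \<bullet> y \<le> 1 / polar_radius P d y"
proof -
  have "x \<bullet> y \<le> 1" using norm_cauchy_schwarz[of x y] assms by simp
  then show ?thesis using assms
    by (simp add: conormal_def polar_radius_focal inner_diff_left divide_inverse)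
qed

text \<open>The ray reflected at \<open>polar_radius P d x *\<^sub>R x\<close>, which contains the focus \<open>P\<close>, has a direction
  that depends on the ellipsoid only through its conormal.\<close>

lemma focus_on_reflected_ray:
  assumes P: "P \<noteq> 0" and d: "0 < d" and x: "norm x = 1"
  defines "g \<equiv> conormal P d x" and "r \<equiv> polar_radius P d x"
  shows "\<exists>l. P = r *\<^sub>R x + l *\<^sub>R ((r * (norm g)\<^sup>2) *\<^sub>R x - 2 *\<^sub>R g)"
proof -
  \<comment> \<open>Found by expanding the square of the norm of \<open>x - d *\<^sub>R g\<close>:
    one minus that square is \<open>d * q\<close>, the quantity by which
    \<open>focus_of_focal\<close> divides.\<close>
  define q where "q = 2 / r - d * (norm g)\<^sup>2"
  have r: "r > 0" unfolding r_def by (rule polar_radius_pos[OF P d x])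
  have v: "focal P d = x - d *\<^sub>R g" using d by (simp add: g_def conormal_def)
  have gx: "g \<bullet> x = 1 / r" unfolding g_def r_def by (rule conormal_inner_self[OF x])
  have "(norm (focal P d))\<^sup>2 = (norm x)\<^sup>2 - 2 * d * (g \<bullet> x) + d\<^sup>2 * (norm g)\<^sup>2"
    unfolding v power2_norm_eq_inner by (simp add: algebra_simps inner_diff_left inner_diff_right
        power2_eq_square inner_commute)
  then have n: "1 - (norm (focal P d))\<^sup>2 = d * q"
    using x by (simp add: q_def gx algebra_simps power2_eq_square)
  have "(norm (focal P d))\<^sup>2 < 1"
    using norm_focal_less_1[OF P d] by (simp add: power_less_one_iff)
  then have "0 < d * q" using n by linarith
  then have q: "q > 0" using d by (simp add: zero_less_mult_iff)
  have "P = (2 * d / (d * q)) *\<^sub>R (x - d *\<^sub>R g)"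
    using focus_of_focal[OF P d] unfolding n unfolding v .
  also have "\<dots> = (2 / q) *\<^sub>R x - (2 * d / q) *\<^sub>R g"
    using d by (simp add: algebra_simps)
  also have "2 / q = r + d / q * (r * (norm g)\<^sup>2)"
    using q r by (simp add: q_def field_simps)
  finally have "P = r *\<^sub>R x + (d / q) *\<^sub>R ((r * (norm g)\<^sup>2) *\<^sub>R x - 2 *\<^sub>R g)"
    by (simp add: algebra_simps)
  then show ?thesis by blast
qed

text \<open>Both foci lie on the line through the surface point in the reflected direction. Two
  different points of this line are in the plane, so the whole line is. The second conclusion says
  that the plane cannot have the conormal of the ellipsoid, since the line would then have to be
  transversal to it.\<close>

lemma reflected_ray_in_plane:
  assumes "norm x = 1" and 1: "P \<noteq> 0" "0 < d" and 2: "P' \<noteq> 0" "0 < d'" and "P \<noteq> P'"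
    and g: "conormal P d x = conormal P' d' x"
    and plane: "a \<bullet> P = b" "a \<bullet> P' = b"
  shows "polar_radius P d x * (a \<bullet> x) = b" "b *\<^sub>R conormal P d x = a \<Longrightarrow> a = 0"
proof -
  let ?r = "polar_radius P d x" and ?g = "conormal P d x"
  let ?w = "(?r * (norm ?g)\<^sup>2) *\<^sub>R x - 2 *\<^sub>R ?g"
  have gx: "?g \<bullet> x = 1 / ?r" by (rule conormal_inner_self) fact
  have r: "?r > 0" by (rule polar_radius_pos) fact+
  have r': "polar_radius P' d' x = ?r"
    using gx conormal_inner_self[OF assms(1), of P' d'] unfolding g by simp
  obtain l where l: "P = ?r *\<^sub>R x + l *\<^sub>R ?w"
    using focus_on_reflected_ray[OF 1 assms(1)] by blast
  obtain l' where l': "P' = ?r *\<^sub>R x + l' *\<^sub>R ?w"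
    using focus_on_reflected_ray[OF 2 assms(1)] unfolding g[symmetric] r' by blast
  have "l \<noteq> l'" using l l' \<open>P \<noteq> P'\<close> by metis
  have e: "a \<bullet> P = ?r * (a \<bullet> x) + l * (a \<bullet> ?w)" "a \<bullet> P' = ?r * (a \<bullet> x) + l' * (a \<bullet> ?w)"
    using arg_cong[OF l, of "inner a"] arg_cong[OF l', of "inner a"]
    by (simp_all only: inner_add_right inner_scaleR_right)
  then have "(l - l') * (a \<bullet> ?w) = 0" using plane by (simp add: algebra_simps)
  then have w: "a \<bullet> ?w = 0" using \<open>l \<noteq> l'\<close> by simp
  show ra: "?r * (a \<bullet> x) = b" using e(1) plane(1) unfolding w by simp
  assume a: "b *\<^sub>R ?g = a"
  \<comment> \<open>The reflected direction is not tangent to the ellipsoid.\<close>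
  have "?g \<bullet> ?w = - (norm ?g)\<^sup>2"
    using gx r by (simp add: inner_diff_right power2_norm_eq_inner)
  then have "a \<bullet> ?w = - b * (norm ?g)\<^sup>2" unfolding a[symmetric] by simp
  then have "b = 0 \<or> ?g = 0" using w by simp
  then show "a = 0" using a by auto
qed

text \<open>The factor of \<open>f\<close> in \<open>illum_density\<close>, computed from a
  supporting ellipsoid: \<open>sgn (x - focal P d)\<close> is its outer unit normal. In this form
  measurability and limits follow from those of \<open>P\<close>, \<open>d\<close> and
  \<open>x\<close>.\<close>

definition illum_weight :: "point \<Rightarrow> real \<Rightarrow> point \<Rightarrow> real" where
  "illum_weight P d x = (x \<bullet> sgn (x - focal P d)) / (polar_radius P d x)\<^sup>2"

lemma measurable_illum_weight[measurable]:
  assumes [measurable]: "f \<in> borel_measurable N" "g \<in> borel_measurable N" "h \<in> borel_measurable N"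
  shows "(\<lambda>x. illum_weight (f x) (g x) (h x)) \<in> borel_measurable N"
  unfolding illum_weight_def sgn_div_norm by measurable

lemma focal_neq: "P \<noteq> 0 \<Longrightarrow> 0 < d \<Longrightarrow> norm x = 1 \<Longrightarrow> x \<noteq> focal P d"
  using norm_focal_less_1[of P d] by auto

lemma tendsto_illum_weight[tendsto_intros]:
  assumes "(f \<longlongrightarrow> P) F" "(g \<longlongrightarrow> d) F" "(h \<longlongrightarrow> x) F" "P \<noteq> 0" "0 < d" "norm x = 1"
  shows "((\<lambda>x. illum_weight (f x) (g x) (h x)) \<longlongrightarrow> illum_weight P d x) F"
  unfolding illum_weight_def using assms polar_radius_pos[of P d x] focal_neq[of P d x]
  by (intro tendsto_intros) auto

lemma inner_ellipsoid_normal: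
  assumes "norm x = 1" shows "x \<bullet> sgn (x - focal P d) = (1 - focal P d \<bullet> x) / norm (x - focal P d)"
proof -
  have "x \<bullet> x = 1" using assms by (simp add: dot_square_norm)
  then show ?thesis by (simp add: sgn_div_norm inner_diff_right inner_commute divide_inverse)
qed

text \<open>The origin of \<open>C_const\<close>: it is this bound for c =
  \<open>c_ecc \<delta>\<close> and R = \<kappa> M / (1 - c), with \<kappa> the second argument of
  \<open>C_const\<close>. The cosine is a quotient of a number at least 1 - c by a number at most 1
  + c.\<close>

lemma illum_weight_ge:
  assumes "P \<noteq> 0" "0 < d" "norm x = 1" "norm (focal P d) \<le> c" "c < 1" "polar_radius P d x \<le> R"
  shows "(1 - c) / ((1 + c) * R\<^sup>2) \<le> illum_weight P d x"
proof -
  have f: "norm (x - focal P d) \<le> 1 + c" "1 - c \<le> 1 - focal P d \<bullet> x" "0 < norm (x - focal P d)"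
    using norm_triangle_ineq4[of x "focal P d"] focal_inner_le[OF assms(3), of P d] assms focal_neq[OF assms(1-3)]
    by auto
  have "(1 - c) / (1 + c) \<le> x \<bullet> sgn (x - focal P d)"
    unfolding inner_ellipsoid_normal[OF assms(3)] using f assms by (intro frac_le) auto
  moreover have "0 < (polar_radius P d x)\<^sup>2" "(polar_radius P d x)\<^sup>2 \<le> R\<^sup>2"
    using polar_radius_pos[OF assms(1-3)] assms by (auto intro: power_mono)
  moreover have "0 \<le> (1 - c) / (1 + c)" using f assms by (intro divide_nonneg_nonneg) (auto intro: order_trans[OF norm_ge_zero])
  ultimately have "(1 - c) / (1 + c) / R\<^sup>2 \<le> illum_weight P d x"
    unfolding illum_weight_def by (intro frac_le) auto
  then show ?thesis by simp
qed

lemma illum_weight_pos: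
  assumes "P \<noteq> 0" "0 < d" "norm x = 1" shows "0 < illum_weight P d x"
  using one_minus_focal_pos[OF assms] polar_radius_pos[OF assms] focal_neq[OF assms]
  by (simp add: illum_weight_def inner_ellipsoid_normal[OF assms(3)])

text \<open>Provides the integrable majorant for all dominated convergence arguments.\<close>

lemma illum_weight_le:
  assumes "P \<noteq> 0" "norm x = 1" "0 < lo" "lo \<le> d" shows "illum_weight P d x \<le> 4 / lo\<^sup>2"
proof -
  have "x \<bullet> sgn (x - focal P d) \<le> 1"
    using norm_cauchy_schwarz[of x "sgn (x - focal P d)"] assms by (simp add: norm_sgn split: if_splits)
  moreover have "lo / 2 \<le> polar_radius P d x"
    using polar_radius_ge_half[of P d x] assms by simp
  then have "(lo / 2)\<^sup>2 \<le> (polar_radius P d x)\<^sup>2"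
    using assms by (intro power_mono) auto
  ultimately have "illum_weight P d x \<le> 1 / (lo / 2)\<^sup>2"
    unfolding illum_weight_def using assms by (intro frac_le) auto
  then show ?thesis by (simp add: power_divide)
qed

section \<open>Supporting ellipsoids of a reflector\<close>

lemma supports_atD:
  assumes "supports_at X \<rho> P d x"
  shows "0 < d" "y \<in> X \<Longrightarrow> \<rho> y \<le> polar_radius P d y" "\<rho> x = polar_radius P d x"
  using assms by (auto simp: supports_at_def)

text \<open>A compact relation is continuous at a point where it is single-valued: the pairs with
  values at distance at least \<open>e\<close> from \<open>g\<close> project to a closed set that
  misses \<open>p\<close>.\<close>

lemma compact_fibre_singleton_imp_near:
  fixes K :: "('a::euclidean_space \<times> 'b::euclidean_space) set"
  assumes K: "compact K" and uniq: "\<And>h. (p, h) \<in> K \<Longrightarrow> h = g" and "0 < e"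
  shows "\<exists>r>0. \<forall>z h. (z, h) \<in> K \<and> dist z p < r \<longrightarrow> norm (h - g) < e"
proof -
  have "closed {w :: 'a \<times> 'b. e \<le> norm (snd w - g)}"
    by (intro closed_Collect_le continuous_intros)
  then have "compact (K \<inter> {w. e \<le> norm (snd w - g)})"
    by (rule compact_Int_closed[OF K])
  then have "closed (fst ` (K \<inter> {w. e \<le> norm (snd w - g)}))"
    by (intro compact_imp_closed compact_continuous_image continuous_intros)
  moreover have "p \<notin> fst ` (K \<inter> {w. e \<le> norm (snd w - g)})"
    using uniq \<open>0 < e\<close> by force
  ultimately obtain r where "r > 0" and r: "ball p r \<subseteq> - fst ` (K \<inter> {w. e \<le> norm (snd w - g)})"
    by (meson ComplI open_Compl open_contains_ball)
  have "norm (h - g) < e" if "(z, h) \<in> K" "dist z p < r" for z h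
  proof (rule ccontr)
    assume "\<not> ?thesis"
    then have "z \<in> fst ` (K \<inter> {w. e \<le> norm (snd w - g)})" using that by force
    moreover have "z \<in> ball p r" using that by (simp add: dist_commute)
    ultimately show False using r by blast
  qed
  then show ?thesis using \<open>r > 0\<close> by blast
qed

locale reflector_data =
  fixes X D :: "point set" and lo hi :: real and \<rho> :: "point \<Rightarrow> real"
  assumes X: "compact X" "X \<subseteq> S2"
    and D: "compact D" "0 \<notin> D"
    and lo: "0 < lo"
    and supported: "\<And>x. x \<in> X \<Longrightarrow> \<exists>P\<in>D. \<exists>d\<in>{lo..hi}. supports_at X \<rho> P d x"
begin

abbreviation supp where "supp \<equiv> supports_at X \<rho>"

definition contact :: "real \<Rightarrow> real \<Rightarrow> (point \<times> point \<times> real) set" where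
  "contact l u = {(x, P, d). x \<in> X \<and> P \<in> D \<and> d \<in> {l..u} \<and> supp P d x}"

text \<open>All positive parameters count here, not only those in \<open>{lo..hi}\<close>, because
  \<open>tau\<close> admits any supporting ellipsoid.\<close>

definition multiply_supported :: "point set" where
  "multiply_supported = {x \<in> X. \<exists>P\<in>D. \<exists>P'\<in>D. \<exists>d d'. (P, d) \<noteq> (P', d') \<and> supp P d x \<and> supp P' d' x}"

section \<open>Regularity of the radial function and compactness of the contact relation\<close>

lemma X_norm: "x \<in> X \<Longrightarrow> norm x = 1"
  using X by auto

lemma D_nonzero: "P \<in> D \<Longrightarrow> P \<noteq> 0"
  using D by auto

lemma rho_pos: "x \<in> X \<Longrightarrow> 0 < \<rho> x"
  using supported[of x] polar_radius_pos X_norm D_nonzero by (metis supports_atD(1,3))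

text \<open>On the sphere the reciprocal of \<rho> is a maximum of affine functions with gradients
  of norm at most 1 / \<open>lo\<close>. The constant does not depend on the reflector, which yields
  equicontinuity later.\<close>

lemma inverse_rho_lipschitz:
  assumes "x \<in> X" "y \<in> X" shows "\<bar>inverse (\<rho> x) - inverse (\<rho> y)\<bar> \<le> norm (x - y) / lo"
proof -
  have "inverse (\<rho> x) - inverse (\<rho> y) \<le> norm (x - y) / lo" if "x \<in> X" "y \<in> X" for x y
  proof -
    obtain P d where P: "P \<in> D" "lo \<le> d" "supp P d x" using supported[OF \<open>x \<in> X\<close>] by (meson atLeastAtMost_iff)
    have v: "norm (focal P d) \<le> 1" "0 < d"
      using norm_focal_less_1[of P d] D_nonzero P lo by auto
    have "inverse (polar_radius P d y) \<le> inverse (\<rho> y)"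
      using rho_pos supports_atD(2)[OF P(3)] that by (intro le_imp_inverse_le) auto
    then have "inverse (\<rho> x) - inverse (\<rho> y) \<le> inverse (polar_radius P d x) - inverse (polar_radius P d y)"
      using supports_atD(3)[OF P(3)] by simp
    also have "\<dots> = (focal P d \<bullet> (y - x)) / d"
      by (simp add: polar_radius_focal inner_diff_right diff_divide_distrib)
    also have "\<dots> \<le> norm (x - y) / lo"
    proof (rule frac_le)
      have "focal P d \<bullet> (y - x) \<le> norm (focal P d) * norm (y - x)" by (rule norm_cauchy_schwarz)
      also have "\<dots> \<le> 1 * norm (y - x)" using v by (intro mult_right_mono) auto
      finally show "focal P d \<bullet> (y - x) \<le> norm (x - y)" by (simp add: norm_minus_commute)
    qed (use P lo in auto)
    finally show ?thesis .
  qed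
  from this[of x y] this[of y x] show ?thesis
    using assms by (simp add: norm_minus_commute)
qed

lemma cont: "continuous_on X \<rho>"
proof -
  have "continuous_on X (\<lambda>x. inverse (\<rho> x))"
  proof (rule continuous_onI)
    fix x and e :: real assume x: "x \<in> X" and e: "e > 0"
    have "dist (inverse (\<rho> y)) (inverse (\<rho> x)) \<le> e" if "y \<in> X" "dist y x < e * lo" for y
    proof -
      have "norm (y - x) / lo \<le> e" using that lo by (simp add: dist_norm field_simps)
      then show ?thesis using inverse_rho_lipschitz[OF that(1) x] by (simp add: dist_real_def)
    qed
    then show "\<exists>d>0. \<forall>y\<in>X. dist y x < d \<longrightarrow> dist (inverse (\<rho> y)) (inverse (\<rho> x)) \<le> e"
      using lo e by (intro exI[of _ "e * lo"]) simp
  qed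
  then have "continuous_on X (\<lambda>x. inverse (inverse (\<rho> x)))"
    by (rule continuous_on_inverse) (use rho_pos in fastforce)
  then show ?thesis by simp
qed

lemma compact_contact:
  assumes "0 < l" shows "compact (contact l u)"
proof -
  let ?K = "X \<times> D \<times> {l..u}"
  have K: "compact ?K" by (intro compact_Times X D compact_Icc)
  have "closed (contact l u)"
    unfolding closed_sequential_limits
  proof (intro allI impI, elim conjE)
    fix w x assume w: "\<forall>n. w n \<in> contact l u" and lim: "w \<longlonglongrightarrow> x"
    have "contact l u \<subseteq> ?K" by (auto simp: contact_def)
    then have wK: "w n \<in> ?K" for n using w by blast
    then have x: "x \<in> ?K"
      using closed_sequentially[OF compact_imp_closed[OF K]] lim by blast
    obtain y P d where xe: "x = (y, P, d)" by (cases x)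
    have yPd: "y \<in> X" "P \<in> D" "d \<in> {l..u}" using x by (auto simp: xe)
    have l1: "(\<lambda>n. fst (w n)) \<longlonglongrightarrow> y" and l2: "(\<lambda>n. fst (snd (w n))) \<longlonglongrightarrow> P"
      and l3: "(\<lambda>n. snd (snd (w n))) \<longlonglongrightarrow> d"
      using lim xe by (auto intro!: tendsto_eq_intros)
    have sw: "supp (fst (snd (w n))) (snd (snd (w n))) (fst (w n))" and wX: "fst (w n) \<in> X" for n
      using w by (auto simp: contact_def split_beta)
    have d: "0 < d" using yPd assms by simp
    have "\<rho> z \<le> polar_radius P d z" if "z \<in> X" for z
    proof (rule LIMSEQ_le_const)
      show "(\<lambda>n. polar_radius (fst (snd (w n))) (snd (snd (w n))) z) \<longlonglongrightarrow> polar_radius P d z"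
        using l2 l3 yPd d that D_nonzero X_norm by (intro tendsto_intros) auto
      show "\<exists>N. \<forall>n\<ge>N. \<rho> z \<le> polar_radius (fst (snd (w n))) (snd (snd (w n))) z"
        using supports_atD(2)[OF sw that] by blast
    qed
    moreover have "\<rho> y = polar_radius P d y"
    proof (rule LIMSEQ_unique)
      show "(\<lambda>n. \<rho> (fst (w n))) \<longlonglongrightarrow> \<rho> y"
        by (rule continuous_on_tendsto_compose[OF cont l1]) (use yPd wX in auto)
      have "(\<lambda>n. polar_radius (fst (snd (w n))) (snd (snd (w n))) (fst (w n))) \<longlonglongrightarrow> polar_radius P d y"
        using l1 l2 l3 yPd d D_nonzero X_norm by (intro tendsto_intros) auto
      then show "(\<lambda>n. \<rho> (fst (w n))) \<longlonglongrightarrow> polar_radius P d y"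
        using supports_atD(3)[OF sw] by simp
    qed
    ultimately show "x \<in> contact l u"
      using yPd d by (auto simp: contact_def xe supports_at_def)
  qed
  then have "compact (?K \<inter> contact l u)" by (rule compact_Int_closed[OF K])
  also have "?K \<inter> contact l u = contact l u" by (auto simp: contact_def)
  finally show ?thesis .
qed

section \<open>Points with several supporting ellipsoids are negligible\<close>

lemma continuous_on_conormal_contact:
  "0 < l \<Longrightarrow> continuous_on (contact l u) (\<lambda>w. conormal (fst (snd w)) (snd (snd w)) (fst w))"
  by (intro continuous_intros) (auto simp: contact_def dest: D_nonzero)

lemma conormal_inner_contact:
  assumes "x \<in> X" "supp P d x" shows "conormal P d x \<bullet> x = 1 / \<rho> x"
  using conormal_inner_self[OF X_norm[OF assms(1)]] supports_atD(3)[OF assms(2)] by simp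

lemma conormal_inner_le_rho:
  assumes "x \<in> X" "y \<in> X" "supp P d x" shows "conormal P d x \<bullet> y \<le> 1 / \<rho> y"
proof -
  have "conormal P d x \<bullet> y \<le> 1 / polar_radius P d y"
    using conormal_inner_le assms X_norm supports_atD(1) by blast
  also have "\<dots> \<le> 1 / \<rho> y"
    using rho_pos[OF assms(2)] supports_atD(2)[OF assms(3,2)] by (simp add: frac_le)
  finally show ?thesis .
qed

text \<open>Confocal ellipsoids are nested, so of two with focus \<open>P\<close> the larger one
  cannot touch the reflector. The points of contact may differ; hence each focus has only one
  parameter for the whole reflector.\<close>

lemma supports_unique_parameter:
  assumes "x \<in> X" "x' \<in> X" "P \<in> D" "supp P d x" "supp P d' x'" shows "d = d'"
proof (rule antisym)
  note [simp] = D_nonzero[OF \<open>P \<in> D\<close>] X_norm[OF assms(1)] X_norm[OF assms(2)]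
    supports_atD(1)[OF assms(4)] supports_atD(1)[OF assms(5)]
  have "polar_radius P d x \<le> polar_radius P d' x"
    using supports_atD(3)[OF assms(4)] supports_atD(2)[OF assms(5,1)] by simp
  then show "d \<le> d'" by (simp add: polar_radius_le_iff)
  have "polar_radius P d' x' \<le> polar_radius P d x'"
    using supports_atD(3)[OF assms(5)] supports_atD(2)[OF assms(4,2)] by simp
  then show "d' \<le> d" by (simp add: polar_radius_le_iff)
qed

text \<open>Supporting parameters need not lie in \<open>{lo..hi}\<close>; they are exhausted by
  windows bounded away from 0, for which the contact relation is compact.\<close>

definition conormals :: "nat \<Rightarrow> (point \<times> point) set" where
  "conormals n = (\<lambda>w. (fst w, conormal (fst (snd w)) (snd (snd w)) (fst w))) ` contact (inverse (real (Suc n))) (real n)"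

lemma compact_conormals: "compact (conormals n)"
  unfolding conormals_def
  by (intro compact_continuous_image compact_contact continuous_on_Pair continuous_on_conormal_contact
      continuous_on_fst continuous_on_id) auto

lemma conormalsE:
  assumes "(x, g) \<in> conormals n"
  obtains P d where "x \<in> X" "P \<in> D" "supp P d x" "g = conormal P d x"
  using assms by (auto simp: conormals_def contact_def)

text \<open>At \<open>x'\<close> the conormal of the ellipsoid touching there attains 1 / \<rho>,
  which bounds every other conormal.\<close>

lemma conormals_mono: "(x, g) \<in> conormals n \<Longrightarrow> (x', g') \<in> conormals n \<Longrightarrow> g \<bullet> x' \<le> g' \<bullet> x'"
  by (elim conormalsE) (simp add: conormal_inner_contact conormal_inner_le_rho)

text \<open>Membership for all large \<open>n\<close> allows two conormals to be placed in the same
  window.\<close>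

lemma mem_conormals:
  assumes "x \<in> X" "P \<in> D" "supp P d x"
  shows "\<exists>m. \<forall>n\<ge>m. (x, conormal P d x) \<in> conormals n"
proof -
  have d: "0 < d" by (rule supports_atD(1)) fact
  obtain n1 where n1: "inverse (real (Suc n1)) < d" using reals_Archimedean[OF d] by blast
  obtain n2 where n2: "d < real n2" using reals_Archimedean2 by blast
  have "(x, conormal P d x) \<in> conormals n" if "max n1 n2 \<le> n" for n
  proof -
    have "inverse (real (Suc n)) \<le> inverse (real (Suc n1))" "real n2 \<le> real n"
      using that by (auto intro!: le_imp_inverse_le)
    then have "d \<in> {inverse (real (Suc n))..real n}" using n1 n2 unfolding atLeastAtMost_iff by linarith
    then show ?thesis unfolding conormals_def
      using assms by (intro image_eqI[of _ _ "(x, P, d)"]) (auto simp: contact_def)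
  qed
  then show ?thesis by blast
qed

lemma null_distinct_conormals:
  "{x \<in> X. \<exists>P\<in>D. \<exists>P'\<in>D. \<exists>d d'. supp P d x \<and> supp P' d' x \<and> conormal P d x \<noteq> conormal P' d' x}
    \<in> null_sets surface" (is "?N \<in> _")
proof (rule null_sets_surface_subset)
  let ?M = "\<lambda>n. {x. \<exists>g1 g2. (x, g1) \<in> conormals n \<and> (x, g2) \<in> conormals n \<and> g1 \<noteq> g2}"
  have "?M n \<in> null_sets surface" for n
    using compact_conormals _ conormals_mono
    by (rule null_sets_surface_multivalued) (auto simp: X_norm elim: conormalsE)
  then show "(\<Union>n. ?M n) \<in> null_sets surface" by (intro null_sets_UN)
  show "?N \<subseteq> (\<Union>n. ?M n)"
  proof clarify
    fix x P P' d d' assume *: "x \<in> X" "P \<in> D" "P' \<in> D" "supp P d x" "supp P' d' x"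
      and ne: "conormal P d x \<noteq> conormal P' d' x"
    obtain m m' where "\<forall>n\<ge>m. (x, conormal P d x) \<in> conormals n" "\<forall>n\<ge>m'. (x, conormal P' d' x) \<in> conormals n"
      using mem_conormals * by meson
    then have "(x, conormal P d x) \<in> conormals (max m m')" "(x, conormal P' d' x) \<in> conormals (max m m')"
      by auto
    then show "x \<in> (\<Union>n. ?M n)" using ne by blast
  qed
qed

text \<open>Each pair of foci contributes at most one point. The parameters d, d' are fixed by the
  foci, so equality of the conormals is a linear equation for \<open>x\<close> with coefficient 1/d
  - 1/d'. This is not zero, as equal parameters would give equal eccentricity vectors and equal
  foci.\<close>

lemma null_common_conormal_countable:
  assumes "countable D"
  shows "{x \<in> X. \<exists>P\<in>D. \<exists>P'\<in>D. \<exists>d d'. P \<noteq> P' \<and> supp P d x \<and> supp P' d' x \<and> conormal P d x = conormal P' d' x}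
    \<in> null_sets surface" (is "?N \<in> _")
proof (rule null_sets_surface_countable)
  let ?S = "\<lambda>P P'. {x \<in> X. \<exists>d d'. P \<noteq> P' \<and> supp P d x \<and> supp P' d' x \<and> conormal P d x = conormal P' d' x}"
  have single: "?S P P' \<subseteq> {x}" if PD: "P \<in> D" "P' \<in> D" and x: "x \<in> ?S P P'" for P P' x
  proof
    fix y assume y: "y \<in> ?S P P'"
    obtain d d' where d: "supp P d x" "supp P' d' x" "conormal P d x = conormal P' d' x" "x \<in> X" "P \<noteq> P'"
      using x by blast
    obtain e e' where e: "supp P e y" "supp P' e' y" "conormal P e y = conormal P' e' y" "y \<in> X"
      using y by blast
    have "e = d" "e' = d'" using supports_unique_parameter d e PD by blast+
    have pos: "0 < d" "0 < d'" using supports_atD(1) d by blast+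
    have "d \<noteq> d'"
    proof
      assume "d = d'"
      then have "focal P d = focal P' d" using d(3) pos by (simp add: conormal_def)
      then have "P = P'" using focus_of_focal[of P d] focus_of_focal[of P' d] pos D_nonzero PD by metis
      then show False using d by simp
    qed
    have eq: "(1 / d - 1 / d') *\<^sub>R z = focal P d /\<^sub>R d - focal P' d' /\<^sub>R d'"
      if "conormal P d z = conormal P' d' z" for z
    proof -
      have "(1 / d) *\<^sub>R z - (1 / d') *\<^sub>R z - (focal P d /\<^sub>R d - focal P' d' /\<^sub>R d')
          = conormal P d z - conormal P' d' z"
        by (simp add: conormal_def scaleR_diff_right divide_inverse)
      then show ?thesis using that by (simp add: scaleR_diff_left)
    qed
    have "(1 / d - 1 / d') *\<^sub>R x = (1 / d - 1 / d') *\<^sub>R y"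
      using eq[OF d(3)] eq[of y] e(3) unfolding \<open>e = d\<close> \<open>e' = d'\<close> by simp
    moreover have "1 / d - 1 / d' \<noteq> 0" using \<open>d \<noteq> d'\<close> pos by (simp add: field_simps)
    ultimately show "y \<in> {x}" by simp
  qed
  then have "countable (?S P P')" if "P \<in> D" "P' \<in> D" for P P'
  proof (cases "?S P P' = {}")
    case False
    then obtain x where "x \<in> ?S P P'" by blast
    then have "?S P P' \<subseteq> {x}" using single that by blast
    then show ?thesis by (rule countable_subset) simp
  qed (simp only: countable_empty)
  then have "countable (\<Union>P\<in>D. \<Union>P'\<in>D. ?S P P')"
    using assms by (intro countable_UN) auto
  then show "countable ?N" by (rule countable_subset[rotated]) auto
qed (use X in auto)

text \<open>If two foci in the plane \<open>a \<bullet> x = b\<close> share a conormal, then the reflected ray lies in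
  the plane. Hence so does the point \<open>\<rho> x *\<^sub>R x\<close>, and the conormal \<open>a /\<^sub>R b\<close> of the plane is a
  second, different subgradient at that point.\<close>

lemma null_common_conormal_plane:
  assumes "a \<noteq> 0" "D \<subseteq> {x. a \<bullet> x = b}"
  shows "{x \<in> X. \<exists>P\<in>D. \<exists>P'\<in>D. \<exists>d d'. P \<noteq> P' \<and> supp P d x \<and> supp P' d' x \<and> conormal P d x = conormal P' d' x}
    \<in> null_sets surface" (is "?N \<in> _")
proof -
  have N: "\<exists>P d. x \<in> X \<and> P \<in> D \<and> supp P d x \<and> \<rho> x * (a \<bullet> x) = b \<and> b *\<^sub>R conormal P d x \<noteq> a" if x: "x \<in> ?N" for x
  proof -
    obtain P P' d d' where *: "x \<in> X" "P \<in> D" "P' \<in> D" "P \<noteq> P'" "supp P d x" "supp P' d' x"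
      "conormal P d x = conormal P' d' x"
      using x by blast
    have "a \<bullet> P = b" "a \<bullet> P' = b" using * assms by auto
    note ray = reflected_ray_in_plane[OF X_norm[OF *(1)] D_nonzero[OF *(2)] supports_atD(1)[OF *(5)]
        D_nonzero[OF *(3)] supports_atD(1)[OF *(6)] *(4) *(7) this]
    then have "\<rho> x * (a \<bullet> x) = b" "b *\<^sub>R conormal P d x \<noteq> a"
      using assms(1) supports_atD(3)[OF *(5)] by auto
    then show ?thesis using * by blast
  qed
  show ?thesis
  \<comment> \<open>A plane through the origin has no conormal \<open>a /\<^sub>R b\<close>, but
    then \<open>x\<close> lies on a great circle.\<close>
  proof (cases "b = 0")
    case True
    have "?N \<subseteq> {x \<in> S2. a \<bullet> x = 0}"
    proof
      fix x assume "x \<in> ?N"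
      then have "x \<in> X" "\<rho> x * (a \<bullet> x) = 0" using N[of x] True by auto
      then show "x \<in> {x \<in> S2. a \<bullet> x = 0}" using rho_pos[of x] X_norm[of x] by simp
    qed
    then show ?thesis using null_sets_surface_hyperplane[OF assms(1)] null_sets_surface_subset by blast
  next
    case False
    let ?T = "{x \<in> X. \<rho> x * (a \<bullet> x) = b}"
    \<comment> \<open>The relation is restricted to \<open>?T\<close>, where the surface meets the
      plane: there the product of the plane's conormal with \<open>x\<close> is exactly 1 / \<rho>
      x, so adding it preserves monotonicity.\<close>
    let ?R = "\<lambda>n. conormals n \<inter> (?T \<times> UNIV) \<union> ?T \<times> {a /\<^sub>R b}"
    let ?M = "\<lambda>n. {x. \<exists>g1 g2. (x, g1) \<in> ?R n \<and> (x, g2) \<in> ?R n \<and> g1 \<noteq> g2}"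
    have "closed ?T"
      by (intro continuous_closed_preimage_constant continuous_intros cont compact_imp_closed X)
    then have T: "compact ?T"
      using compact_Int_closed[OF X(1), of ?T] by (simp add: Int_def)
    have ha: "(a /\<^sub>R b) \<bullet> x = 1 / \<rho> x" if "x \<in> ?T" for x
    proof -
      have "\<rho> x \<noteq> 0" "\<rho> x * (a \<bullet> x) = b" using that rho_pos[of x] by auto
      then show ?thesis using False by (simp add: divide_inverse) (simp add: field_simps)
    qed
    have hg: "g \<bullet> x' \<le> 1 / \<rho> x'" "g \<bullet> x = 1 / \<rho> x" if "(x, g) \<in> conormals n" "x' \<in> X" for x g x' n
      using that by (auto elim!: conormalsE simp: conormal_inner_contact conormal_inner_le_rho)
    have "?M n \<in> null_sets surface" for n
    proof (rule null_sets_surface_multivalued)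
      show "compact (?R n)"
        by (intro compact_Un compact_Int_closed compact_Times closed_Times compact_conormals T
            compact_imp_closed[OF T] closed_UNIV) auto
      show "fst ` ?R n \<subseteq> S2" using X by auto
      fix x g x' g' assume xg: "(x, g) \<in> ?R n" and xg': "(x', g') \<in> ?R n"
      have T': "x' \<in> ?T" using xg' by blast
      have "g' \<bullet> x' = 1 / \<rho> x'" using xg' ha[OF T'] hg(2) by blast
      moreover have "g \<bullet> x' \<le> 1 / \<rho> x'"
      proof (cases "(x, g) \<in> conormals n")
        case True then show ?thesis using hg(1) T' by blast
      next
        case False
        then have "g = a /\<^sub>R b" using xg by blast
        then show ?thesis using ha[OF T'] by simp
      qed
      ultimately show "g \<bullet> x' \<le> g' \<bullet> x'" by simp
    qed
    then have "(\<Union>n. ?M n) \<in> null_sets surface" by (intro null_sets_UN)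
    then show ?thesis
    proof (rule null_sets_surface_subset[rotated], intro subsetI)
      fix x assume "x \<in> ?N"
      then obtain P d where Pd: "x \<in> X" "P \<in> D" "supp P d x" "\<rho> x * (a \<bullet> x) = b" "b *\<^sub>R conormal P d x \<noteq> a"
        using N by blast
      then obtain n where "(x, conormal P d x) \<in> conormals n" using mem_conormals by blast
      moreover have "conormal P d x \<noteq> a /\<^sub>R b" using Pd(5) False by auto
      ultimately have "x \<in> ?M n" using Pd by blast
      then show "x \<in> (\<Union>n. ?M n)" by blast
    qed
  qed
qed

lemma null_multiply_supported:
  assumes "(\<exists>a b. a \<noteq> 0 \<and> D \<subseteq> {x. a \<bullet> x = b}) \<or> countable D"
  shows "multiply_supported \<in> null_sets surface"
proof -
  let ?N = "{x \<in> X. \<exists>P\<in>D. \<exists>P'\<in>D. \<exists>d d'. P \<noteq> P' \<and> supp P d x \<and> supp P' d' x \<and> conormal P d x = conormal P' d' x}"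
  let ?N' = "{x \<in> X. \<exists>P\<in>D. \<exists>P'\<in>D. \<exists>d d'. supp P d x \<and> supp P' d' x \<and> conormal P d x \<noteq> conormal P' d' x}"
  have "?N \<in> null_sets surface"
    using assms
  proof (elim disjE exE conjE)
    fix a b assume "a \<noteq> 0" "D \<subseteq> {x. a \<bullet> x = b}"
    then show ?thesis by (rule null_common_conormal_plane)
  qed (rule null_common_conormal_countable)
  then have "?N' \<union> ?N \<in> null_sets surface"
    by (rule null_sets.Un[OF null_distinct_conormals])
  moreover have "multiply_supported \<subseteq> ?N' \<union> ?N"
  proof
    fix x assume "x \<in> multiply_supported"
    then obtain P P' d d' where *: "x \<in> X" "P \<in> D" "P' \<in> D" "supp P d x" "supp P' d' x" "(P, d) \<noteq> (P', d')"
      unfolding multiply_supported_def by blast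
    have "P \<noteq> P'"
    proof
      assume "P = P'"
      moreover from this have "d = d'"
        using supports_unique_parameter[OF *(1) *(1) *(2) *(4)] *(5) by simp
      ultimately show False using *(6) by simp
    qed
    show "x \<in> ?N' \<union> ?N"
    proof (cases "conormal P d x = conormal P' d' x")
      case True
      then have "x \<in> ?N" using *(1-5) \<open>P \<noteq> P'\<close> by blast
      then show ?thesis by (rule UnI2)
    next
      case False
      then have "x \<in> ?N'" using *(1-5) by blast
      then show ?thesis by (rule UnI1)
    qed
  qed
  ultimately show ?thesis by (rule null_sets_surface_subset[rotated])
qed

lemma multiply_supportedD:
  assumes "x \<in> X" "x \<notin> multiply_supported" "P \<in> D" "supp P d x" "P' \<in> D" "supp P' d' x"
  shows "P' = P" "d' = d"
  using assms unfolding multiply_supported_def by blast+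

section \<open>Differentiability of the reflector and its outer normal\<close>

lemma conormal_inner_surface:
  assumes "x \<in> X" "y \<in> X" "supp P d x"
  shows "conormal P d x \<bullet> (\<rho> y *\<^sub>R y) \<le> 1" "conormal P d x \<bullet> (\<rho> x *\<^sub>R x) = 1"
  using conormal_inner_le_rho[OF assms] conormal_inner_contact[OF assms(1,3)] rho_pos[OF assms(1)] rho_pos[OF assms(2)]
  by (simp_all add: field_simps)

text \<open>The subgradient inequalities at \<open>p\<close> and at a nearby surface point
  \<open>z\<close> squeeze the deviation from the tangent plane by the difference of the two
  conormals, which tends to 0 because the conormal at \<open>p\<close> is unique.\<close>

lemma conormal_tendsto_zero:
  assumes x: "x \<in> X" "x \<notin> multiply_supported" and P: "P \<in> D" "supp P d x"
  defines "p \<equiv> \<rho> x *\<^sub>R x" and "g \<equiv> conormal P d x"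
  shows "((\<lambda>z. ((z - p) \<bullet> g) / norm (z - p)) \<longlongrightarrow> 0) (at p within surface_of X \<rho>)"
proof (rule tendstoI)
  fix e :: real assume e: "e > 0"
  define K where "K = (\<lambda>w. (\<rho> (fst w) *\<^sub>R fst w, conormal (fst (snd w)) (snd (snd w)) (fst w))) ` contact lo hi"
  have "compact K"
    unfolding K_def
    by (intro compact_continuous_image compact_contact lo continuous_on_Pair continuous_on_conormal_contact
        continuous_intros continuous_on_compose2[OF cont]) (auto simp: contact_def)
  \<comment> \<open>The surface is a radial graph, so the point \<open>p\<close> determines
    \<open>x\<close>.\<close>
  moreover have "h = g" if "(p, h) \<in> K" for h
  proof -
    obtain y Q c where y: "y \<in> X" "Q \<in> D" "supp Q c y" "\<rho> y *\<^sub>R y = \<rho> x *\<^sub>R x" "h = conormal Q c y"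
      using \<open>(p, h) \<in> K\<close> by (auto simp: K_def contact_def p_def)
    have "norm (\<rho> y *\<^sub>R y) = norm (\<rho> x *\<^sub>R x)" using y(4) by simp
    then have "\<rho> y = \<rho> x"
      using rho_pos[OF x(1)] rho_pos[OF y(1)] X_norm[OF x(1)] X_norm[OF y(1)] by simp
    then have "y = x" using y(4) rho_pos[OF x(1)] by simp
    then show ?thesis using multiply_supportedD[OF x P] y by (simp add: g_def)
  qed
  ultimately obtain r where r: "r > 0" "\<And>z h. (z, h) \<in> K \<Longrightarrow> dist z p < r \<Longrightarrow> norm (h - g) < e"
    using compact_fibre_singleton_imp_near[OF _ _ e, of K p g] by blast
  show "\<forall>\<^sub>F z in at p within surface_of X \<rho>. dist (((z - p) \<bullet> g) / norm (z - p)) 0 < e"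
    unfolding eventually_at
  proof (intro exI[of _ r] conjI ballI impI)
    fix z assume "z \<in> surface_of X \<rho>" and zp: "z \<noteq> p \<and> dist z p < r"
    then obtain y where y: "y \<in> X" "z = \<rho> y *\<^sub>R y" by (auto simp: surface_of_def)
    obtain Q c where Q: "Q \<in> D" "c \<in> {lo..hi}" "supp Q c y" using supported y by blast
    let ?h = "conormal Q c y"
    have "(z, ?h) \<in> K"
      unfolding K_def using y Q by (intro image_eqI[of _ _ "(y, Q, c)"]) (auto simp: contact_def)
    then have h: "norm (?h - g) < e" using r zp by blast
    have "g \<bullet> z \<le> 1" "g \<bullet> p = 1"
      using conormal_inner_surface[OF x(1) y(1) P(2)] by (simp_all add: y p_def g_def)
    moreover have "?h \<bullet> p \<le> 1" "?h \<bullet> z = 1"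
      using conormal_inner_surface[OF y(1) x(1) Q(3)] by (simp_all add: y p_def)
    \<comment> \<open>The surface lies below both tangent planes: (z - p) . g <= 0, whereas (z - p)
      . h >= 0.\<close>
    ultimately have "\<bar>(z - p) \<bullet> g\<bar> \<le> (?h - g) \<bullet> (z - p)"
      by (simp add: inner_diff_left inner_diff_right inner_commute)
    also have "\<dots> \<le> norm (?h - g) * norm (z - p)" by (rule norm_cauchy_schwarz)
    also have "\<dots> < e * norm (z - p)" using h zp by (intro mult_strict_right_mono) auto
    finally show "dist (((z - p) \<bullet> g) / norm (z - p)) 0 < e"
      using zp by (simp add: abs_divide field_simps)
  qed (rule r)
qed

text \<open>Needed for uniqueness of the normal: every vector in the tangent plane is a limit
  direction of secants of the surface. Interiority of \<open>x\<close> guarantees that a curve in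
  direction \<open>w\<close> stays on the surface.\<close>

lemma tangent_vector_of_surface:
  assumes x: "x \<in> X" "x \<notin> multiply_supported" and P: "P \<in> D" "supp P d x"
    and int: "x \<in> (top_of_set S2) interior_of X"
    and w: "w \<bullet> conormal P d x = 0"
    and \<nu>: "((\<lambda>z. ((z - \<rho> x *\<^sub>R x) \<bullet> \<nu>) / norm (z - \<rho> x *\<^sub>R x)) \<longlongrightarrow> 0) (at (\<rho> x *\<^sub>R x) within surface_of X \<rho>)"
  shows "w \<bullet> \<nu> = 0"
proof (rule ccontr)
  assume ne: "w \<bullet> \<nu> \<noteq> 0"
  define p g where "p = \<rho> x *\<^sub>R x" and "g = conormal P d x"
  have gp: "g \<bullet> p = 1" using conormal_inner_surface(2)[OF x(1) x(1) P(2)] by (simp add: p_def g_def)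
  have wg: "w \<bullet> g = 0" using w by (simp add: g_def)
  have w0: "w \<noteq> 0" using ne by auto
  \<comment> \<open>The tangent line at \<open>p\<close>, projected radially onto the surface. Since
    \<open>g\<close> is 1 along this line, it takes the value \<open>s t\<close> at the projected
    point.\<close>
  define q where "q t = p + t *\<^sub>R w" for t
  define y where "y t = q t /\<^sub>R norm (q t)" for t
  define s where "s t = \<rho> (y t) / norm (q t)" for t
  define z where "z t = \<rho> (y t) *\<^sub>R y t" for t
  have p0: "p \<noteq> 0" using gp by auto
  have q0: "q t \<noteq> 0" for t
  proof
    assume "q t = 0"
    then have "g \<bullet> q t = 0" by simp
    then show False using gp wg by (simp add: q_def inner_add_right inner_commute)
  qed
  have np: "norm p = \<rho> x" using rho_pos[OF x(1)] X_norm[OF x(1)] by (simp add: p_def)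
  have ql: "(q \<longlongrightarrow> p) (at_right 0)"
    unfolding q_def by (rule tendsto_eq_intros refl tendsto_ident_at | simp)+
  have "(y \<longlongrightarrow> p /\<^sub>R norm p) (at_right 0)"
    unfolding y_def using ql p0 by (intro tendsto_intros) auto
  then have yl: "(y \<longlongrightarrow> x) (at_right 0)"
    using np rho_pos[OF x(1)] by (simp add: p_def)
  obtain U where U: "open U" "x \<in> U" "S2 \<inter> U \<subseteq> X"
    using int by (auto simp: interior_of_def openin_open)
  have yS: "y t \<in> S2" for t using q0[of t] by (simp add: y_def)
  have "eventually (\<lambda>t. y t \<in> U) (at_right 0)"
    using topological_tendstoD[OF yl U(1,2)] .
  then have yX: "eventually (\<lambda>t. y t \<in> X) (at_right 0)"
    by eventually_elim (use U(3) yS in blast)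
  have rl: "((\<lambda>t. \<rho> (y t)) \<longlongrightarrow> \<rho> x) (at_right 0)"
    by (rule continuous_on_tendsto_compose[OF cont yl x(1) yX])
  have zl: "(z \<longlongrightarrow> p) (at_right 0)"
    unfolding z_def p_def by (intro tendsto_intros rl yl)
  have zs: "z t = s t *\<^sub>R q t" for t by (simp add: z_def s_def y_def divide_inverse)
  have gz: "g \<bullet> z t = s t" for t
    using gp wg by (simp add: zs q_def inner_add_right inner_commute)
  have zp: "z t \<noteq> p" if "t > 0" for t
  proof
    assume zp: "z t = p"
    then have "s t = 1" using gz[of t] gp by simp
    then show False using zp that w0 by (simp add: zs q_def)
  qed
  have at: "filterlim z (at p within surface_of X \<rho>) (at_right 0)"
    unfolding filterlim_at
  proof
    show "eventually (\<lambda>t. z t \<in> surface_of X \<rho> \<and> z t \<noteq> p) (at_right 0)"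
      using yX eventually_at_right_less[of 0]
      by eventually_elim (auto simp: surface_of_def zp, simp add: z_def)
  qed (rule zl)
  have A: "((\<lambda>t. ((z t - p) \<bullet> g) / norm (z t - p)) \<longlongrightarrow> 0) (at_right 0)"
    using filterlim_compose[OF conormal_tendsto_zero[OF x P] at[unfolded p_def]] by (simp add: p_def g_def)
  have B: "((\<lambda>t. ((z t - p) \<bullet> \<nu>) / norm (z t - p)) \<longlongrightarrow> 0) (at_right 0)"
    using filterlim_compose[OF \<nu> at[unfolded p_def]] by (simp add: p_def)
  define a b where "a t = ((z t - p) \<bullet> g) / norm (z t - p)" and "b t = s t * t / norm (z t - p)" for t
  \<comment> \<open>The unit secant in terms of \<open>w\<close> and \<open>p\<close>.
    Differentiability sends \<open>a\<close> to 0, and then the assumption on \<nu> with w . \<nu>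
    not zero sends \<open>b\<close> to 0, which is impossible for unit vectors.\<close>
  have sg: "sgn (z t - p) = b t *\<^sub>R w + a t *\<^sub>R p" for t
  proof -
    have "z t - p = (s t * t) *\<^sub>R w + ((z t - p) \<bullet> g) *\<^sub>R p"
      using gz[of t] gp by (simp add: inner_diff_left inner_commute) (simp add: zs q_def algebra_simps)
    then show ?thesis
      by (metis (no_types, lifting) a_def b_def divide_inverse_commute scaleR_add_right scaleR_scaleR sgn_div_norm)
  qed
  have a0: "(a \<longlongrightarrow> 0) (at_right 0)" using A by (simp add: a_def[abs_def])
  have "((\<lambda>t. (((z t - p) \<bullet> \<nu>) / norm (z t - p) - a t * (p \<bullet> \<nu>)) / (w \<bullet> \<nu>)) \<longlongrightarrow> (0 - 0 * (p \<bullet> \<nu>)) / (w \<bullet> \<nu>)) (at_right 0)"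
    using ne by (intro tendsto_intros B a0)
  moreover have "(((z t - p) \<bullet> \<nu>) / norm (z t - p) - a t * (p \<bullet> \<nu>)) / (w \<bullet> \<nu>) = b t" for t
  proof -
    have "((z t - p) \<bullet> \<nu>) / norm (z t - p) = sgn (z t - p) \<bullet> \<nu>"
      by (simp add: sgn_div_norm divide_inverse mult.commute)
    then show ?thesis using ne by (simp add: sg inner_add_left)
  qed
  ultimately have b0: "(b \<longlongrightarrow> 0) (at_right 0)" by simp
  have "((\<lambda>t. sgn (z t - p)) \<longlongrightarrow> 0 *\<^sub>R w + 0 *\<^sub>R p) (at_right 0)"
    unfolding sg by (intro tendsto_intros a0 b0)
  then have "((\<lambda>t. norm (sgn (z t - p))) \<longlongrightarrow> 0) (at_right 0)"
    by (intro tendsto_norm_zero) simp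
  moreover have "eventually (\<lambda>t. norm (sgn (z t - p)) = 1) (at_right (0::real))"
    using eventually_at_right_less[of 0] by eventually_elim (simp add: norm_sgn zp)
  then have "((\<lambda>t. norm (sgn (z t - p))) \<longlongrightarrow> 1) (at_right 0)"
    by (rule tendsto_eventually)
  ultimately have "(0::real) = 1" by (intro tendsto_unique) (auto simp: trivial_limit_at_right_real)
  then show False by simp
qed

text \<open>The component of any outer normal \<nu> orthogonal to the conormal is a tangent vector,
  so it is orthogonal to \<nu> and hence to itself. The sign is fixed by p . \<nu> > 0.\<close>

lemma outer_normal_eq:
  assumes x: "x \<in> X" "x \<notin> multiply_supported" and P: "P \<in> D" "supp P d x"
    and int: "x \<in> (top_of_set S2) interior_of X"
  shows "outer_normal X \<rho> x = sgn (x - focal P d)"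
  unfolding outer_normal_def
proof (rule the_equality)
  let ?p = "\<rho> x *\<^sub>R x" and ?g = "conormal P d x"
  have d: "0 < d" using P by (simp add: supports_atD)
  have g: "sgn (x - focal P d) = sgn ?g" using d by (simp add: conormal_def sgn_scaleR)
  have gp: "?g \<bullet> ?p = 1" by (rule conormal_inner_surface(2)[OF x(1) x(1) P(2)])
  then have g0: "?g \<noteq> 0" by auto
  have sg: "sgn ?g = ?g /\<^sub>R norm ?g" by (simp add: sgn_div_norm)
  show "is_outer_normal (surface_of X \<rho>) ?p (sgn (x - focal P d))"
    unfolding is_outer_normal_def g
  proof (intro conjI)
    show "norm (sgn ?g) = 1" using g0 by (simp add: norm_sgn)
    show "?p \<bullet> sgn ?g > 0" using gp g0 by (simp add: sg inner_commute)
    have "((\<lambda>z. inverse (norm ?g) * (((z - ?p) \<bullet> ?g) / norm (z - ?p))) \<longlongrightarrow> inverse (norm ?g) * 0)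
        (at ?p within surface_of X \<rho>)"
      by (intro tendsto_intros conormal_tendsto_zero x P)
    then show "((\<lambda>z. ((z - ?p) \<bullet> sgn ?g) / norm (z - ?p)) \<longlongrightarrow> 0) (at ?p within surface_of X \<rho>)"
      by (simp add: sg)
  qed
  fix \<nu> assume \<nu>: "is_outer_normal (surface_of X \<rho>) ?p \<nu>"
  define c where "c = (\<nu> \<bullet> ?g) / (?g \<bullet> ?g)"
  define w where "w = \<nu> - c *\<^sub>R ?g"
  have wg: "w \<bullet> ?g = 0" using g0 by (simp add: w_def c_def inner_diff_left)
  then have "w \<bullet> \<nu> = 0"
    using tangent_vector_of_surface[OF x P int wg] \<nu> by (simp add: is_outer_normal_def)
  then have "w \<bullet> w = 0" using wg by (simp add: w_def inner_diff_right)
  then have \<nu>c: "\<nu> = c *\<^sub>R ?g" by (simp add: w_def)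
  have "0 < ?p \<bullet> \<nu>" "norm \<nu> = 1" using \<nu> by (auto simp: is_outer_normal_def)
  then have "0 < c" using gp unfolding \<nu>c by (simp only: inner_scaleR_right inner_commute[of ?p])
  then have "sgn \<nu> = sgn ?g" unfolding \<nu>c by (simp add: sgn_scaleR)
  moreover have "sgn \<nu> = \<nu>" using \<open>norm \<nu> = 1\<close> by (simp add: sgn_div_norm)
  ultimately show "\<nu> = sgn (x - focal P d)" using g by simp
qed

section \<open>Measurable choice of a supporting ellipsoid\<close>

definition sel :: "point \<Rightarrow> point \<times> real" where
  "sel x = (if x \<in> X then SOME p. fst p \<in> D \<and> snd p \<in> {lo..hi} \<and> supp (fst p) (snd p) x else (0, 0))"

lemma sel:
  assumes "x \<in> X"
  shows "fst (sel x) \<in> D" "snd (sel x) \<in> {lo..hi}" "supp (fst (sel x)) (snd (sel x)) x"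
proof -
  have "\<exists>p. fst p \<in> D \<and> snd p \<in> {lo..hi} \<and> supp (fst p) (snd p) x"
    using supported[OF assms] by (metis fst_conv snd_conv)
  from someI_ex[OF this] show "fst (sel x) \<in> D" "snd (sel x) \<in> {lo..hi}" "supp (fst (sel x)) (snd (sel x)) x"
    using assms by (simp_all add: sel_def)
qed

lemma sel_outside: "x \<notin> X \<Longrightarrow> sel x = (0, 0)"
  by (simp add: sel_def)

lemma sel_unique:
  assumes "x \<in> X" "x \<notin> multiply_supported" "P \<in> D" "supp P d x"
  shows "sel x = (P, d)"
  using multiply_supportedD[OF assms sel(1,3)] assms by (simp add: prod_eq_iff)

text \<open>The choice is arbitrary, but the preimage of a closed set differs from a compact
  projection of the contact relation only inside a null set, and the surface measure is
  complete.\<close>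

lemma measurable_sel:
  assumes null: "multiply_supported \<in> null_sets surface"
  shows "sel \<in> borel_measurable surface"
proof (rule borel_measurableI)
  have XS: "X \<in> sets surface"
    using X by (intro sets_surface_borel) (auto simp: borel_compact)
  have C: "{x \<in> X. sel x \<in> C} \<in> sets surface" if "closed C" for C
  proof -
    let ?B = "fst ` (contact lo hi \<inter> UNIV \<times> C)"
    have "compact ?B"
      using that by (intro compact_continuous_image compact_Int_closed compact_contact lo closed_Times
          continuous_intros) auto
    moreover have BX: "?B \<subseteq> X" by (auto simp: contact_def)
    ultimately have B: "?B \<in> sets surface"
      using X by (intro sets_surface_borel) (auto simp: borel_compact)
    have sub: "{x \<in> X. sel x \<in> C} \<subseteq> ?B"
    proof clarify
      fix x assume "x \<in> X" "sel x \<in> C"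
      then show "x \<in> ?B"
        using sel[of x] by (intro image_eqI[of _ _ "(x, sel x)"]) (auto simp: contact_def split_beta)
    qed
    have "?B - {x \<in> X. sel x \<in> C} \<subseteq> multiply_supported"
    proof
      fix x assume x: "x \<in> ?B - {x \<in> X. sel x \<in> C}"
      then obtain P d where Pd: "x \<in> X" "P \<in> D" "supp P d x" "(P, d) \<in> C"
        by (auto simp: contact_def)
      then show "x \<in> multiply_supported"
        using sel_unique[OF Pd(1) _ Pd(2,3)] x by (intro ccontr[of "x \<in> multiply_supported"]) auto
    qed
    then have "?B - {x \<in> X. sel x \<in> C} \<in> sets surface"
      using null_sets_surface_subset[OF _ null] by blast
    then have "?B - (?B - {x \<in> X. sel x \<in> C}) \<in> sets surface" using B by blast
    also have "?B - (?B - {x \<in> X. sel x \<in> C}) = {x \<in> X. sel x \<in> C}" using sub by blast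
    finally show ?thesis .
  qed
  fix S :: "(point \<times> real) set" assume "open S"
  then have 1: "X - {x \<in> X. sel x \<in> - S} \<in> sets surface" using C[of "- S"] XS by (simp add: closed_Compl)
  show "sel -` S \<inter> space surface \<in> sets surface"
  \<comment> \<open>The default value of \<open>sel\<close> off \<open>X\<close> decides whether the
    complement of \<open>X\<close> belongs to the preimage.\<close>
  proof (cases "(0, 0) \<in> S")
    case True
    have "x \<in> sel -` S \<inter> space surface \<longleftrightarrow> x \<in> (X - {x \<in> X. sel x \<in> - S}) \<union> (space surface - X)" for x
      using True X by (cases "x \<in> X") (auto simp: space_surface sel_outside)
    then have "sel -` S \<inter> space surface = (X - {x \<in> X. sel x \<in> - S}) \<union> (space surface - X)"
      by blast
    then show ?thesis using 1 XS by auto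
  next
    case False
    have "x \<in> sel -` S \<inter> space surface \<longleftrightarrow> x \<in> X - {x \<in> X. sel x \<in> - S}" for x
      using False X by (cases "x \<in> X") (auto simp: space_surface sel_outside)
    then have "sel -` S \<inter> space surface = X - {x \<in> X. sel x \<in> - S}"
      by blast
    then show ?thesis using 1 by simp
  qed
qed

lemma illum_density_eq:
  assumes x: "x \<in> X" "x \<notin> multiply_supported" and int: "x \<in> (top_of_set S2) interior_of X"
  shows "illum_density X f \<rho> x = f x * illum_weight (fst (sel x)) (snd (sel x)) x"
  using outer_normal_eq[OF x sel(1,3)[OF x(1)] int] supports_atD(3)[OF sel(3)[OF x(1)]]
  by (simp add: illum_density_def illum_weight_def)

lemma mem_tau_iff:
  assumes x: "x \<in> X" "x \<notin> multiply_supported" and "E \<subseteq> D"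
  shows "x \<in> tau X \<rho> E \<longleftrightarrow> fst (sel x) \<in> E"
proof
  assume "x \<in> tau X \<rho> E"
  then obtain P d where "P \<in> E" "supp P d x" by (auto simp: tau_def)
  then show "fst (sel x) \<in> E" using sel_unique[OF x] assms by auto
next
  assume "fst (sel x) \<in> E"
  then show "x \<in> tau X \<rho> E" using sel[OF x(1)] x by (auto simp: tau_def)
qed

end

section \<open>The transported energy\<close>

text \<open>Holds by completeness. It makes \<open>illum_density\<close> usable although
  \<open>outer_normal\<close> is unspecified on a null set.\<close>

lemma borel_measurable_surface_cong_AE:
  fixes f g :: "point \<Rightarrow> 'b::topological_space"
  assumes g: "g \<in> borel_measurable surface" and ae: "AE x in surface. f x = g x"
  shows "f \<in> borel_measurable surface"
proof (rule borel_measurableI)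
  fix S :: "'b set" assume "open S"
  then have A: "g -` S \<inter> space surface \<in> sets surface" using g by (auto intro: measurable_sets)
  have "AE x in surface. x \<in> g -` S \<inter> space surface \<longleftrightarrow> x \<in> f -` S \<inter> space surface"
    using ae by eventually_elim auto
  then show "f -` S \<inter> space surface \<in> sets surface"
    using completion.in_sets_AE[of "g -` S \<inter> space surface" "f -` S \<inter> space surface" surface_borel] A
    unfolding surface_def by blast
qed

lemma measurable_ident_surface[measurable]: "(\<lambda>x. x) \<in> borel_measurable surface"
proof (rule borel_measurableI)
  fix S :: "point set" assume "open S"
  then have "S \<inter> S2 \<in> sets surface"
    by (intro sets_surface_borel) auto
  then show "(\<lambda>x. x) -` S \<inter> space surface \<in> sets surface"
    by (simp add: space_surface vimage_def Int_def)
qed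

lemma supports_at_limit:
  assumes X: "X \<subseteq> S2" and x: "x \<in> X"
    and lim: "Q \<longlonglongrightarrow> P" "c \<longlonglongrightarrow> d" and pos: "P \<noteq> 0" "0 < d"
    and r: "\<And>y. y \<in> X \<Longrightarrow> (\<lambda>n. r n y) \<longlonglongrightarrow> \<rho> y"
    and supp: "\<And>n. supports_at X (r n) (Q n) (c n) x"
  shows "supports_at X \<rho> P d x"
proof -
  have l: "(\<lambda>n. polar_radius (Q n) (c n) y) \<longlonglongrightarrow> polar_radius P d y" if "y \<in> X" for y
    using that X pos lim by (intro tendsto_intros) auto
  have "\<rho> y \<le> polar_radius P d y" if "y \<in> X" for y
    using l[OF that] r[OF that] supports_atD(2)[OF supp that]
    by (intro LIMSEQ_le) blast+
  moreover have "\<rho> x = polar_radius P d x"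
    using l[OF x] r[OF x] supports_atD(3)[OF supp] by (simp add: LIMSEQ_unique)
  ultimately show ?thesis using pos by (simp add: supports_at_def)
qed

lemma LIMSEQ_compact_unique:
  fixes l :: "'a::metric_space"
  assumes K: "compact K" and p: "\<And>n. p n \<in> K"
    and l: "\<And>k l'. strict_mono k \<Longrightarrow> (p \<circ> k) \<longlonglongrightarrow> l' \<Longrightarrow> l' \<in> K \<Longrightarrow> l' = l"
  shows "p \<longlonglongrightarrow> l"
proof (rule ccontr)
  assume "\<not> p \<longlonglongrightarrow> l"
  then obtain e where "e > 0" and "\<not> (\<forall>\<^sub>F n in sequentially. dist (p n) l < e)"
    by (auto simp: tendsto_iff)
  then have "infinite {n. e \<le> dist (p n) l}"
    by (auto simp: eventually_sequentially infinite_nat_iff_unbounded_le not_less)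
  then obtain k :: "nat \<Rightarrow> nat" where k: "strict_mono k" "\<And>n. e \<le> dist (p (k n)) l"
    using infinite_enumerate by blast
  obtain l' k' where l': "l' \<in> K" "strict_mono k'" "((p \<circ> k) \<circ> k') \<longlonglongrightarrow> l'"
    using K[unfolded compact_def, rule_format, of "p \<circ> k"] p by auto
  then have "l' = l" using l[of "k \<circ> k'" l'] k by (simp add: strict_mono_o comp_assoc)
  moreover have "e \<le> dist l' l"
  proof (rule LIMSEQ_le_const)
    show "(\<lambda>n. dist (((p \<circ> k) \<circ> k') n) l) \<longlonglongrightarrow> dist l' l" by (intro tendsto_intros l')
  qed (use k in auto)
  ultimately show False using \<open>e > 0\<close> by simp
qed

locale near_field =
  fixes X D :: "point set" and lo hi :: real and f :: "point \<Rightarrow> real"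
  assumes X: "compact X" "X \<subseteq> S2"
    and D: "compact D" "0 \<notin> D" "(\<exists>a b. a \<noteq> 0 \<and> D \<subseteq> {x. a \<bullet> x = b}) \<or> countable D"
    and lo: "0 < lo"
    and f: "set_integrable surface X f" "AE x\<in>X in surface. 0 \<le> f x"
begin

definition admissible :: "(point \<Rightarrow> real) \<Rightarrow> bool" where
  "admissible \<rho> \<longleftrightarrow> (\<forall>x\<in>X. \<exists>P\<in>D. \<exists>d\<in>{lo..hi}. supports_at X \<rho> P d x)"

abbreviation multi :: "(point \<Rightarrow> real) \<Rightarrow> point set" where
  "multi \<equiv> reflector_data.multiply_supported X D"

abbreviation sel :: "(point \<Rightarrow> real) \<Rightarrow> point \<Rightarrow> point \<times> real" where
  "sel \<equiv> reflector_data.sel X D lo hi"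

abbreviation target :: "(point \<Rightarrow> real) \<Rightarrow> point \<Rightarrow> point" where
  "target \<rho> x \<equiv> fst (sel \<rho> x)"

definition weight :: "(point \<Rightarrow> real) \<Rightarrow> point \<Rightarrow> real" where
  "weight \<rho> x = illum_weight (fst (sel \<rho> x)) (snd (sel \<rho> x)) x"

definition source :: "point \<Rightarrow> real" where
  "source x = indicat_real X x * f x"

text \<open>The integral of \<phi> against the image of the illumination measure under the target
  map. Working with this functional avoids forming a measure on \<open>D\<close>.\<close>

definition energy :: "(point \<Rightarrow> real) \<Rightarrow> (point \<Rightarrow> real) \<Rightarrow> real" where
  "energy \<rho> \<phi> = (LINT x|surface. \<phi> (target \<rho> x) * (weight \<rho> x * source x))"

lemma admissibleD: "admissible \<rho> \<Longrightarrow> reflector_data X D lo hi \<rho>"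
  using X D lo by unfold_locales (auto simp: admissible_def)

lemma D_nonzero: "P \<in> D \<Longrightarrow> P \<noteq> 0"
  using D by auto

lemma X_norm: "x \<in> X \<Longrightarrow> norm x = 1"
  using X by auto

lemmas sel = reflector_data.sel[OF admissibleD]
  and sel_unique = reflector_data.sel_unique[OF admissibleD]

lemma null_multi: "admissible \<rho> \<Longrightarrow> multi \<rho> \<in> null_sets surface"
  by (intro reflector_data.null_multiply_supported[OF admissibleD] D)

lemma AE_not_multi: "admissible \<rho> \<Longrightarrow> AE x in surface. x \<notin> multi \<rho>"
  by (intro AE_not_in null_multi)

lemma source_integrable[measurable, simp]: "integrable surface source"
  using f(1) by (simp add: set_integrable_def source_def[abs_def])

lemma source_nonneg: "AE x in surface. 0 \<le> source x"
  using f(2) by eventually_elim (auto simp: source_def indicator_def)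

lemma sel_measurable[measurable]: "admissible \<rho> \<Longrightarrow> sel \<rho> \<in> borel_measurable surface"
  by (intro reflector_data.measurable_sel[OF admissibleD] null_multi)

lemma target_measurable[measurable]: "admissible \<rho> \<Longrightarrow> target \<rho> \<in> borel_measurable surface"
  by (rule borel_measurable_continuous_on[OF _ sel_measurable]) (intro continuous_intros)

lemma parameter_measurable[measurable]: "admissible \<rho> \<Longrightarrow> (\<lambda>x. snd (sel \<rho> x)) \<in> borel_measurable surface"
  by (rule borel_measurable_continuous_on[OF _ sel_measurable]) (intro continuous_intros)

lemma weight_measurable[measurable]: "admissible \<rho> \<Longrightarrow> weight \<rho> \<in> borel_measurable surface"
  unfolding weight_def[abs_def] by measurable

lemma weight_pos: "admissible \<rho> \<Longrightarrow> x \<in> X \<Longrightarrow> 0 < weight \<rho> x"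
  unfolding weight_def using sel[of \<rho> x] lo by (intro illum_weight_pos D_nonzero X_norm) auto

lemma weight_le: "admissible \<rho> \<Longrightarrow> x \<in> X \<Longrightarrow> weight \<rho> x \<le> 4 / lo\<^sup>2"
  unfolding weight_def using sel[of \<rho> x] lo by (intro illum_weight_le D_nonzero X_norm) auto

lemma weight_source_bound:
  assumes "admissible \<rho>" shows "\<bar>weight \<rho> x * source x\<bar> \<le> 4 / lo\<^sup>2 * \<bar>source x\<bar>"
proof (cases "x \<in> X")
  case True
  have "\<bar>weight \<rho> x * source x\<bar> = weight \<rho> x * \<bar>source x\<bar>"
    using weight_pos[OF assms True] by (simp add: abs_mult)
  then show ?thesis
    using mult_right_mono[OF weight_le[OF assms True], of "\<bar>source x\<bar>"] by simp
qed (simp add: source_def)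

lemma integrand_bound:
  assumes "admissible \<rho>" "\<And>P. \<bar>\<phi> P\<bar> \<le> B"
  shows "\<bar>\<phi> (target \<rho> x) * (weight \<rho> x * source x)\<bar> \<le> B * (4 / lo\<^sup>2 * \<bar>source x\<bar>)"
  unfolding abs_mult[of "\<phi> (target \<rho> x)"]
  using weight_source_bound[OF assms(1)] assms(2) by (intro mult_mono) (auto intro: order_trans[OF abs_ge_zero])

lemma energy_integrable:
  assumes [measurable]: "admissible \<rho>" "\<phi> \<in> borel_measurable borel" and B: "\<And>P. \<bar>\<phi> P\<bar> \<le> B"
  shows "integrable surface (\<lambda>x. \<phi> (target \<rho> x) * (weight \<rho> x * source x))"
proof (rule Bochner_Integration.integrable_bound)
  show "integrable surface (\<lambda>x. B * (4 / lo\<^sup>2 * \<bar>source x\<bar>))"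
    by (intro integrable_mult_right integrable_abs source_integrable)
  show "AE x in surface. norm (\<phi> (target \<rho> x) * (weight \<rho> x * source x)) \<le> norm (B * (4 / lo\<^sup>2 * \<bar>source x\<bar>))"
    unfolding real_norm_def by (intro AE_I2 order_trans[OF integrand_bound abs_ge_self] assms)
  have [measurable]: "target \<rho> \<in> borel_measurable surface" "weight \<rho> \<in> borel_measurable surface"
    "source \<in> borel_measurable surface"
    by (rule target_measurable weight_measurable borel_measurable_integrable source_integrable assms)+
  show "(\<lambda>x. \<phi> (target \<rho> x) * (weight \<rho> x * source x)) \<in> borel_measurable surface"
    by measurable
qed

lemma energy_mono_AE:
  assumes "admissible \<rho>" "admissible \<rho>'" "\<phi> \<in> borel_measurable borel" "\<phi>' \<in> borel_measurable borel"
    and "\<And>P. \<bar>\<phi> P\<bar> \<le> B" "\<And>P. \<bar>\<phi>' P\<bar> \<le> B"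
    and le: "\<And>x. x \<in> X \<Longrightarrow> x \<notin> multi \<rho> \<Longrightarrow> x \<notin> multi \<rho>' \<Longrightarrow>
        \<phi> (target \<rho> x) * weight \<rho> x \<le> \<phi>' (target \<rho>' x) * weight \<rho>' x"
  shows "energy \<rho> \<phi> \<le> energy \<rho>' \<phi>'"
  unfolding energy_def
proof (rule integral_mono_AE)
  show "AE x in surface. \<phi> (target \<rho> x) * (weight \<rho> x * source x) \<le> \<phi>' (target \<rho>' x) * (weight \<rho>' x * source x)"
    using AE_not_multi[OF assms(1)] AE_not_multi[OF assms(2)] source_nonneg
  proof eventually_elim
    case (elim x)
    show ?case
    proof (cases "x \<in> X")
      case True
      then show ?thesis
        using mult_right_mono[OF le[of x], of "source x"] elim by (simp add: mult.assoc)
    qed (simp add: source_def)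
  qed
qed (rule energy_integrable; fact)+

lemma energy_ge:
  assumes "admissible \<rho>" and c: "\<And>x. x \<in> X \<Longrightarrow> c \<le> weight \<rho> x"
  shows "c * (LINT x:X|surface. f x) \<le> energy \<rho> (\<lambda>_. 1)"
proof -
  have "c * (LINT x:X|surface. f x) = (LINT x|surface. c * source x)"
    by (simp add: set_lebesgue_integral_def source_def)
  also have "\<dots> \<le> energy \<rho> (\<lambda>_. 1)"
    unfolding energy_def
  proof (rule integral_mono_AE)
    show "integrable surface (\<lambda>x. 1 * (weight \<rho> x * source x))"
      using energy_integrable[OF assms(1), of "\<lambda>_. 1" 1] by simp
    show "AE x in surface. c * source x \<le> 1 * (weight \<rho> x * source x)"
      using source_nonneg
    proof eventually_elim
      case (elim x)
      show ?case
      proof (cases "x \<in> X")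
        case True
        then show ?thesis using elim c by (simp add: mult_right_mono)
      qed (simp add: source_def)
    qed
  qed (intro integrable_mult_right source_integrable)
  finally show ?thesis .
qed

text \<open>Every limit point of the selected pairs supports \<rho> at \<open>x\<close>, where the
  pair is unique. The selections for the approximating reflectors may be arbitrary.\<close>

lemma sel_limit:
  assumes r: "\<And>n. admissible (r n)" and \<rho>: "admissible \<rho>"
    and lim: "\<And>y. y \<in> X \<Longrightarrow> (\<lambda>n. r n y) \<longlonglongrightarrow> \<rho> y"
    and x: "x \<in> X" "x \<notin> multi \<rho>"
  shows "(\<lambda>n. sel (r n) x) \<longlonglongrightarrow> sel \<rho> x"
proof (rule LIMSEQ_compact_unique[where K = "D \<times> {lo..hi}"])
  show "compact (D \<times> {lo..hi})" by (intro compact_Times D compact_Icc)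
  show "sel (r n) x \<in> D \<times> {lo..hi}" for n
    using sel(1,2)[OF r x(1)] by (simp add: mem_Times_iff)
  fix k :: "nat \<Rightarrow> nat" and l' assume k: "strict_mono k" "((\<lambda>n. sel (r n) x) \<circ> k) \<longlonglongrightarrow> l'" "l' \<in> D \<times> {lo..hi}"
  obtain P d where l': "l' = (P, d)" by (cases l')
  have "supports_at X \<rho> P d x"
  proof (rule supports_at_limit[OF X(2) x(1)])
    show "(\<lambda>n. fst (sel (r (k n)) x)) \<longlonglongrightarrow> P" "(\<lambda>n. snd (sel (r (k n)) x)) \<longlonglongrightarrow> d"
      using tendsto_fst[OF k(2)] tendsto_snd[OF k(2)] by (simp_all add: l' o_def)
    show "P \<noteq> 0" "0 < d" using k(3) lo D by (auto simp: l')
    show "(\<lambda>n. r (k n) y) \<longlonglongrightarrow> \<rho> y" if "y \<in> X" for y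
      using LIMSEQ_subseq_LIMSEQ[OF lim[OF that] k(1)] by (simp add: o_def)
  qed (rule sel(3)[OF r x(1)])
  then show "l' = sel \<rho> x"
    using sel_unique[OF \<rho> x, of P d] k(3) by (simp add: l')
qed

text \<open>Convergence of \<phi> along the targets is a separate hypothesis, because \<phi> is an
  indicator for finitely many targets and continuous in the general case.\<close>

lemma energy_limit:
  assumes r: "\<And>n. admissible (r n)" and \<rho>: "admissible \<rho>"
    and lim: "\<And>y. y \<in> X \<Longrightarrow> (\<lambda>n. r n y) \<longlonglongrightarrow> \<rho> y"
    and \<phi>: "\<phi> \<in> borel_measurable borel" "\<And>P. \<bar>\<phi> P\<bar> \<le> B"
    and conv: "AE x in surface. x \<in> X \<longrightarrow> (\<lambda>n. \<phi> (target (r n) x)) \<longlonglongrightarrow> \<phi> (target \<rho> x)"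
  shows "(\<lambda>n. energy (r n) \<phi>) \<longlonglongrightarrow> energy \<rho> \<phi>"
  unfolding energy_def
proof (rule integral_dominated_convergence)
  show "integrable surface (\<lambda>x. B * (4 / lo\<^sup>2 * \<bar>source x\<bar>))"
    by (intro integrable_mult_right integrable_abs source_integrable)
  show "AE x in surface. norm (\<phi> (target (r n) x) * (weight (r n) x * source x)) \<le> B * (4 / lo\<^sup>2 * \<bar>source x\<bar>)" for n
    unfolding real_norm_def by (intro AE_I2 integrand_bound r \<phi>)
  show "AE x in surface. (\<lambda>n. \<phi> (target (r n) x) * (weight (r n) x * source x)) \<longlonglongrightarrow> \<phi> (target \<rho> x) * (weight \<rho> x * source x)"
    using AE_not_multi[OF \<rho>] conv
  proof eventually_elim
    case (elim x)
    show ?case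
    proof (cases "x \<in> X")
      case True
      have s: "(\<lambda>n. sel (r n) x) \<longlonglongrightarrow> sel \<rho> x" using sel_limit[OF r \<rho> lim True] elim by blast
      have "(\<lambda>n. weight (r n) x) \<longlonglongrightarrow> weight \<rho> x"
        unfolding weight_def using sel[OF \<rho> True] lo True
        by (intro tendsto_intros s D_nonzero X_norm) auto
      then show ?thesis using elim True by (intro tendsto_intros) auto
    qed (simp add: source_def)
  qed
qed (rule borel_measurable_integrable, rule energy_integrable; fact)+

text \<open>Links the illumination integral of the theorem to \<open>energy\<close>: away from
  multiply supported and boundary points, \<open>tau\<close> and the normal are read off from the
  selected ellipsoid.\<close>

lemma tau_energy:
  assumes \<rho>: "admissible \<rho>" and E: "E \<in> sets borel" "E \<subseteq> D"
    and int: "AE x in surface. x \<in> X \<longrightarrow> x \<in> (top_of_set S2) interior_of X"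
  shows "set_integrable surface (tau X \<rho> E) (illum_density X f \<rho>)"
    "(LINT x:tau X \<rho> E|surface. illum_density X f \<rho> x) = energy \<rho> (indicat_real E)"
proof -
  let ?g = "\<lambda>x. indicat_real E (target \<rho> x) * (weight \<rho> x * source x)"
  let ?h = "\<lambda>x. indicat_real (tau X \<rho> E) x *\<^sub>R illum_density X f \<rho> x"
  have ae: "AE x in surface. ?h x = ?g x"
    using AE_not_multi[OF \<rho>] int
  proof eventually_elim
    case (elim x)
    show ?case
    proof (cases "x \<in> X")
      case True
      then show ?thesis
        using reflector_data.mem_tau_iff[OF admissibleD[OF \<rho>] True _ E(2)]
          reflector_data.illum_density_eq[OF admissibleD[OF \<rho>] True] elim
        by (simp add: indicator_def weight_def source_def)
    next
      case False
      then show ?thesis by (auto simp: tau_def source_def)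
    qed
  qed
  have g: "integrable surface ?g" using E by (intro energy_integrable[OF \<rho>, where B = 1]) auto
  have h: "?h \<in> borel_measurable surface"
    by (rule borel_measurable_surface_cong_AE[OF borel_measurable_integrable[OF g] ae])
  show "set_integrable surface (tau X \<rho> E) (illum_density X f \<rho>)"
    unfolding set_integrable_def
    by (rule integrable_cong_AE[THEN iffD2, OF h borel_measurable_integrable[OF g] ae g])
  show "(LINT x:tau X \<rho> E|surface. illum_density X f \<rho> x) = energy \<rho> (indicat_real E)"
    unfolding set_lebesgue_integral_def energy_def
    by (rule integral_cong_AE[OF h borel_measurable_integrable[OF g] ae])
qed

end

section \<open>Finitely many targets\<close>

definition envelope :: "point set \<Rightarrow> (point \<Rightarrow> real) \<Rightarrow> point \<Rightarrow> real" where
  "envelope F d x = (MIN P\<in>F. polar_radius P (d P) x)"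

lemma envelope_le: "finite F \<Longrightarrow> P \<in> F \<Longrightarrow> envelope F d x \<le> polar_radius P (d P) x"
  unfolding envelope_def by (intro Min_le) auto

lemma envelope_attained:
  assumes "finite F" "F \<noteq> {}" shows "\<exists>P\<in>F. envelope F d x = polar_radius P (d P) x"
proof -
  have "envelope F d x \<in> (\<lambda>P. polar_radius P (d P) x) ` F"
    unfolding envelope_def using assms by (intro Min_in) auto
  then show ?thesis by blast
qed

lemma envelope_mono:
  assumes "finite F" "F \<noteq> {}" "\<And>P. P \<in> F \<Longrightarrow> polar_radius P (d P) x \<le> polar_radius P (e P) x"
  shows "envelope F d x \<le> envelope F e x"
  using envelope_attained[OF assms(1,2), of e x] envelope_le[OF assms(1), of _ d x] assms(3)
  by (metis order_trans)

lemma tendsto_envelope: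
  assumes F: "finite F" "F \<noteq> {}" and "0 \<notin> F" "norm x = 1"
    and "\<And>P. P \<in> F \<Longrightarrow> (\<lambda>n. d n P) \<longlonglongrightarrow> e P" "\<And>P. P \<in> F \<Longrightarrow> 0 < e P"
  shows "(\<lambda>n. envelope F (d n) x) \<longlonglongrightarrow> envelope F e x"
  using F assms(3,5,6)
proof (induction F rule: finite_ne_induct)
  case (singleton P)
  then show ?case unfolding envelope_def using \<open>norm x = 1\<close> by (auto intro!: tendsto_intros)
next
  case (insert P F)
  have *: "envelope (insert P F) d x = min (polar_radius P (d P) x) (envelope F d x)" for d
    unfolding envelope_def using insert.hyps by simp
  show ?case unfolding *
    using insert \<open>norm x = 1\<close> by (intro tendsto_intros) auto
qed

context near_field
begin

lemma energy_nonneg: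
  assumes "admissible \<rho>" "\<phi> \<in> borel_measurable borel" "\<And>P. \<bar>\<phi> P\<bar> \<le> B" "\<And>P. 0 \<le> \<phi> P"
  shows "0 \<le> energy \<rho> \<phi>"
proof -
  have B: "0 \<le> B" using assms(3)[of 0] by linarith
  have "energy \<rho> (\<lambda>_. 0) \<le> energy \<rho> \<phi>"
    using assms(3,4) B less_imp_le[OF weight_pos[OF assms(1)]]
    by (intro energy_mono_AE[OF assms(1,1) _ assms(2), of _ B]) auto
  then show ?thesis by (simp add: energy_def)
qed

text \<open>No bound on \<phi> is imposed: almost everywhere only its finitely many values on
  \<open>F\<close> enter.\<close>

lemma energy_sum:
  assumes \<rho>: "admissible \<rho>" and F: "finite F"
    and T: "\<And>x. x \<in> X \<Longrightarrow> x \<notin> multi \<rho> \<Longrightarrow> target \<rho> x \<in> F"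
  shows "energy \<rho> \<phi> = (\<Sum>P\<in>F. \<phi> P * energy \<rho> (indicat_real {P}))"
proof -
  have I: "integrable surface (\<lambda>x. \<phi> P * (indicat_real {P} (target \<rho> x) * (weight \<rho> x * source x)))" for P
    by (intro integrable_mult_right energy_integrable[OF \<rho>, where B = 1]) auto
  have ae: "AE x in surface. \<phi> (target \<rho> x) * (weight \<rho> x * source x)
      = (\<Sum>P\<in>F. \<phi> P * (indicat_real {P} (target \<rho> x) * (weight \<rho> x * source x)))"
    using AE_not_multi[OF \<rho>]
  proof eventually_elim
    case (elim x)
    show ?case
    proof (cases "x \<in> X")
      case True
      have "(\<Sum>P\<in>F. \<phi> P * (indicat_real {P} (target \<rho> x) * (weight \<rho> x * source x)))
          = (\<Sum>P\<in>F. if P = target \<rho> x then \<phi> P * (weight \<rho> x * source x) else 0)"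
        by (intro sum.cong) auto
      then show ?thesis using T[OF True elim] F by simp
    qed (simp add: source_def)
  qed
  have S: "integrable surface (\<lambda>x. \<Sum>P\<in>F. \<phi> P * (indicat_real {P} (target \<rho> x) * (weight \<rho> x * source x)))"
    by (intro Bochner_Integration.integrable_sum I)
  have "energy \<rho> \<phi> = (LINT x|surface. (\<Sum>P\<in>F. \<phi> P * (indicat_real {P} (target \<rho> x) * (weight \<rho> x * source x))))"
    unfolding energy_def
    using borel_measurable_integrable[OF S] ae
    by (intro integral_cong_AE borel_measurable_surface_cong_AE[OF _ ae]) auto
  also have "\<dots> = (\<Sum>P\<in>F. \<phi> P * energy \<rho> (indicat_real {P}))"
    unfolding energy_def by (subst Bochner_Integration.integral_sum[OF I]) simp
  finally show ?thesis .
qed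

end

locale finite_targets = near_field +
  fixes F :: "point set"
  assumes F: "finite F" "F \<noteq> {}" "F \<subseteq> D"
begin

definition params :: "(point \<Rightarrow> real) \<Rightarrow> bool" where
  "params d \<longleftrightarrow> (\<forall>P\<in>F. d P \<in> {lo..hi})"

definition share :: "(point \<Rightarrow> real) \<Rightarrow> point \<Rightarrow> real" where
  "share d P = energy (envelope F d) (indicat_real {P})"

lemma supports_envelope:
  assumes "params d" "P \<in> F" "envelope F d x = polar_radius P (d P) x"
  shows "supports_at X (envelope F d) P (d P) x"
  using assms envelope_le[OF F(1)] lo by (auto simp: supports_at_def params_def)

lemma admissible_envelope:
  assumes "params d" shows "admissible (envelope F d)"
  unfolding admissible_def
proof
  fix x
  obtain P where "P \<in> F" "envelope F d x = polar_radius P (d P) x"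
    using envelope_attained[OF F(1,2)] by blast
  then show "\<exists>P\<in>D. \<exists>d'\<in>{lo..hi}. supports_at X (envelope F d) P d' x"
    using supports_envelope[OF assms] assms F(3) unfolding params_def by blast
qed

lemma sel_envelope:
  assumes d: "params d" and x: "x \<in> X" "x \<notin> multi (envelope F d)"
    and P: "P \<in> F" "envelope F d x = polar_radius P (d P) x"
  shows "sel (envelope F d) x = (P, d P)"
  by (rule sel_unique[OF admissible_envelope[OF d] x]) (use P F supports_envelope[OF d P] in auto)

lemma sel_envelopeE:
  assumes d: "params d" and x: "x \<in> X" "x \<notin> multi (envelope F d)"
  obtains P where "P \<in> F" "envelope F d x = polar_radius P (d P) x" "sel (envelope F d) x = (P, d P)"
  using envelope_attained[OF F(1,2)] sel_envelope[OF d x] by metis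

lemma target_envelope:
  assumes "params d" "x \<in> X" "x \<notin> multi (envelope F d)"
  shows "target (envelope F d) x \<in> F"
  by (rule sel_envelopeE[OF assms]) simp

lemma share_nonneg: "params d \<Longrightarrow> 0 \<le> share d P"
  unfolding share_def by (intro energy_nonneg[where B = 1] admissible_envelope) auto

lemma share_eq_0:
  assumes d: "params d"
    and T: "\<And>x. x \<in> X \<Longrightarrow> x \<notin> multi (envelope F d) \<Longrightarrow> target (envelope F d) x \<noteq> P"
  shows "share d P = 0"
proof -
  have "share d P \<le> energy (envelope F d) (\<lambda>_. 0)"
    unfolding share_def
    by (rule energy_mono_AE[where B = 1]) (use T in \<open>auto simp: admissible_envelope[OF d]\<close>)
  then show ?thesis using share_nonneg[OF d, of P] by (simp add: energy_def)
qed

text \<open>Raising the other ellipsoids while keeping that of \<open>P\<close> only enlarges the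
  region where \<open>P\<close> attains the minimum, and the weight there is unchanged.\<close>

lemma share_mono:
  assumes d: "params d" and e: "params e" and le: "\<And>Q. Q \<in> F \<Longrightarrow> e Q \<le> d Q" and P: "e P = d P"
  shows "share e P \<le> share d P"
  unfolding share_def
proof (rule energy_mono_AE[where B = 1])
  fix x assume x: "x \<in> X" "x \<notin> multi (envelope F e)" "x \<notin> multi (envelope F d)"
  obtain Q where Q: "Q \<in> F" "envelope F e x = polar_radius Q (e Q) x" "sel (envelope F e) x = (Q, e Q)"
    by (rule sel_envelopeE[OF e x(1,2)])
  have w: "0 < weight (envelope F d) x" by (rule weight_pos[OF admissible_envelope[OF d] x(1)])
  show "indicat_real {P} (target (envelope F e) x) * weight (envelope F e) x
      \<le> indicat_real {P} (target (envelope F d) x) * weight (envelope F d) x"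
  proof (cases "Q = P")
    case True
    have "envelope F e x \<le> envelope F d x"
    proof (rule envelope_mono[OF F(1,2)])
      fix R assume R: "R \<in> F"
      then have "0 < e R" "0 < d R" using d e lo by (force simp: params_def)+
      then show "polar_radius R (e R) x \<le> polar_radius R (d R) x"
        using le[OF R] R F(3) D(2) X_norm[OF x(1)] by (subst polar_radius_le_iff) auto
    qed
    moreover have "envelope F d x \<le> polar_radius P (d P) x"
      using envelope_le[OF F(1)] Q(1) True by blast
    ultimately have "envelope F d x = polar_radius P (d P) x" using Q(2) True P by simp
    then have "sel (envelope F d) x = sel (envelope F e) x"
      using sel_envelope[OF d x(1,3)] Q True P by auto
    then show ?thesis by (simp add: weight_def)
  next
    case False
    then show ?thesis using Q(3) w by (simp add: indicator_def)
  qed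
qed (auto simp: admissible_envelope d e)

text \<open>An indicator is not continuous, but the targets range over a finite set, so convergent
  targets are eventually constant.\<close>

lemma share_limit:
  assumes d: "\<And>n. params (d n)" and e: "params e" and lim: "\<And>Q. Q \<in> F \<Longrightarrow> (\<lambda>n. d n Q) \<longlonglongrightarrow> e Q"
  shows "(\<lambda>n. share (d n) P) \<longlonglongrightarrow> share e P"
  unfolding share_def
proof (rule energy_limit[where B = 1])
  have ep: "0 < e Q" if "Q \<in> F" for Q using e that lo by (force simp: params_def)
  have L: "(\<lambda>n. envelope F (d n) y) \<longlonglongrightarrow> envelope F e y" if "y \<in> X" for y
    using tendsto_envelope[OF F(1,2) _ X_norm[OF that], of d e] lim ep F(3) D(2) by blast
  then show "\<And>y. y \<in> X \<Longrightarrow> (\<lambda>n. envelope F (d n) y) \<longlonglongrightarrow> envelope F e y" .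
  have "AE x in surface. \<forall>n. x \<notin> multi (envelope F (d n))"
    unfolding AE_all_countable using AE_not_multi admissible_envelope d by blast
  then show "AE x in surface. x \<in> X \<longrightarrow> (\<lambda>n. indicat_real {P} (target (envelope F (d n)) x))
      \<longlonglongrightarrow> indicat_real {P} (target (envelope F e) x)"
    using AE_not_multi[OF admissible_envelope[OF e]]
  proof (eventually_elim, intro impI)
    fix x assume x: "\<forall>n. x \<notin> multi (envelope F (d n))" "x \<notin> multi (envelope F e)" "x \<in> X"
    let ?T = "target (envelope F e) x"
    have "(\<lambda>n. target (envelope F (d n)) x) \<longlonglongrightarrow> ?T"
      by (rule tendsto_fst[OF sel_limit[OF admissible_envelope[OF d] admissible_envelope[OF e] L x(3,2)]])
    then have "\<forall>\<^sub>F n in sequentially. target (envelope F (d n)) x \<in> - (F - {?T})"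
      using finite_imp_closed[OF finite_Diff[OF F(1)]] by (intro topological_tendstoD open_Compl) auto
    then have "\<forall>\<^sub>F n in sequentially. indicat_real {P} (target (envelope F (d n)) x) = indicat_real {P} ?T"
    proof eventually_elim
      case (elim n)
      then have "target (envelope F (d n)) x = ?T" using target_envelope[OF d x(3)] x(1) by blast
      then show ?case by simp
    qed
    then show "(\<lambda>n. indicat_real {P} (target (envelope F (d n)) x)) \<longlonglongrightarrow> indicat_real {P} ?T"
      by (rule tendsto_eventually)
  qed
qed (auto simp: admissible_envelope d e)

text \<open>Perron's method: the parameter vectors for which no target other than \<open>P0\<close> receives more than
  its prescribed amount are closed under pointwise minima, and at the least one all the
  prescribed amounts are attained, since lowering one parameter only decreases the other shares.
  No parameter can reach \<open>lo\<close>, because such an ellipsoid would hide the one with focus \<open>P0\<close> and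
  leave nothing to compensate for the mass missing at \<open>P0\<close>.\<close>

theorem discrete_solution:
  assumes P0: "P0 \<in> F" and \<kappa>: "\<kappa> \<in> {lo..hi}"
    and a: "\<And>P. P \<in> F \<Longrightarrow> 0 \<le> a P" "0 < a P0"
    and low: "\<And>Q x. Q \<in> F \<Longrightarrow> x \<in> X \<Longrightarrow> polar_radius Q lo x \<le> polar_radius P0 \<kappa> x"
    and high: "\<And>Q x. Q \<in> F \<Longrightarrow> x \<in> X \<Longrightarrow> polar_radius P0 \<kappa> x < polar_radius Q hi x"
    and total: "\<And>d. params d \<Longrightarrow> d P0 = \<kappa> \<Longrightarrow> sum a F \<le> energy (envelope F d) (\<lambda>_. 1)"
  shows "\<exists>d. params d \<and> d P0 = \<kappa> \<and> (\<forall>P\<in>F - {P0}. share d P = a P)"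
proof -
  define A where "A = {d. params d \<and> d P0 = \<kappa> \<and> (\<forall>P\<in>F - {P0}. share d P \<le> a P)}"
  \<comment> \<open>By \<open>high\<close> all other ellipsoids lie strictly outside that of
    \<open>P0\<close>, so their targets receive nothing.\<close>
  have "(\<lambda>P. if P = P0 then \<kappa> else hi) \<in> A"
  proof -
    let ?d = "\<lambda>P. if P = P0 then \<kappa> else hi"
    have d: "params ?d" using \<kappa> by (auto simp: params_def)
    have "share ?d P = 0" if "P \<in> F - {P0}" for P
    proof (rule share_eq_0[OF d])
      fix x assume x: "x \<in> X" "x \<notin> multi (envelope F ?d)"
      obtain Q where Q: "Q \<in> F" "envelope F ?d x = polar_radius Q (?d Q) x" "sel (envelope F ?d) x = (Q, ?d Q)"
        by (rule sel_envelopeE[OF d x])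
      have "envelope F ?d x \<le> polar_radius P0 \<kappa> x"
        using envelope_le[OF F(1) P0, of ?d x] by simp
      then have "Q \<noteq> P" using that high[OF Q(1) x(1)] Q(2) by auto
      then show "target (envelope F ?d) x \<noteq> P" using Q(3) by simp
    qed
    then show ?thesis using d a by (auto simp: A_def)
  qed
  then have "A \<noteq> {}" by blast
  have strict: "lo < d Q" if d: "d \<in> A" and Q: "Q \<in> F - {P0}" for d Q
  proof (rule ccontr)
    assume "\<not> lo < d Q"
    then have dQ: "d Q = lo" using d Q by (force simp: A_def params_def)
    have pd: "params d" "d P0 = \<kappa>" using d by (auto simp: A_def)
    have "share d P0 = 0"
    proof (rule share_eq_0[OF pd(1)])
      fix x assume x: "x \<in> X" "x \<notin> multi (envelope F d)"
      show "target (envelope F d) x \<noteq> P0"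
      proof
        assume t: "target (envelope F d) x = P0"
        obtain P where P: "envelope F d x = polar_radius P (d P) x" "sel (envelope F d) x = (P, d P)"
          by (rule sel_envelopeE[OF pd(1) x])
        then have "envelope F d x = polar_radius P0 \<kappa> x" using t pd by simp
        \<comment> \<open>The inequality \<open>low\<close> is not strict, so \<open>Q\<close> may
          tie with \<open>P0\<close>; at a singly supported point a tie already makes
          \<open>Q\<close> the target.\<close>
        then have "envelope F d x = polar_radius Q (d Q) x"
          using envelope_le[OF F(1), of Q d x] low[of Q x] Q x(1) dQ by auto
        then have "target (envelope F d) x = Q" using sel_envelope[OF pd(1) x, of Q] Q by simp
        then show False using t Q by simp
      qed
    qed
    have "sum a F \<le> energy (envelope F d) (\<lambda>_. 1)" by (rule total[OF pd])
    also have "\<dots> = (\<Sum>P\<in>F. share d P)"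
      by (subst energy_sum[OF admissible_envelope[OF pd(1)] F(1) target_envelope[OF pd(1)]])
        (auto simp: share_def)
    also have "\<dots> = (\<Sum>P\<in>F - {P0}. share d P)"
      using \<open>share d P0 = 0\<close> F(1) P0 by (simp add: sum.remove)
    also have "\<dots> \<le> (\<Sum>P\<in>F - {P0}. a P)" using d by (intro sum_mono) (auto simp: A_def)
    also have "\<dots> < sum a F" using a(2) F(1) P0 by (simp add: sum.remove)
    finally show False by simp
  qed
  \<comment> \<open>At each \<open>P\<close> the minimum agrees with one of the two vectors and lies
    below that vector elsewhere, so \<open>share_mono\<close> applies.\<close>
  have min_A: "(\<lambda>Q. min (d Q) (e Q)) \<in> A" if d: "d \<in> A" and e: "e \<in> A" for d e
  proof -
    have p: "params d" "params e" "params (\<lambda>Q. min (d Q) (e Q))"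
      using d e by (auto simp: A_def params_def min_def)
    have "share (\<lambda>Q. min (d Q) (e Q)) P \<le> a P" if "P \<in> F - {P0}" for P
    proof (cases "d P \<le> e P")
      case True
      then have "share (\<lambda>Q. min (d Q) (e Q)) P \<le> share d P" by (intro share_mono p) auto
      then show ?thesis using d that by (force simp: A_def)
    next
      case False
      then have "share (\<lambda>Q. min (d Q) (e Q)) P \<le> share e P" by (intro share_mono p) auto
      then show ?thesis using e that by (force simp: A_def)
    qed
    then show ?thesis using p d e by (auto simp: A_def)
  qed
  have Min_A: "(\<lambda>Q. MIN d\<in>S. d Q) \<in> A" if "finite S" "S \<noteq> {}" "S \<subseteq> A" for S
    using that
  proof (induction S rule: finite_ne_induct)
    case (insert d S)
    then have "(\<lambda>Q. MIN d\<in>insert d S. d Q) = (\<lambda>Q. min (d Q) (MIN d\<in>S. d Q))" by (auto simp: fun_eq_iff)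
    then show ?case using min_A insert by simp
  qed simp
  define e where "e Q = (INF d\<in>A. d Q)" for Q
  have bdd: "bdd_below ((\<lambda>d. d Q) ` A)" if "Q \<in> F" for Q
    using that by (intro bdd_belowI2[where m = lo]) (auto simp: A_def params_def)
  have e_le: "e Q \<le> d Q" if "d \<in> A" "Q \<in> F" for d Q
    unfolding e_def using bdd that by (intro cINF_lower) auto
  have "\<exists>d\<in>A. Q \<in> F \<longrightarrow> d Q < e Q + inverse (real (Suc n))" for Q n
  proof (cases "Q \<in> F")
    case True
    then show ?thesis
      using \<open>A \<noteq> {}\<close> bdd[OF True] cInf_less_iff[of "(\<lambda>d. d Q) ` A" "e Q + inverse (real (Suc n))"]
      by (simp add: e_def)
  qed (use \<open>A \<noteq> {}\<close> in blast)
  note approx = this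
  \<comment> \<open>One vector of \<open>A\<close> per coordinate, nearly optimal in that
    coordinate; their minimum over \<open>F\<close> is then nearly optimal in all coordinates at
    once.\<close>
  define c where "c n Q = (SOME d. d \<in> A \<and> (Q \<in> F \<longrightarrow> d Q < e Q + inverse (real (Suc n))))" for n Q
  have c_props: "c n Q \<in> A \<and> (Q \<in> F \<longrightarrow> c n Q Q < e Q + inverse (real (Suc n)))" for n Q
  proof -
    have "\<exists>d. d \<in> A \<and> (Q \<in> F \<longrightarrow> d Q < e Q + inverse (real (Suc n)))"
      using approx[of Q n] by blast
    from someI_ex[OF this] show ?thesis unfolding c_def .
  qed
  then have c: "c n Q \<in> A" "Q \<in> F \<Longrightarrow> c n Q Q < e Q + inverse (real (Suc n))" for Q n
    by blast+
  define d where "d n = (\<lambda>Q. MIN d\<in>c n ` F. d Q)" for n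
  have dA: "d n \<in> A" for n unfolding d_def using F c by (intro Min_A) auto
  then have pd: "params (d n)" "d n P0 = \<kappa>" for n by (auto simp: A_def)
  have d_lim: "(\<lambda>n. d n Q) \<longlonglongrightarrow> e Q" if Q: "Q \<in> F" for Q
  proof (rule tendsto_sandwich)
    show "\<forall>\<^sub>F n in sequentially. e Q \<le> d n Q" using e_le[OF dA Q] by simp
    have "d n Q \<le> c n Q Q" for n
      unfolding d_def using F Q by (intro Min_le) auto
    then show "\<forall>\<^sub>F n in sequentially. d n Q \<le> e Q + inverse (real (Suc n))"
      using c(2)[OF Q] by (intro always_eventually allI) (meson less_imp_le order_trans)
    show "(\<lambda>n. e Q + inverse (real (Suc n))) \<longlonglongrightarrow> e Q"
      using tendsto_add[OF tendsto_const LIMSEQ_inverse_real_of_nat, of "e Q"] by simp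
  qed simp
  have pe: "params e"
    unfolding params_def
  proof
    fix Q assume Q: "Q \<in> F"
    have "\<And>n. d n Q \<in> {lo..hi}" using pd(1) Q by (auto simp: params_def)
    then show "e Q \<in> {lo..hi}"
      using closed_sequentially[of "{lo..hi}" "\<lambda>n. d n Q"] d_lim[OF Q] by blast
  qed
  have e0: "e P0 = \<kappa>"
    using d_lim[OF P0] LIMSEQ_unique[of "\<lambda>n. d n P0" \<kappa> "e P0"] pd(2) by simp
  have eA: "e \<in> A"
    unfolding A_def
  proof (intro CollectI conjI ballI pe e0)
    fix P assume "P \<in> F - {P0}"
    then have "share (d n) P \<le> a P" for n using dA[of n] by (simp add: A_def)
    then show "share e P \<le> a P"
      by (intro LIMSEQ_le_const2[OF share_limit[OF pd(1) pe d_lim]]) auto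
  qed
  have "share e Q = a Q" if Q: "Q \<in> F - {P0}" for Q
  proof (rule ccontr)
    assume "share e Q \<noteq> a Q"
    then have less: "share e Q < a Q" using eA Q by (force simp: A_def)
    \<comment> \<open>Lowers only the coordinate \<open>Q\<close>, clipped at \<open>lo\<close> to
      stay a legal parameter. Since \<open>e Q\<close> exceeds \<open>lo\<close>, this is a genuine
      decrease and contradicts minimality.\<close>
    define h where "h n = e(Q := max lo (e Q - inverse (real (Suc n))))" for n
    have ph: "params (h n)" for n
      unfolding params_def
    proof
      fix P assume P: "P \<in> F"
      have le: "lo \<le> e P" "e P \<le> hi" using pe P by (auto simp: params_def)
      moreover have "0 < inverse (real (Suc n))" by simp
      ultimately have "e P - inverse (real (Suc n)) \<le> hi" by linarith
      with le show "h n P \<in> {lo..hi}" by (auto simp: h_def simp del: of_nat_Suc)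
    qed
    have h_lim: "(\<lambda>n. h n P) \<longlonglongrightarrow> e P" if "P \<in> F" for P
    proof (cases "P = Q")
      case True
      have "(\<lambda>n. max lo (e Q - inverse (real (Suc n)))) \<longlonglongrightarrow> max lo (e Q - 0)"
        by (intro tendsto_intros LIMSEQ_inverse_real_of_nat)
      then show ?thesis using True strict[OF eA Q] by (simp add: h_def)
    qed (simp add: h_def)
    have "\<forall>\<^sub>F n in sequentially. share (h n) Q < a Q"
      by (rule order_tendstoD(2)[OF share_limit[OF ph pe h_lim] less])
    then obtain n where n: "share (h n) Q < a Q" using eventually_happens sequentially_bot by blast
    have hle: "h n P \<le> e P" for P
      using strict[OF eA Q] by (simp add: h_def)
    have "h n \<in> A"
      unfolding A_def
    proof (intro CollectI conjI ballI ph)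
      show "h n P0 = \<kappa>" using e0 Q by (auto simp: h_def)
      fix P assume P: "P \<in> F - {P0}"
      show "share (h n) P \<le> a P"
      proof (cases "P = Q")
        case False
        then have "share (h n) P \<le> share e P"
          by (intro share_mono pe ph hle) (simp add: h_def)
        then show ?thesis using eA P by (force simp: A_def)
      qed (use n in simp)
    qed
    then have "e Q \<le> h n Q" using e_le Q by blast
    moreover have "0 < inverse (real (Suc n))" by simp
    then have "h n Q < e Q" using strict[OF eA Q] by (simp add: h_def del: of_nat_Suc)
    ultimately show False by simp
  qed
  then show ?thesis using pe e0 by blast
qed

end

section \<open>General measures\<close>

text \<open>Each point goes to a net point within \<open>e\<close>. \<open>P0\<close> takes
  precedence on its entire ball, so its cell has positive mass when \<open>P0\<close> is in the
  support.\<close>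

lemma finite_net_map:
  fixes D :: "'a::euclidean_space set"
  assumes D: "compact D" "P0 \<in> D" and e: "0 < e"
  obtains F \<pi> where "finite F" "F \<subseteq> D" "P0 \<in> F" "\<pi> \<in> borel_measurable borel"
    "\<And>P. P \<in> D \<Longrightarrow> \<pi> P \<in> F \<and> dist (\<pi> P) P < e" "\<And>P. dist P0 P < e \<Longrightarrow> \<pi> P = P0"
proof -
  have ind: "\<exists>\<pi>::'a \<Rightarrow> 'a. \<pi> \<in> borel_measurable borel \<and> (\<forall>P. (\<exists>Q\<in>G. dist Q P < e) \<longrightarrow> \<pi> P \<in> G \<and> dist (\<pi> P) P < e)"
    if "finite G" for G :: "'a set"
    using that
  proof (induction G)
    case (insert Q G)
    then obtain \<pi> :: "'a \<Rightarrow> 'a" where [measurable]: "\<pi> \<in> borel_measurable borel"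
      and \<pi>: "\<And>P. (\<exists>Q\<in>G. dist Q P < e) \<Longrightarrow> \<pi> P \<in> G \<and> dist (\<pi> P) P < e" by blast
    have "(\<lambda>P. if dist Q P < e then Q else \<pi> P) \<in> borel_measurable borel" by measurable
    then show ?case using \<pi> by (intro exI[of _ "\<lambda>P. if dist Q P < e then Q else \<pi> P"]) auto
  qed (auto intro: exI[of _ "\<lambda>_. 0"])
  obtain G where G: "G \<subseteq> D" "finite G" "D \<subseteq> (\<Union>x\<in>G. ball x e)"
    using compactE_image[OF D(1), of D "\<lambda>x. ball x e"] e by force
  obtain \<pi> :: "'a \<Rightarrow> 'a" where \<pi>[measurable]: "\<pi> \<in> borel_measurable borel"
    and \<pi>2: "\<And>P. (\<exists>Q\<in>G. dist Q P < e) \<Longrightarrow> \<pi> P \<in> G \<and> dist (\<pi> P) P < e" using ind[OF G(2)] by blast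
  show thesis
  proof (rule that[of "insert P0 G" "\<lambda>P. if dist P0 P < e then P0 else \<pi> P"])
    show "(\<lambda>P. if dist P0 P < e then P0 else \<pi> P) \<in> borel_measurable borel" by measurable
    fix P assume "P \<in> D"
    then have "\<exists>Q\<in>G. dist Q P < e" using G(3) by (auto simp: subset_iff)
    then show "(if dist P0 P < e then P0 else \<pi> P) \<in> insert P0 G \<and> dist (if dist P0 P < e then P0 else \<pi> P) P < e"
      using \<pi>2 by auto
  qed (use G D in auto)
qed

context near_field
begin

section \<open>Dependence of the energy on the test function\<close>

lemma energy_limit_fun:
  assumes \<rho>: "admissible \<rho>" and \<phi>: "\<And>n. \<phi> n \<in> borel_measurable borel" "\<psi> \<in> borel_measurable borel"
    and B: "\<And>n P. \<bar>\<phi> n P\<bar> \<le> B" and lim: "\<And>P. (\<lambda>n. \<phi> n P) \<longlonglongrightarrow> \<psi> P"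
  shows "(\<lambda>n. energy \<rho> (\<phi> n)) \<longlonglongrightarrow> energy \<rho> \<psi>"
proof -
  have B': "\<bar>\<psi> P\<bar> \<le> B" for P
    by (rule LIMSEQ_le_const2[OF tendsto_rabs[OF lim]]) (use B in auto)
  show ?thesis
    unfolding energy_def
  proof (rule integral_dominated_convergence)
    show "integrable surface (\<lambda>x. B * (4 / lo\<^sup>2 * \<bar>source x\<bar>))"
      by (intro integrable_mult_right integrable_abs source_integrable)
    show "AE x in surface. norm (\<phi> n (target \<rho> x) * (weight \<rho> x * source x)) \<le> B * (4 / lo\<^sup>2 * \<bar>source x\<bar>)" for n
      unfolding real_norm_def by (intro AE_I2 integrand_bound \<rho> B)
    show "AE x in surface. (\<lambda>n. \<phi> n (target \<rho> x) * (weight \<rho> x * source x)) \<longlonglongrightarrow> \<psi> (target \<rho> x) * (weight \<rho> x * source x)"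
      by (intro AE_I2 tendsto_mult lim tendsto_const)
    show "(\<lambda>x. \<phi> n (target \<rho> x) * (weight \<rho> x * source x)) \<in> borel_measurable surface" for n
      by (rule borel_measurable_integrable, rule energy_integrable; fact)
    show "(\<lambda>x. \<psi> (target \<rho> x) * (weight \<rho> x * source x)) \<in> borel_measurable surface"
      by (rule borel_measurable_integrable, rule energy_integrable; fact)
  qed
qed

lemma energy_add:
  assumes \<rho>: "admissible \<rho>" and m: "\<phi> \<in> borel_measurable borel" "\<psi> \<in> borel_measurable borel"
    and b: "\<And>P. \<bar>\<phi> P\<bar> \<le> B" "\<And>P. \<bar>\<psi> P\<bar> \<le> B'"
  shows "energy \<rho> (\<lambda>P. \<phi> P + \<psi> P) = energy \<rho> \<phi> + energy \<rho> \<psi>"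
  unfolding energy_def
  using Bochner_Integration.integral_add[OF energy_integrable[OF \<rho> m(1) b(1)] energy_integrable[OF \<rho> m(2) b(2)]]
  by (simp add: distrib_right)

lemma energy_indicator_UN_sums:
  fixes A :: "nat \<Rightarrow> point set"
  assumes \<rho>: "admissible \<rho>" and A: "\<And>i. A i \<in> sets borel" "disjoint_family A"
  shows "(\<lambda>i. energy \<rho> (indicat_real (A i))) sums energy \<rho> (indicat_real (\<Union>i. A i))"
proof -
  have sums: "(\<lambda>i. indicat_real (A i) P) sums indicat_real (\<Union>i. A i) P" for P
    by (rule indicator_sums) (use A in \<open>auto simp: disjoint_family_on_def\<close>)
  have B: "\<bar>\<Sum>i<n. indicat_real (A i) P\<bar> \<le> 1" for n P
  proof -
    have "(\<Sum>i<n. indicat_real (A i) P) \<le> (\<Sum>i. indicat_real (A i) P)"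
      using sums by (intro sum_le_suminf) (auto simp: sums_iff)
    also have "\<dots> \<le> 1" using sums[of P] by (simp add: sums_iff indicator_def)
    finally show ?thesis by (simp add: sum_nonneg)
  qed
  have fin: "energy \<rho> (\<lambda>P. \<Sum>i<n. indicat_real (A i) P) = (\<Sum>i<n. energy \<rho> (indicat_real (A i)))" for n
  proof (induction n)
    case (Suc n)
    have "energy \<rho> (\<lambda>P. (\<Sum>i<n. indicat_real (A i) P) + indicat_real (A n) P)
        = energy \<rho> (\<lambda>P. \<Sum>i<n. indicat_real (A i) P) + energy \<rho> (indicat_real (A n))"
      by (rule energy_add[OF \<rho>, where B = 1 and B' = 1]) (use A B in auto)
    then show ?case using Suc by simp
  qed (simp add: energy_def)
  have "(\<lambda>n. energy \<rho> (\<lambda>P. \<Sum>i<n. indicat_real (A i) P)) \<longlonglongrightarrow> energy \<rho> (indicat_real (\<Union>i. A i))"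
    by (rule energy_limit_fun[OF \<rho>, where B = 1]) (use A B sums in \<open>auto simp: sums_def\<close>)
  then show ?thesis unfolding sums_def fin .
qed

section \<open>Compactness of the admissible reflectors\<close>

lemma admissible_limit:
  assumes r: "\<And>n. admissible (r n)" and lim: "\<And>y. y \<in> X \<Longrightarrow> (\<lambda>n. r n y) \<longlonglongrightarrow> \<rho> y"
  shows "admissible \<rho>"
  unfolding admissible_def
proof
  fix x assume x: "x \<in> X"
  have "compact (D \<times> {lo..hi})" by (intro compact_Times D compact_Icc)
  moreover have "sel (r n) x \<in> D \<times> {lo..hi}" for n
    using sel(1,2)[OF r x] by (simp add: mem_Times_iff)
  ultimately obtain l k where k: "l \<in> D \<times> {lo..hi}" "strict_mono k" "((\<lambda>n. sel (r n) x) \<circ> k) \<longlonglongrightarrow> l"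
    unfolding compact_def by metis
  obtain P d where l: "l = (P, d)" by (cases l)
  have "supports_at X \<rho> P d x"
  proof (rule supports_at_limit[OF X(2) x])
    show "(\<lambda>n. fst (sel (r (k n)) x)) \<longlonglongrightarrow> P" "(\<lambda>n. snd (sel (r (k n)) x)) \<longlonglongrightarrow> d"
      using tendsto_fst[OF k(3)] tendsto_snd[OF k(3)] by (simp_all add: l o_def)
    show "P \<noteq> 0" "0 < d" using k(1) lo D by (auto simp: l)
    show "(\<lambda>n. r (k n) y) \<longlonglongrightarrow> \<rho> y" if "y \<in> X" for y
      using LIMSEQ_subseq_LIMSEQ[OF lim[OF that] k(2)] by (simp add: o_def)
  qed (rule sel(3)[OF r x])
  then show "\<exists>P\<in>D. \<exists>d\<in>{lo..hi}. supports_at X \<rho> P d x" using k(1) unfolding l by blast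
qed

text \<open>Reciprocals are used because their Lipschitz constant is uniform. The common upper bound
  \<open>R\<close> keeps their limit positive, so that it can be inverted.\<close>

lemma admissible_compact:
  fixes r :: "nat \<Rightarrow> point \<Rightarrow> real"
  assumes r: "\<And>n. admissible (r n)"
    and ub: "\<And>n x. x \<in> X \<Longrightarrow> r n x \<le> R"
  obtains k \<rho> where "strict_mono k" "admissible \<rho>" "\<And>x. x \<in> X \<Longrightarrow> (\<lambda>n. r (k n) x) \<longlonglongrightarrow> \<rho> x"
proof -
  have pos: "0 < r n x" if "x \<in> X" for n x
    by (rule reflector_data.rho_pos[OF admissibleD[OF r] that])
  have bound: "norm (inverse (r n x)) \<le> 2 / lo" if x: "x \<in> X" for n x
  proof -
    note s = sel[OF r x]
    have "lo / 2 \<le> snd (sel (r n) x) / 2" using s(2)[of n] by simp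
    also have "\<dots> \<le> r n x"
      unfolding supports_atD(3)[OF s(3)[of n]]
      using s(1,2)[of n] lo x by (intro polar_radius_ge_half D_nonzero X_norm) auto
    finally have "inverse (r n x) \<le> inverse (lo / 2)" using lo by (intro le_imp_inverse_le) auto
    then show ?thesis using pos[OF x, of n] by simp
  qed
  have equi: "\<exists>d>0. \<forall>n y. y \<in> X \<and> norm (x - y) < d \<longrightarrow> norm (inverse (r n x) - inverse (r n y)) < e"
    if "x \<in> X" "0 < e" for x e
  proof (intro exI[of _ "e * lo"] conjI allI impI)
    fix n y assume y: "y \<in> X \<and> norm (x - y) < e * lo"
    have "norm (inverse (r n x) - inverse (r n y)) \<le> norm (x - y) / lo"
      using reflector_data.inverse_rho_lipschitz[OF admissibleD[OF r] that(1)] y by simp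
    also have "\<dots> < e" using y lo by (simp add: field_simps)
    finally show "norm (inverse (r n x) - inverse (r n y)) < e" .
  qed (use that lo in auto)
  obtain g and k :: "nat \<Rightarrow> nat" where "continuous_on X g" "strict_mono k"
    and g: "\<And>e. 0 < e \<Longrightarrow> \<exists>N. \<forall>n x. n \<ge> N \<and> x \<in> X \<longrightarrow> norm (inverse (r (k n) x) - g x) < e"
    by (rule Arzela_Ascoli[of X "\<lambda>n x. inverse (r n x)", OF X(1) bound equi]) (assumption | rule that)+
  have lim: "(\<lambda>n. inverse (r (k n) x)) \<longlonglongrightarrow> g x" if "x \<in> X" for x
    using g that unfolding LIMSEQ_iff by blast
  have lim': "(\<lambda>n. r (k n) x) \<longlonglongrightarrow> inverse (g x)" if "x \<in> X" for x
  proof -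
    have "inverse R \<le> g x"
      using ub[OF that] pos[OF that] by (intro LIMSEQ_le_const[OF lim[OF that]]) (auto intro!: le_imp_inverse_le)
    moreover have "0 < R" using ub[OF that, of 0] pos[OF that, of 0] by simp
    ultimately have "g x \<noteq> 0" by (metis inverse_positive_iff_positive not_le order_less_irrefl)
    from tendsto_inverse[OF lim[OF that] this] show ?thesis by simp
  qed
  have "admissible (\<lambda>x. inverse (g x))"
    by (rule admissible_limit[OF _ lim']) (rule r)
  then show thesis using that \<open>strict_mono k\<close> lim' by blast
qed

end

section \<open>From finitely supported to general target measures\<close>

locale near_field_measure = near_field + finite_measure \<eta> for \<eta> :: "point measure" +
  fixes P0 :: point and \<kappa> :: real
  assumes sets_\<eta>: "sets \<eta> = sets (restrict_space borel D)"
    and P0: "P0 \<in> measure_support D \<eta>"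
    and \<kappa>: "\<kappa> \<in> {lo..hi}"
    and low: "\<And>Q x. Q \<in> D \<Longrightarrow> x \<in> X \<Longrightarrow> polar_radius Q lo x \<le> polar_radius P0 \<kappa> x"
    and high: "\<And>Q x. Q \<in> D \<Longrightarrow> x \<in> X \<Longrightarrow> polar_radius P0 \<kappa> x < polar_radius Q hi x"
    and total: "\<And>\<rho>. admissible \<rho> \<Longrightarrow> (\<And>x. x \<in> X \<Longrightarrow> \<rho> x \<le> polar_radius P0 \<kappa> x) \<Longrightarrow>
        measure \<eta> D \<le> energy \<rho> (\<lambda>_. 1)"
begin

lemma P0_D: "P0 \<in> D"
  using P0 by (simp add: measure_support_def)

lemma space_\<eta>: "space \<eta> = D"
  using sets_eq_imp_space_eq[OF sets_\<eta>] by (simp add: space_restrict_space)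

lemma measurable_\<eta>: "\<phi> \<in> borel_measurable borel \<Longrightarrow> \<phi> \<in> borel_measurable \<eta>"
  using measurable_restrict_space1[of \<phi> borel borel D] measurable_cong_sets[OF sets_\<eta> refl] by blast

lemma sets_\<eta>_Int: "E \<in> sets borel \<Longrightarrow> E \<inter> D \<in> sets \<eta>"
  unfolding sets_\<eta> using D(1) by (subst sets_restrict_space_iff) (auto simp: borel_compact)

lemma integrable_\<eta>:
  fixes \<phi> :: "point \<Rightarrow> real"
  shows "\<phi> \<in> borel_measurable borel \<Longrightarrow> (\<And>P. \<bar>\<phi> P\<bar> \<le> B) \<Longrightarrow> integrable \<eta> \<phi>"
  by (rule integrable_const_bound[where B = B]) (auto intro: measurable_\<eta>)

text \<open>The transported measure is the image of \<eta> under \<pi> plus a point mass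
  \<open>c\<close> at \<open>P0\<close>.\<close>

definition solves :: "(point \<Rightarrow> real) \<Rightarrow> (point \<Rightarrow> point) \<Rightarrow> real \<Rightarrow> bool" where
  "solves \<rho> \<pi> c \<longleftrightarrow> (\<forall>\<phi>. \<phi> \<in> borel_measurable borel \<longrightarrow>
     energy \<rho> \<phi> = (LINT P|\<eta>. \<phi> (\<pi> P)) + c * \<phi> P0)"

lemma approximate_solution:
  assumes e: "0 < e"
  obtains \<rho> \<pi> c where "admissible \<rho>" "\<And>x. x \<in> X \<Longrightarrow> \<rho> x \<le> polar_radius P0 \<kappa> x"
    "\<pi> \<in> borel_measurable borel" "\<And>P. P \<in> D \<Longrightarrow> dist (\<pi> P) P < e" "0 \<le> c" "solves \<rho> \<pi> c"
proof -
  obtain F \<pi> where net: "finite F" "F \<subseteq> D" "P0 \<in> F" and \<pi>[measurable]: "\<pi> \<in> borel_measurable borel"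
    and \<pi>F: "\<And>P. P \<in> D \<Longrightarrow> \<pi> P \<in> F \<and> dist (\<pi> P) P < e" and \<pi>0: "\<And>P. dist P0 P < e \<Longrightarrow> \<pi> P = P0"
    using finite_net_map[OF D(1) P0_D e] by metis
  interpret finite_targets X D lo hi f F
    by unfold_locales (use net in auto)
  define a where "a P = measure \<eta> (\<pi> -` {P} \<inter> D)" for P
  have set: "\<pi> -` {P} \<inter> D \<in> sets \<eta>" for P
    using measurable_sets[OF \<pi>, of "{P}"] by (intro sets_\<eta>_Int) simp
  have int_\<pi>: "(LINT P|\<eta>. \<phi> (\<pi> P)) = (\<Sum>P\<in>F. \<phi> P * a P)" for \<phi> :: "point \<Rightarrow> real"
  proof -
    have "(LINT P|\<eta>. \<phi> (\<pi> P)) = (LINT Q|\<eta>. (\<Sum>P\<in>F. \<phi> P * indicat_real (\<pi> -` {P} \<inter> D) Q))"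
    proof (rule Bochner_Integration.integral_cong[OF refl])
      fix Q assume "Q \<in> space \<eta>"
      then have Q: "Q \<in> D" by (simp add: space_\<eta>)
      have "(\<Sum>P\<in>F. \<phi> P * indicat_real (\<pi> -` {P} \<inter> D) Q) = (\<Sum>P\<in>F. if P = \<pi> Q then \<phi> P else 0)"
        using Q by (intro sum.cong) auto
      then show "\<phi> (\<pi> Q) = (\<Sum>P\<in>F. \<phi> P * indicat_real (\<pi> -` {P} \<inter> D) Q)"
        using \<pi>F[OF Q] net(1) by simp
    qed
    also have "\<dots> = (\<Sum>P\<in>F. LINT Q|\<eta>. \<phi> P * indicat_real (\<pi> -` {P} \<inter> D) Q)"
      using set by (intro Bochner_Integration.integral_sum integrable_mult_right integrable_real_indicator)
        (auto simp: emeasure_eq_measure)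
    also have "\<dots> = (\<Sum>P\<in>F. \<phi> P * a P)"
      by (simp add: a_def space_\<eta> Int_absorb2)
    finally show ?thesis .
  qed
  have sum_a: "sum a F = measure \<eta> D"
    using int_\<pi>[of "\<lambda>_. 1"] by (simp add: space_\<eta>)
  have a0: "0 < a P0"
  proof -
    have "0 < emeasure \<eta> (ball P0 e \<inter> D)"
      using P0 e by (auto simp: measure_support_def)
    also have "\<dots> \<le> emeasure \<eta> (\<pi> -` {P0} \<inter> D)"
      using \<pi>0 set by (intro emeasure_mono) auto
    finally show ?thesis by (simp add: a_def emeasure_eq_measure)
  qed
  have env: "envelope F d x \<le> polar_radius P0 \<kappa> x" if "d P0 = \<kappa>" for d x
    using envelope_le[OF net(1,3), of d x] that by simp
  have "\<exists>d. params d \<and> d P0 = \<kappa> \<and> (\<forall>P\<in>F - {P0}. share d P = a P)"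
  proof (rule discrete_solution[where a = a, OF net(3) \<kappa>])
    show "sum a F \<le> energy (envelope F d) (\<lambda>_. 1)" if "params d" "d P0 = \<kappa>" for d
      unfolding sum_a by (rule total[OF admissible_envelope[OF that(1)] env[of d, OF that(2)]])
    show "0 < a P0" by (rule a0)
    show "0 \<le> a P" for P by (simp add: a_def)
  qed (use net(2) low high in blast)+
  then obtain d where d: "params d" "d P0 = \<kappa>" "\<And>P. P \<in> F - {P0} \<Longrightarrow> share d P = a P" by blast
  let ?\<rho> = "envelope F d"
  have adm: "admissible ?\<rho>" by (rule admissible_envelope[OF d(1)])
  have en: "energy ?\<rho> \<phi> = (LINT P|\<eta>. \<phi> (\<pi> P)) + (share d P0 - a P0) * \<phi> P0" for \<phi>
  proof -
    have "energy ?\<rho> \<phi> = (\<Sum>P\<in>F. \<phi> P * share d P)"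
      unfolding share_def by (rule energy_sum[OF adm net(1) target_envelope[OF d(1)]])
    also have "\<dots> = (\<Sum>P\<in>F. \<phi> P * a P) + (share d P0 - a P0) * \<phi> P0"
      using d(3) net(1,3) by (simp add: sum.remove[of F P0] algebra_simps)
    finally show ?thesis by (simp add: int_\<pi>)
  qed
  \<comment> \<open>Comparing total masses, that is, testing with the constant 1, shows that the
    surplus at \<open>P0\<close> is nonnegative.\<close>
  have "measure \<eta> D \<le> energy ?\<rho> (\<lambda>_. 1)"
    by (rule total[OF adm env[of d, OF d(2)]])
  then have "0 \<le> share d P0 - a P0"
    using en[of "\<lambda>_. 1"] by (simp add: space_\<eta>)
  moreover have "solves ?\<rho> \<pi> (share d P0 - a P0)"
    unfolding solves_def using en by blast
  ultimately show thesis
    using that[OF adm env[of d, OF d(2)] \<pi>] \<pi>F by blast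
qed

lemma limit_solution:
  obtains \<rho> c where "admissible \<rho>" "\<And>x. x \<in> X \<Longrightarrow> \<rho> x \<le> polar_radius P0 \<kappa> x" "0 \<le> c"
    "\<And>\<phi> B. continuous_on UNIV \<phi> \<Longrightarrow> (\<And>P. \<bar>\<phi> P\<bar> \<le> B) \<Longrightarrow> energy \<rho> \<phi> = (LINT P|\<eta>. \<phi> P) + c * \<phi> P0"
proof -
  define good where "good n = (\<lambda>(\<rho>, \<pi>, c). admissible \<rho> \<and> (\<forall>x\<in>X. \<rho> x \<le> polar_radius P0 \<kappa> x) \<and>
      \<pi> \<in> borel_measurable borel \<and> (\<forall>P\<in>D. dist (\<pi> P) P < inverse (real (Suc n))) \<and> 0 \<le> c \<and> solves \<rho> \<pi> c)" for n
  have "\<exists>w. good n w" for n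
  proof -
    have "0 < inverse (real (Suc n))" by simp
    then show ?thesis
    proof (rule approximate_solution)
      fix \<rho> \<pi> c
      assume "admissible \<rho>" "\<And>x. x \<in> X \<Longrightarrow> \<rho> x \<le> polar_radius P0 \<kappa> x" "\<pi> \<in> borel_measurable borel"
        "\<And>P. P \<in> D \<Longrightarrow> dist (\<pi> P) P < inverse (real (Suc n))" "0 \<le> c" "solves \<rho> \<pi> c"
      then have "good n (\<rho>, \<pi>, c)" unfolding good_def by blast
      then show ?thesis by blast
    qed
  qed
  then obtain w where w: "\<And>n. good n (w n)" by metis
  define r p b where "r n = fst (w n)" and "p n = fst (snd (w n))" and "b n = snd (snd (w n))" for n
  have good: "good n (r n, p n, b n)" for n using w by (simp add: r_def p_def b_def)
  have r: "admissible (r n)" and ub: "x \<in> X \<Longrightarrow> r n x \<le> polar_radius P0 \<kappa> x"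
    and p[measurable]: "p n \<in> borel_measurable borel"
    and near: "P \<in> D \<Longrightarrow> dist (p n P) P < inverse (real (Suc n))"
    and b: "0 \<le> b n" and sol: "solves (r n) (p n) (b n)" for n x P
    using good[of n] unfolding good_def by blast+
  have "continuous_on X (\<lambda>x. polar_radius P0 \<kappa> x)"
    using P0_D D_nonzero \<kappa> lo X_norm by (intro continuous_intros) auto
  then have "bounded ((\<lambda>x. polar_radius P0 \<kappa> x) ` X)"
    by (intro compact_imp_bounded compact_continuous_image X)
  then obtain U where "\<And>x. x \<in> X \<Longrightarrow> \<bar>polar_radius P0 \<kappa> x\<bar> \<le> U"
    unfolding bounded_iff by auto
  then have rU: "r n x \<le> U" if "x \<in> X" for n x
    using ub[OF that, of n] that abs_ge_self order_trans by meson
  obtain k \<rho> where k: "strict_mono k" and \<rho>: "admissible \<rho>" and lim: "\<And>x. x \<in> X \<Longrightarrow> (\<lambda>n. r (k n) x) \<longlonglongrightarrow> \<rho> x"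
    by (rule admissible_compact[of r U, OF r rU]) (assumption | rule that)+
  have en_lim: "(\<lambda>n. energy (r (k n)) \<phi>) \<longlonglongrightarrow> energy \<rho> \<phi>" if \<phi>: "continuous_on UNIV \<phi>" "\<And>P. \<bar>\<phi> P\<bar> \<le> B" for \<phi> B
  proof (rule energy_limit[OF r \<rho> lim])
    show "\<phi> \<in> borel_measurable borel" using \<phi> by (intro borel_measurable_continuous_onI)
    show "AE x in surface. x \<in> X \<longrightarrow> (\<lambda>n. \<phi> (target (r (k n)) x)) \<longlonglongrightarrow> \<phi> (target \<rho> x)"
      using AE_not_multi[OF \<rho>]
    proof (eventually_elim, intro impI)
      fix x assume "x \<notin> multi \<rho>" "x \<in> X"
      then have "(\<lambda>n. target (r (k n)) x) \<longlonglongrightarrow> target \<rho> x"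
        by (intro tendsto_fst sel_limit[OF r \<rho> lim])
      then show "(\<lambda>n. \<phi> (target (r (k n)) x)) \<longlonglongrightarrow> \<phi> (target \<rho> x)"
        by (rule continuous_on_tendsto_compose[OF \<phi>(1)]) simp_all
    qed
  qed (use \<phi> in auto)
  have int_lim: "(\<lambda>n. LINT P|\<eta>. \<phi> (p (k n) P)) \<longlonglongrightarrow> (LINT P|\<eta>. \<phi> P)"
    if \<phi>: "continuous_on UNIV \<phi>" "\<And>P. \<bar>\<phi> P\<bar> \<le> B" for \<phi> :: "point \<Rightarrow> real" and B
  proof (rule integral_dominated_convergence[where w = "\<lambda>_. B"])
    have m: "\<phi> \<in> borel_measurable borel" using \<phi> by (intro borel_measurable_continuous_onI)
    show "\<phi> \<in> borel_measurable \<eta>" by (rule measurable_\<eta>[OF m])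
    show "(\<lambda>P. \<phi> (p (k n) P)) \<in> borel_measurable \<eta>" for n
      by (rule measurable_\<eta>[OF measurable_compose[OF p m]])
    show "integrable \<eta> (\<lambda>_. B)" by (rule integrable_const)
    show "AE P in \<eta>. norm (\<phi> (p (k n) P)) \<le> B" for n
      unfolding real_norm_def by (intro AE_I2 \<phi>(2))
    show "AE P in \<eta>. (\<lambda>n. \<phi> (p (k n) P)) \<longlonglongrightarrow> \<phi> P"
    proof (rule AE_I2)
      fix P assume "P \<in> space \<eta>"
      then have P: "P \<in> D" by (simp add: space_\<eta>)
      have "(\<lambda>n. p n P) \<longlonglongrightarrow> P"
      proof (rule tendsto_dist_iff[THEN iffD2, OF tendsto_sandwich, OF _ _ tendsto_const LIMSEQ_inverse_real_of_nat])
        show "\<forall>\<^sub>F n in sequentially. dist (p n P) P \<le> inverse (real (Suc n))"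
          by (intro always_eventually allI less_imp_le near P)
      qed simp
      from LIMSEQ_subseq_LIMSEQ[OF this k] have "(\<lambda>n. p (k n) P) \<longlonglongrightarrow> P"
        unfolding o_def .
      then show "(\<lambda>n. \<phi> (p (k n) P)) \<longlonglongrightarrow> \<phi> P"
        by (rule continuous_on_tendsto_compose[OF \<phi>(1)]) simp_all
    qed
  qed
  have sol': "energy (r n) \<phi> = (LINT P|\<eta>. \<phi> (p n P)) + b n * \<phi> P0" if "continuous_on UNIV \<phi>" for \<phi> n
    using sol[of n] borel_measurable_continuous_onI[OF that] by (simp add: solves_def)
  \<comment> \<open>Testing with the constant 1 expresses the point masses through the energies, so
    they converge without passing to a further subsequence.\<close>
  define c where "c = energy \<rho> (\<lambda>_. 1) - measure \<eta> D"
  have "(\<lambda>n. energy (r (k n)) (\<lambda>_. 1) - measure \<eta> D) \<longlonglongrightarrow> c"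
    unfolding c_def by (intro tendsto_intros en_lim[where B = 1]) auto
  then have c_lim: "(\<lambda>n. b (k n)) \<longlonglongrightarrow> c" by (simp add: sol' space_\<eta>)
  show thesis
  proof (rule that[OF \<rho>])
    show "\<rho> x \<le> polar_radius P0 \<kappa> x" if "x \<in> X" for x
      using ub[OF that] by (intro LIMSEQ_le_const2[OF lim[OF that]]) blast
    show "0 \<le> c" using b by (intro LIMSEQ_le_const[OF c_lim]) blast
    fix \<phi> :: "point \<Rightarrow> real" and B assume \<phi>: "continuous_on UNIV \<phi>" "\<And>P. \<bar>\<phi> P\<bar> \<le> B"
    have "(\<lambda>n. (LINT P|\<eta>. \<phi> (p (k n) P)) + b (k n) * \<phi> P0) \<longlonglongrightarrow> (LINT P|\<eta>. \<phi> P) + c * \<phi> P0"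
      by (intro tendsto_intros int_lim[OF \<phi>] c_lim)
    then show "energy \<rho> \<phi> = (LINT P|\<eta>. \<phi> P) + c * \<phi> P0"
      using LIMSEQ_unique[OF en_lim[OF \<phi>]] sol'[OF \<phi>(1)] by simp
  qed
qed

text \<open>Continuous cut-offs decrease to the indicator of a closed set; the closed sets are an
  intersection-stable generator of the Borel sets.\<close>

lemma transported_measure_unique:
  assumes \<rho>: "admissible \<rho>"
    and eq: "\<And>\<phi> B. continuous_on UNIV \<phi> \<Longrightarrow> (\<And>P. \<bar>\<phi> P\<bar> \<le> B) \<Longrightarrow> energy \<rho> \<phi> = (LINT P|\<eta>. \<phi> P) + c * \<phi> P0"
    and E: "E \<in> sets borel"
  shows "energy \<rho> (indicat_real E) = measure \<eta> (E \<inter> D) + c * indicator E P0"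
proof -
  have one: "energy \<rho> (\<lambda>_. 1) = measure \<eta> D + c"
    using eq[of "\<lambda>_. 1" 1] by (simp add: space_\<eta>)
  have "Int_stable (Collect closed :: point set set)" by (auto simp: Int_stable_def)
  moreover have "Collect closed \<subseteq> Pow (UNIV :: point set)" by simp
  moreover have borel: "sets borel = sigma_sets UNIV (Collect closed :: point set set)"
    by (subst borel_eq_closed) simp
  then have "E \<in> sigma_sets UNIV (Collect closed)" using E by simp
  ultimately show ?thesis
  proof (induction E rule: sigma_sets_induct_disjoint)
    case (basic C)
    then have C: "closed C" by simp
    show ?case
    \<comment> \<open>\<open>infdist\<close> to the empty set is 0 by convention, so the cut-offs
      below would not vanish.\<close>
    proof (cases "C = {}")
      case True
      then show ?thesis by (simp add: energy_def)
    next
      case False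
      define \<phi> where "\<phi> n P = max 0 (1 - real n * infdist P C)" for n P
      have cont: "continuous_on UNIV (\<phi> n)" for n
        unfolding \<phi>_def by (intro continuous_intros)
      have B: "\<bar>\<phi> n P\<bar> \<le> 1" for n P
        by (simp add: \<phi>_def infdist_nonneg)
      have m: "\<phi> n \<in> borel_measurable borel" for n
        by (rule borel_measurable_continuous_onI[OF cont])
      have lim: "(\<lambda>n. \<phi> n P) \<longlonglongrightarrow> indicat_real C P" for P
      proof (cases "P \<in> C")
        case True
        then show ?thesis by (simp add: \<phi>_def)
      next
        case out: False
        then have pos: "0 < infdist P C"
          using in_closed_iff_infdist_zero[OF C False, of P] infdist_nonneg[of P C] by linarith
        obtain N where N: "1 / infdist P C < real N" using reals_Archimedean2 by blast
        have "\<phi> n P = 0" if "n \<ge> N" for n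
        proof -
          have "1 / infdist P C \<le> real n" using N that by linarith
          then have "1 \<le> real n * infdist P C" using pos by (simp add: field_simps)
          then show ?thesis by (simp add: \<phi>_def)
        qed
        then have "\<forall>\<^sub>F n in sequentially. \<phi> n P = indicat_real C P"
          using out by (auto simp: eventually_sequentially)
        then show ?thesis by (rule tendsto_eventually)
      qed
      have mC: "indicat_real C \<in> borel_measurable borel" using C by (intro borel_measurable_indicator borel_closed)
      have "(\<lambda>n. LINT P|\<eta>. \<phi> n P) \<longlonglongrightarrow> (LINT P|\<eta>. indicat_real C P)"
        by (rule integral_dominated_convergence[where w = "\<lambda>_. 1"])
          (use lim B in \<open>auto intro: measurable_\<eta> m mC\<close>)
      also have "(LINT P|\<eta>. indicat_real C P) = (LINT P|\<eta>. indicat_real (C \<inter> D) P)"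
        by (intro Bochner_Integration.integral_cong) (auto simp: space_\<eta> indicator_def)
      also have "\<dots> = measure \<eta> (C \<inter> D)"
        by (simp add: space_\<eta> Int_absorb2)
      finally have "(\<lambda>n. (LINT P|\<eta>. \<phi> n P) + c * \<phi> n P0) \<longlonglongrightarrow> measure \<eta> (C \<inter> D) + c * indicator C P0"
        by (intro tendsto_intros lim)
      then show ?thesis
        using LIMSEQ_unique[OF energy_limit_fun[OF \<rho> m mC B lim]] eq[OF cont B] by simp
    qed
  next
    case empty
    then show ?case by (simp add: energy_def)
  next
    case (compl A)
    then have A: "A \<in> sets borel" by (simp add: borel)
    have "energy \<rho> (\<lambda>P. indicat_real (UNIV - A) P + indicat_real A P) = energy \<rho> (indicat_real (UNIV - A)) + energy \<rho> (indicat_real A)"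
      by (rule energy_add[OF \<rho>, where B = 1 and B' = 1]) (use A in auto)
    moreover have "(\<lambda>P. indicat_real (UNIV - A) P + indicat_real A P) = (\<lambda>_. 1)"
      by (auto simp: fun_eq_iff indicator_def)
    moreover have "measure \<eta> ((UNIV - A) \<inter> D) = measure \<eta> D - measure \<eta> (A \<inter> D)"
      using finite_measure_compl[OF sets_\<eta>_Int[OF A]] by (simp add: space_\<eta> Diff_Int2 Int_commute Diff_Int_distrib)
    moreover have "indicat_real (UNIV - A) P0 = 1 - indicat_real A P0" by (simp add: indicator_def)
    ultimately show ?case using compl(2) one by (simp only: right_diff_distrib)
  next
    case (union A)
    then have A: "A i \<in> sets borel" for i by (auto simp: borel)
    have "(\<lambda>i. measure \<eta> (A i \<inter> D)) sums measure \<eta> (\<Union>i. A i \<inter> D)"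
      by (rule finite_measure_UNION) (use A union(1) sets_\<eta>_Int in \<open>auto simp: disjoint_family_on_def\<close>)
    moreover have "(\<lambda>i. indicat_real (A i) P0) sums indicat_real (\<Union>i. A i) P0"
      by (rule indicator_sums) (use union(1) in \<open>auto simp: disjoint_family_on_def\<close>)
    ultimately have "(\<lambda>i. measure \<eta> (A i \<inter> D) + c * indicat_real (A i) P0) sums
        (measure \<eta> (\<Union>i. A i \<inter> D) + c * indicat_real (\<Union>i. A i) P0)"
      by (intro sums_add sums_mult)
    then show ?case
      using sums_unique2[OF energy_indicator_UN_sums[OF \<rho> A union(1)]] union(3) by simp
  qed
qed

lemma ex_solution:
  "\<exists>\<rho> c. admissible \<rho> \<and> (\<forall>x\<in>X. \<rho> x \<le> polar_radius P0 \<kappa> x) \<and> 0 \<le> c \<and>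
    (\<forall>E\<in>sets borel. energy \<rho> (indicat_real E) = measure \<eta> (E \<inter> D) + c * indicator E P0)"
proof (rule limit_solution)
  fix \<rho> c
  assume \<rho>: "admissible \<rho>" "\<And>x. x \<in> X \<Longrightarrow> \<rho> x \<le> polar_radius P0 \<kappa> x" "0 \<le> c"
    and weak: "\<And>\<phi> B. continuous_on UNIV \<phi> \<Longrightarrow> (\<And>P. \<bar>\<phi> P\<bar> \<le> B) \<Longrightarrow> energy \<rho> \<phi> = (LINT P|\<eta>. \<phi> P) + c * \<phi> P0"
  have "\<forall>E\<in>sets borel. energy \<rho> (indicat_real E) = measure \<eta> (E \<inter> D) + c * indicator E P0"
    by (intro ballI transported_measure_unique[OF \<rho>(1)] weak)
  then show ?thesis using \<rho> by blast
qed

end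

section \<open>Choice of the constants and reduction of the hypotheses\<close>

lemma AE_interior_of_closure:
  assumes "\<Omega> \<subseteq> S2" "emeasure surface ((top_of_set S2) frontier_of \<Omega>) = 0"
  shows "AE x in surface. x \<in> closure \<Omega> \<longrightarrow> x \<in> (top_of_set S2) interior_of (closure \<Omega>)"
proof -
  let ?F = "(top_of_set S2) frontier_of \<Omega>"
  have cl: "(top_of_set S2) closure_of \<Omega> = closure \<Omega>"
    using assms(1) closure_minimal[OF assms(1) closed_sphere]
    by (simp add: closure_of_subtopology Int_absorb1)
  have "closedin (top_of_set S2) ?F" by (rule closedin_frontier_of)
  then have "closed ?F" using closedin_closed_trans[OF _ closed_sphere] by blast
  then have "?F \<in> sets surface"
    using frontier_of_subset_topspace[of "top_of_set S2" \<Omega>] by (intro sets_surface_borel) auto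
  then have "?F \<in> null_sets surface" using assms(2) by auto
  from AE_not_in[OF this] show ?thesis
  proof eventually_elim
    case (elim x)
    have "(top_of_set S2) interior_of \<Omega> \<subseteq> (top_of_set S2) interior_of (closure \<Omega>)"
      by (intro interior_of_mono closure_subset)
    then show ?case using elim by (auto simp: frontier_of_def cl)
  qed
qed

theorem theorem5p1:
  fixes D \<Omega> :: "point set" and M \<delta> k :: real
    and f :: "point \<Rightarrow> real" and \<eta> :: "point measure"
  assumes "compact D" and "0 \<notin> D"
    and "(\<exists>a b. a \<noteq> 0 \<and> D \<subseteq> {x. a \<bullet> x = b}) \<or> countable D"
    and "\<exists>P\<in>D. norm P = M" and "\<forall>P\<in>D. norm P \<le> M"
    and "\<Omega> \<subseteq> S2" and "emeasure surface ((top_of_set S2) frontier_of \<Omega>) = 0"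
    and "set_integrable surface (closure \<Omega>) f"
    and "AE x\<in>closure \<Omega> in surface. f x > 0"
    and "radon_measure_on D \<eta>"
    and "\<delta> > 0" and "k \<ge> (1 + c_ecc \<delta>) / (1 - c_ecc \<delta>)"
    and "(LINT x:closure \<Omega>|surface. f x) \<ge> 1 / C_const \<delta> (k * \<delta>) M * measure \<eta> D"
  shows "\<forall>P\<^sub>0 \<in> measure_support D \<eta>. \<exists>\<rho> \<in> reflector_class (closure \<Omega>) D M \<delta>.
      (\<forall>E\<in>sets borel. E \<subseteq> D \<longrightarrow>
         set_integrable surface (tau (closure \<Omega>) \<rho> E) (illum_density (closure \<Omega>) f \<rho>) \<and>
         measure \<eta> E \<le> (LINT x:tau (closure \<Omega>) \<rho> E|surface. illum_density (closure \<Omega>) f \<rho> x)) \<and>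
      (\<forall>E\<in>sets borel. E \<subseteq> D \<and> P\<^sub>0 \<notin> E \<longrightarrow>
         measure \<eta> E = (LINT x:tau (closure \<Omega>) \<rho> E|surface. illum_density (closure \<Omega>) f \<rho> x)) \<and>
      (\<forall>x\<in>closure \<Omega>. \<delta> * M / (1 + c_ecc \<delta>) \<le> \<rho> x \<and> \<rho> x \<le> k * \<delta> * M / (1 - c_ecc \<delta>))"
proof
  fix P0 assume P0: "P0 \<in> measure_support D \<eta>"
  let ?X = "closure \<Omega>" and ?c = "c_ecc \<delta>"
  \<comment> \<open>\<open>lo\<close> is the bound required by the class, \<kappa> the pinned
    parameter of \<open>P0\<close>. For \<open>hi\<close> it only matters that hi / 2, a lower bound
    for the radius, strictly exceeds the largest radius of the pinned ellipsoid.\<close>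
  define lo \<kappa> hi where "lo = \<delta> * M" and "\<kappa> = k * \<delta> * M" and "hi = 2 * (\<kappa> / (1 - ?c)) + 1"
  have c: "0 < ?c" "?c < 1" using c_ecc_pos[of \<delta>] c_ecc_less_1[OF \<open>\<delta> > 0\<close>] by auto
  have nz: "P \<noteq> 0" if "P \<in> D" for P using that \<open>0 \<notin> D\<close> by auto
  then have "M > 0" using assms(4) by auto
  then have lo: "lo > 0" using \<open>\<delta> > 0\<close> by (simp add: lo_def)
  have "1 \<le> (1 + ?c) / (1 - ?c)" using c by simp
  then have k: "1 \<le> k" using assms(12) by linarith
  have \<kappa>lo: "lo \<le> \<kappa>" using k lo mult_right_mono[of 1 k lo] by (simp add: \<kappa>_def lo_def mult.assoc)
  then have \<kappa>: "0 < \<kappa>" using lo by simp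
  \<comment> \<open>This is exactly the hypothesis on \<open>k\<close>: the largest radius at
    parameter \<open>lo\<close> does not exceed the lower bound for the pinned ellipsoid.\<close>
  have ratio: "lo / (1 - ?c) \<le> \<kappa> / (1 + ?c)"
  proof -
    have "(1 + ?c) / (1 - ?c) * lo \<le> k * lo" using assms(12) lo by (intro mult_right_mono) auto
    then have "(1 + ?c) * lo / (1 - ?c) \<le> \<kappa>" by (simp add: \<kappa>_def lo_def mult.assoc)
    then show ?thesis using c by (simp add: field_simps)
  qed
  have "\<kappa> \<le> \<kappa> / (1 - ?c)" using \<kappa> c by (simp add: field_simps)
  moreover have "hi = 2 * B + 1 \<Longrightarrow> \<kappa> \<le> B \<Longrightarrow> \<kappa> \<le> hi \<and> B < hi / 2 \<and> 0 < hi" for B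
    using \<kappa> by simp
  ultimately have hi: "\<kappa> \<le> hi" "\<kappa> / (1 - ?c) < hi / 2" "0 < hi"
    using hi_def by blast+
  have X: "compact ?X" "?X \<subseteq> S2"
    using closure_minimal[OF \<open>\<Omega> \<subseteq> S2\<close> closed_sphere] compact_Int_closed[OF compact_sphere closed_closure, of 0 1 \<Omega>]
    by (auto simp: Int_absorb1)
  have Xn: "norm x = 1" if "x \<in> ?X" for x using X that by auto
  \<comment> \<open>As norm P <= M, the ratio d / norm P is at least \<delta>, and the eccentricity
    decreases in this ratio.\<close>
  have foc: "norm (focal P d) \<le> ?c" if "P \<in> D" "lo \<le> d" for P d
  proof -
    have "\<delta> * norm P \<le> \<delta> * M" using that assms(5) \<open>\<delta> > 0\<close> by (intro mult_left_mono) auto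
    then have "\<delta> \<le> d / norm P" using that nz[OF that(1)] by (simp add: lo_def field_simps)
    then show ?thesis using nz[OF that(1)] \<open>\<delta> > 0\<close> by (simp add: norm_focal c_ecc_antimono)
  qed
  have P0D: "P0 \<in> D" using P0 by (simp add: measure_support_def)
  have ub: "polar_radius P0 \<kappa> x \<le> \<kappa> / (1 - ?c)" if "x \<in> ?X" for x
    using P0D \<kappa> \<kappa>lo c that by (intro polar_radius_le nz Xn foc) auto
  have sets: "sets \<eta> = sets (restrict_space borel D)" using assms(10) by (simp add: radon_measure_on_def)
  have "emeasure \<eta> D < \<infinity>" using assms(1,10) by (auto simp: radon_measure_on_def)
  then have fin: "finite_measure \<eta>"
    using sets_eq_imp_space_eq[OF sets] by (intro finite_measureI) (simp add: space_restrict_space)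
  interpret N: near_field ?X D lo hi f
    using assms(9) by unfold_locales (use X assms lo in \<open>auto elim!: eventually_mono\<close>)
  have Cpos: "0 < C_const \<delta> (k * \<delta>) M"
    unfolding C_const_def using c k \<open>\<delta> > 0\<close> \<open>M > 0\<close>
    by (intro divide_pos_pos mult_pos_pos zero_less_power) auto
  have total: "measure \<eta> D \<le> N.energy \<rho> (\<lambda>_. 1)"
    if adm: "N.admissible \<rho>" and le: "\<And>x. x \<in> ?X \<Longrightarrow> \<rho> x \<le> polar_radius P0 \<kappa> x" for \<rho>
  proof -
    have "C_const \<delta> (k * \<delta>) M \<le> N.weight \<rho> x" if x: "x \<in> ?X" for x
    proof -
      note s = N.sel[OF adm x]
      have "(1 - ?c) / ((1 + ?c) * (\<kappa> / (1 - ?c))\<^sup>2) \<le> N.weight \<rho> x"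
        unfolding N.weight_def
      proof (rule illum_weight_ge)
        show "polar_radius (fst (N.sel \<rho> x)) (snd (N.sel \<rho> x)) x \<le> \<kappa> / (1 - ?c)"
          using supports_atD(3)[OF s(3)] le[OF x] ub[OF x] by simp
      qed (use s lo c nz foc Xn[OF x] in auto)
      also have "(1 - ?c) / ((1 + ?c) * (\<kappa> / (1 - ?c))\<^sup>2) = C_const \<delta> (k * \<delta>) M"
        using c by (simp add: C_const_def \<kappa>_def power_divide power2_eq_square power3_eq_cube)
      finally show ?thesis .
    qed
    from N.energy_ge[OF adm this] have "C_const \<delta> (k * \<delta>) M * (LINT x:?X|surface. f x) \<le> N.energy \<rho> (\<lambda>_. 1)" .
    moreover have "measure \<eta> D \<le> C_const \<delta> (k * \<delta>) M * (LINT x:?X|surface. f x)"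
      using assms(13) Cpos by (simp add: field_simps)
    ultimately show ?thesis by simp
  qed
  interpret near_field_measure ?X D lo hi f \<eta> P0 \<kappa>
  proof (intro near_field_measure.intro near_field_measure_axioms.intro)
    show "near_field ?X D lo f" by unfold_locales
    show "polar_radius Q lo x \<le> polar_radius P0 \<kappa> x" if "Q \<in> D" "x \<in> ?X" for Q x
    proof -
      have "polar_radius Q lo x \<le> lo / (1 - ?c)"
        using that lo c by (intro polar_radius_le nz Xn foc) auto
      also note ratio
      also have "\<kappa> / (1 + ?c) \<le> polar_radius P0 \<kappa> x"
        using that P0D \<kappa> \<kappa>lo by (intro polar_radius_ge nz Xn foc) auto
      finally show ?thesis .
    qed
    show "polar_radius P0 \<kappa> x < polar_radius Q hi x" if "Q \<in> D" "x \<in> ?X" for Q x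
      using ub[OF that(2)] hi polar_radius_ge_half[OF nz[OF that(1)] hi(3) Xn[OF that(2)]] by linarith
  qed (use fin sets P0 \<kappa>lo hi total in auto)
  obtain \<rho> m where \<rho>: "N.admissible \<rho>" and le: "\<And>x. x \<in> ?X \<Longrightarrow> \<rho> x \<le> polar_radius P0 \<kappa> x" and m: "0 \<le> m"
    and transported: "\<And>E. E \<in> sets borel \<Longrightarrow> N.energy \<rho> (indicat_real E) = measure \<eta> (E \<inter> D) + m * indicator E P0"
    using ex_solution by blast
  note int = AE_interior_of_closure[OF assms(6,7)]
  \<comment> \<open>The point mass at \<open>P0\<close> yields both claims: it is nonnegative, and
    it disappears when \<open>P0\<close> is not in \<open>E\<close>.\<close>
  have eq: "(LINT x:tau ?X \<rho> E|surface. illum_density ?X f \<rho> x) = measure \<eta> E + m * indicator E P0"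
    if "E \<in> sets borel" "E \<subseteq> D" for E
    using N.tau_energy(2)[OF \<rho> that int] transported[OF that(1)] that(2)
    by (simp add: Int_absorb2)
  have cls: "\<rho> \<in> reflector_class ?X D M \<delta>"
  proof -
    have 1: "\<exists>P\<in>D. \<exists>d. supports_at ?X \<rho> P d x \<and> \<delta> * M \<le> d" if "x \<in> ?X" for x
      using N.sel[OF \<rho> that] by (auto simp: lo_def)
    moreover have "0 < \<rho> x" if "x \<in> ?X" for x
      by (rule reflector_data.rho_pos[OF N.admissibleD[OF \<rho>] that])
    ultimately show ?thesis unfolding reflector_class_def reflector_def by blast
  qed
  have bounds: "\<delta> * M / (1 + ?c) \<le> \<rho> x \<and> \<rho> x \<le> k * \<delta> * M / (1 - ?c)" if x: "x \<in> ?X" for x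
  proof
    note s = N.sel[OF \<rho> x]
    have "lo / (1 + ?c) \<le> snd (N.sel \<rho> x) / (1 + ?c)" using s(2) c by (intro divide_right_mono) auto
    also have "\<dots> \<le> \<rho> x"
      unfolding supports_atD(3)[OF s(3)] using s lo x by (intro polar_radius_ge nz Xn foc) auto
    finally show "\<delta> * M / (1 + ?c) \<le> \<rho> x" by (simp add: lo_def)
    show "\<rho> x \<le> k * \<delta> * M / (1 - ?c)" using le[OF x] ub[OF x] by (simp add: \<kappa>_def)
  qed
  show "\<exists>\<rho> \<in> reflector_class ?X D M \<delta>.
      (\<forall>E\<in>sets borel. E \<subseteq> D \<longrightarrow>
         set_integrable surface (tau ?X \<rho> E) (illum_density ?X f \<rho>) \<and>
         measure \<eta> E \<le> (LINT x:tau ?X \<rho> E|surface. illum_density ?X f \<rho> x)) \<and>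
      (\<forall>E\<in>sets borel. E \<subseteq> D \<and> P0 \<notin> E \<longrightarrow>
         measure \<eta> E = (LINT x:tau ?X \<rho> E|surface. illum_density ?X f \<rho> x)) \<and>
      (\<forall>x\<in>?X. \<delta> * M / (1 + ?c) \<le> \<rho> x \<and> \<rho> x \<le> k * \<delta> * M / (1 - ?c))"
  proof (intro bexI[OF _ cls] conjI ballI impI)
    fix E assume E: "E \<in> sets borel" "E \<subseteq> D"
    show "set_integrable surface (tau ?X \<rho> E) (illum_density ?X f \<rho>)"
      by (rule N.tau_energy(1)[OF \<rho> E int])
    show "measure \<eta> E \<le> (LINT x:tau ?X \<rho> E|surface. illum_density ?X f \<rho> x)"
      unfolding eq[OF E] using m by simp
  next
    fix E assume "E \<in> sets borel" "E \<subseteq> D \<and> P0 \<notin> E"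
    then show "measure \<eta> E = (LINT x:tau ?X \<rho> E|surface. illum_density ?X f \<rho> x)"
      by (simp add: eq)
  qed (use bounds in auto)
qed

end
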